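(* Suppose the induced MDP is semicontinuous, and that the following hold. Slater condition: there exists $\mu\in\mathcal D$ such that $\int_{\mathbf V\times\mathbf B}\bar C_j(x,b)\mu(dx\times db)<d_j$ for all $j=1,\dots,J$. Cost conditions: there is $\delta>0$ with $C^I_0(x,a)\ge\delta$ for all $x\in\mathbf X$, $a\in\mathbf A$; and $\max_{0\le j\le J}\sup_{x\in\mathbf X}C^g_j(x)+\max_{0\le j\le J}\sup_{(x,a)\in\mathbf X\times\mathbf A}C^I_j(x,a)<\infty$. Then the following assertions hold. (a) For each fixed $\bar g\in\mathbb R_+^J$, the Bellman function $W^*_{\bar g}$ is bounded, non-negative and lower semicontinuous on $\mathbf V$, and it solves problem $(LP_{\bar g})$, with $val(LP_{\bar g})=W^*_{\bar g}(x_0)$. (b) For each $\bar g\in\mathbb R_+^J$, $W^*_{\bar g}(x_0)-\sum_{j=1}^Jg_jd_j=h(\bar g)$. Thus, a maximizer $\bar g^*\in\mathbb R_+^J$ for $$\max_{\bar g\in\mathbb R_+^J}\left\{\max_{W\in\mathbb B(\mathbf V)}\inf_{\mu\in\mathcal M^{<\infty}(\mathbf V\times\mathbf B)}L_2(\mu,W,\bar g)\right\}=\max_{\bar g\in\mathbb R_+^J}h(\bar g)$$ exists. (c) For such a maximizer $\bar g^*$, the pair $(W^*_{\bar g^*},\bar g^* )$ is a solution to the dual program: maximize $\inf_{\mu\in\mathcal M^{<\infty}(\mathbf V\times\mathbf B)}L_2(\mu,W,\bar g)$ over $(W,\bar g)\in\mathbb B(\mathbf V)\times\mathbb R_+^J$.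 (d) There is no duality gap: $$\inf_{\mu\in\mathcal M^{<\infty}(\mathbf V\times\mathbf B)}\ \sup_{(W,\bar g)\in\mathbb B(\mathbf V)\times\mathbb R_+^J}L_2(\mu,W,\bar g)=\sup_{(W,\bar g)\in\mathbb B(\mathbf V)\times\mathbb R_+^J}\ \inf_{\mu\in\mathcal M^{<\infty}(\mathbf V\times\mathbf B)}L_2(\mu,W,\bar g).$$
   Context: Impulse control model. $\mathbf X$ and $\mathbf A$ are nonempty Borel subsets of complete separable metric spaces; measurability means Borel measurability. $\phi:\mathbf X\times[0,\infty)\to\mathbf X$ is measurable with $\phi(x,0)=x$, $\lim_{t\downarrow0}\phi(\phi(x,s),t)=\phi(x,s)$ and $\phi(x,s+t)=\phi(\phi(x,s),t)$ for all $x\in\mathbf X$, $s,t\ge0$. $l:\mathbf X\times\mathbf A\to\mathbf X$ is measurable; $\alpha\in(0,\infty)$; $J\ge0$ is an integer; for $j=0,\dots,J$, $C^g_j:\mathbf X\to[0,\infty]$ and $C^I_j:\mathbf X\times\mathbf A\to[0,\infty]$ are measurable; $d_1,\dots,d_J\in[0,\infty)$ are constants. Measures are $[0,\infty]$-valued; $\mathbb R_+^J=[0,\infty)^J$; $0\times\infty=0$. Induced MDP. State space $\mathbf X_\Delta=\mathbf X\cup\{\Delta\}$ with $\Delta\notin\mathbf X$ an isolated point; action space $\mathbf B=[0,\infty]\times\mathbf A$, where $[0,\infty]$ is the one-point compactification of $[0,\infty)$; transition kernel $Q(dy|x,(\theta,a))=e^{-\alpha\theta}\delta_{l(\phi(x,\theta),a)}(dy)+(1-e^{-\alpha\theta})\delta_\Delta(dy)$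 if $x\ne\Delta$, $\theta\neq\infty$, and $\delta_\Delta(dy)$ otherwise; costs $\bar C_j(x,(\theta,a))=\int_0^\theta e^{-\alpha t}C^g_j(\phi(x,t))\,dt+e^{-\alpha\theta}C^I_j(\phi(x,\theta),a)$ for $x\in\mathbf X$ (the last term being $0$ if $\theta=\infty$), and $\bar C_j(\Delta,\cdot)=0$. Strategies. A strategy $\pi=\{\pi_i\}_{i\ge1}$ is a sequence of stochastic kernels $\pi_i(db|h_{i-1})$ on $\mathbf B$ given histories $h_{i-1}=(x_0,b_1,x_1,\dots,b_{i-1},x_{i-1})$. $\mathsf P^\pi_x$, $\mathsf E^\pi_x$ denote the probability and expectation on $(\mathbf X_\Delta\times\mathbf B)^\infty$, with coordinates $X_0,B_1,X_1,B_2,\dots$, under which $X_0=x$, $B_i$ has conditional law $\pi_i(\cdot|H_{i-1})$ given the history $H_{i-1}=(X_0,B_1,\dots,X_{i-1})$, and $X_i$ has conditional law $Q(\cdot|X_{i-1},B_i)$ given $(H_{i-1},B_i)$. For a cost $\bar C$, $\mathcal V(x,\pi,\bar C)=\mathsf E^\pi_x[\sum_{i=1}^\infty\bar C(X_{i-1},B_i)]$. The induced MDP is semicontinuous if $\mathbf B$ is compact, $(x,b)\mapsto\int_{\mathbf X_\Delta}u(y)Q(dy|x,b)$ is continuous for every bounded continuous $u$ on $\mathbf X_\Delta$, and each $\bar C_j$ is lower semicontinuous on $\mathbf X_\Delta\times\mathbf B$. Let $\mathbf V=\{x\in\mathbf X_\Delta:\inf_\pi\mathcal V(x,\pi,\sum_{j=0}^J\bar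 C_j)>0\}$. Standing assumption: the fixed initial state $x_0$ lies in $\mathbf V$. $\mathbb B(\mathbf V)$ is the space of bounded measurable real functions on $\mathbf V$, and $\mathcal M^{<\infty}(\mathbf V\times\mathbf B)$ is the set of finite measures on $\mathbf V\times\mathbf B$. $\mathcal D$ is the set of measures $\mu$ on $\mathbf V\times\mathbf B$ such that the marginal $\mu(dx\times\mathbf B)$ is $\sigma$-finite on $\mathbf V$; $\mu(\Gamma\times\mathbf B)=\delta_{x_0}(\Gamma)+\int_{\mathbf V\times\mathbf B}Q(\Gamma|y,b)\mu(dy\times db)$ for all $\Gamma\in\mathcal B(\mathbf V)$; and $\int_{\mathbf V\times\mathbf B}\sum_{j=0}^J\bar C_j\,d\mu<\infty$. $L_1(\mu,\bar g)=\int_{\mathbf V\times\mathbf B}\bar C_0\,d\mu+\sum_{j=1}^Jg_j\left(\int_{\mathbf V\times\mathbf B}\bar C_j\,d\mu-d_j\right)$ for $\mu\in\mathcal D$, $\bar g=(g_1,\dots,g_J)\in\mathbb R_+^J$, and $h(\bar g)=\inf_{\mu\in\mathcal D}L_1(\mu,\bar g)$. For $(\mu,W,\bar g)\in\mathcal M^{<\infty}(\mathbf V\times\mathbf B)\times\mathbb B(\mathbf V)\times\mathbb R_+^J$, $$L_2(\mu,W,\bar g)=\int_{\mathbf V\times\mathbf B}\bar C_0\,d\mu+\int_{\mathbf V}W(x)\Big[\delta_{x_0}(dx)+\int_{\mathbf V\times\mathbf B}Q(dx|y,b)\mu(dy\times db)-\mu(dx\times\mathbf B)\Big]+\sum_{j=1}^Jg_j\Big(\int_{\mathbf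 V\times\mathbf B}\bar C_j\,d\mu-d_j\Big).$$ Bellman function: $W^*_{\bar g}(x)=\inf_\pi\{\mathcal V(x,\pi,\bar C_0)+\sum_{j=1}^Jg_j\mathcal V(x,\pi,\bar C_j)\}$, $x\in\mathbf V$. Problem $(LP_{\bar g})$: maximize $W(x_0)$ over $W\in\mathbb B(\mathbf V)$ subject to $\bar C_0(x,b)+\sum_{j=1}^Jg_j\bar C_j(x,b)+\int_{\mathbf V}W(y)Q(dy|x,b)-W(x)\ge0$ for all $(x,b)\in\mathbf V\times\mathbf B$; $val(LP_{\bar g})$ is its optimal value. *)

theory Defs
  imports "HOL-Probability.Probability"
begin

section \<open>Borel spaces and semicontinuity over abstract topologies\<close>

definition borel_of :: "'a topology \<Rightarrow> 'a measure" where
  "borel_of T = sigma (topspace T) {U. openin T U}"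

definition lower_semicontinuous_map :: "'a topology \<Rightarrow> ('a \<Rightarrow> 'b::linorder) \<Rightarrow> bool" where
  "lower_semicontinuous_map T f \<longleftrightarrow> (\<forall>c. openin T {x \<in> topspace T. c < f x})"

lemma space_borel_of[simp]: "space (borel_of T) = topspace T"
  unfolding borel_of_def by (rule space_measure_of) (auto dest: openin_subset)

lemma sets_borel_of: "sets (borel_of T) = sigma_sets (topspace T) {U. openin T U}"
  unfolding borel_of_def by (rule sets_measure_of) (auto dest: openin_subset)

lemma openin_in_borel_of: "openin T U \<Longrightarrow> U \<in> sets (borel_of T)"
  unfolding sets_borel_of by auto

section \<open>The impulse control model\<close>

record ('x, 'a) impulse_model =
  states :: "'x set"
  actions :: "'a set"
  flow :: "'x \<Rightarrow> real \<Rightarrow> 'x"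
  jump :: "'x \<Rightarrow> 'a \<Rightarrow> 'x"
  discount :: real
  num_constraints :: nat
  gradual_cost :: "nat \<Rightarrow> 'x \<Rightarrow> ennreal"
  impulse_cost :: "nat \<Rightarrow> 'x \<Rightarrow> 'a \<Rightarrow> ennreal"
  constraint_bound :: "nat \<Rightarrow> real"

definition valid_model :: "('x::polish_space, 'a::polish_space) impulse_model \<Rightarrow> bool" where
  "valid_model M \<longleftrightarrow>
     states M \<in> sets borel \<and> states M \<noteq> {} \<and>
     actions M \<in> sets borel \<and> actions M \<noteq> {} \<and>
     (\<lambda>(x, t). flow M x t) \<in>
       restrict_space borel (states M \<times> {0..}) \<rightarrow>\<^sub>M restrict_space borel (states M) \<and>
     (\<forall>x\<in>states M. flow M x 0 = x) \<and>
     (\<forall>x\<in>states M. \<forall>s\<ge>0. ((\<lambda>t. flow M (flow M x s) t) \<longlongrightarrow> flow M x s) (at_right 0)) \<and>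
     (\<forall>x\<in>states M. \<forall>s\<ge>0. \<forall>t\<ge>0. flow M x (s + t) = flow M (flow M x s) t) \<and>
     (\<lambda>(x, a). jump M x a) \<in>
       restrict_space borel (states M \<times> actions M) \<rightarrow>\<^sub>M restrict_space borel (states M) \<and>
     0 < discount M \<and>
     (\<forall>j\<le>num_constraints M.
        gradual_cost M j \<in> borel_measurable (restrict_space borel (states M)) \<and>
        (\<lambda>(x, a). impulse_cost M j x a)
          \<in> borel_measurable (restrict_space borel (states M \<times> actions M))) \<and>
     (\<forall>j\<in>{1..num_constraints M}. 0 \<le> constraint_bound M j)"

section \<open>The induced Markov decision process\<close>

text \<open>The cemetery is \<^term>\<open>None\<close>. Since a set is open as soon as its trace on the state
  space is open, \<^term>\<open>None\<close> is an isolated point.\<close>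

definition state_top :: "('x::polish_space, 'a) impulse_model \<Rightarrow> 'x option topology" where
  "state_top M = topology (\<lambda>U. openin (top_of_set (states M)) (Some -` U))"

lemma openin_state_top:
  "openin (state_top M) U \<longleftrightarrow> openin (top_of_set (states M)) (Some -` U)"
proof -
  have "istopology (\<lambda>U. openin (top_of_set (states M)) (Some -` U))"
    by (auto simp: istopology_def vimage_Union)
  then show ?thesis
    by (simp add: state_top_def)
qed

lemma topspace_state_top: "topspace (state_top M) = insert None (Some ` states M)"
proof (rule antisym)
  have "openin (state_top M) (insert None (Some ` states M))"
  proof -
    have "Some -` insert None (Some ` states M) = states M" by auto
    then show ?thesis by (simp add: openin_state_top)
  qed
  then show "insert None (Some ` states M) \<subseteq> topspace (state_top M)"
    by (rule openin_subset)
  have "openin (state_top M) (topspace (state_top M))" by simp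
  then have "Some -` topspace (state_top M) \<subseteq> states M"
    by (metis openin_state_top openin_subset topspace_euclidean_subtopology)
  then have "y \<in> insert None (Some ` states M)" if "y \<in> topspace (state_top M)" for y
    using that by (cases y) auto
  then show "topspace (state_top M) \<subseteq> insert None (Some ` states M)"
    by blast
qed

abbreviation state_measure :: "('x::polish_space, 'a) impulse_model \<Rightarrow> 'x option measure" where
  "state_measure M \<equiv> borel_of (state_top M)"

text \<open>Type \<^typ>\<open>ennreal\<close> with its order topology is the one-point compactification
  of the nonnegative half-line.\<close>

definition action_set :: "('x, 'a) impulse_model \<Rightarrow> (ennreal \<times> 'a) set" where
  "action_set M = UNIV \<times> actions M"

abbreviation action_measure ::
    "('x, 'a::polish_space) impulse_model \<Rightarrow> (ennreal \<times> 'a) measure" where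
  "action_measure M \<equiv> restrict_space borel (action_set M)"

fun transition :: "('x::polish_space, 'a) impulse_model \<Rightarrow> 'x option \<Rightarrow> ennreal \<times> 'a
    \<Rightarrow> 'x option measure" where
  "transition M None b = return (state_measure M) None"
| "transition M (Some x) (\<theta>, a) =
     (if \<theta> = \<infinity> then return (state_measure M) None
      else let t = enn2real \<theta>; p = exp (- discount M * t) in
        measure_of (space (state_measure M)) (sets (state_measure M))
          (\<lambda>\<Gamma>. ennreal p * indicator \<Gamma> (Some (jump M (flow M x t) a))
              + ennreal (1 - p) * indicator \<Gamma> None))"

fun cost :: "('x, 'a) impulse_model \<Rightarrow> nat \<Rightarrow> 'x option \<Rightarrow> ennreal \<times> 'a \<Rightarrow> ennreal" where
  "cost M j None b = 0"
| "cost M j (Some x) (\<theta>, a) =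
     (\<integral>\<^sup>+t\<in>{t. 0 \<le> t \<and> ennreal t \<le> \<theta>}.
        ennreal (exp (- discount M * t)) * gradual_cost M j (flow M x t) \<partial>lborel)
     + (if \<theta> = \<infinity> then 0
        else ennreal (exp (- discount M * enn2real \<theta>))
             * impulse_cost M j (flow M x (enn2real \<theta>)) a)"

definition total_cost :: "('x, 'a) impulse_model \<Rightarrow> 'x option \<Rightarrow> ennreal \<times> 'a \<Rightarrow> ennreal" where
  "total_cost M y b = (\<Sum>j\<le>num_constraints M. cost M j y b)"

definition semicontinuous_mdp :: "('x::polish_space, 'a::polish_space) impulse_model \<Rightarrow> bool" where
  "semicontinuous_mdp M \<longleftrightarrow>
     compact (action_set M) \<and>
     (\<forall>u. continuous_map (state_top M) euclideanreal u \<and> bounded (u ` topspace (state_top M)) \<longrightarrow>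
        continuous_map (prod_topology (state_top M) (top_of_set (action_set M))) euclideanreal
          (\<lambda>(y, b). \<integral>z. u z \<partial>transition M y b)) \<and>
     (\<forall>j\<le>num_constraints M.
        lower_semicontinuous_map (prod_topology (state_top M) (top_of_set (action_set M)))
          (\<lambda>(y, b). cost M j y b))"

section \<open>Strategies and the strategic measure\<close>

text \<open>A path \<open>\<omega>\<close> lists the pairs \<open>\<omega> n = (X\<^sub>n, B\<^sub>n\<^sub>+\<^sub>1)\<close>. The history available when the
  action \<open>B\<^sub>n\<^sub>+\<^sub>1\<close> is chosen is therefore encoded by the first \<open>n\<close> pairs together with the
  current state, and \<open>\<pi> n\<close> is the kernel of that action.\<close>

abbreviation stage_measure ::
    "('x::polish_space, 'a::polish_space) impulse_model \<Rightarrow> ('x option \<times> ennreal \<times> 'a) measure" where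
  "stage_measure M \<equiv> state_measure M \<Otimes>\<^sub>M action_measure M"

type_synonym ('x, 'a) strategy =
  "nat \<Rightarrow> (nat \<Rightarrow> 'x option \<times> ennreal \<times> 'a) \<times> 'x option \<Rightarrow> (ennreal \<times> 'a) measure"

definition strategies ::
    "('x::polish_space, 'a::polish_space) impulse_model \<Rightarrow> ('x, 'a) strategy set" where
  "strategies M = {\<pi>. \<forall>n. \<pi> n \<in>
     (Pi\<^sub>M {0..<n} (\<lambda>_. stage_measure M) \<Otimes>\<^sub>M state_measure M) \<rightarrow>\<^sub>M prob_algebra (action_measure M)}"

definition stage_kernel :: "('x::polish_space, 'a::polish_space) impulse_model \<Rightarrow> ('x, 'a) strategy
    \<Rightarrow> 'x option \<Rightarrow> nat \<Rightarrow> (nat \<Rightarrow> 'x option \<times> ennreal \<times> 'a) \<Rightarrow> ('x option \<times> ennreal \<times> 'a) measure" where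
  "stage_kernel M \<pi> x n \<omega> =
     (if n = 0 then return (state_measure M) x
      else transition M (fst (\<omega> (n - 1))) (snd (\<omega> (n - 1)))) \<bind>
     (\<lambda>y. \<pi> n (\<omega>, y) \<bind> (\<lambda>b. return (stage_measure M) (y, b)))"

text \<open>The measure given by the Ionescu-Tulcea theorem for the kernels \<^const>\<open>stage_kernel\<close>.\<close>

definition strategic_measure :: "('x::polish_space, 'a::polish_space) impulse_model
    \<Rightarrow> ('x, 'a) strategy \<Rightarrow> 'x option \<Rightarrow> (nat \<Rightarrow> 'x option \<times> ennreal \<times> 'a) measure" where
  "strategic_measure M \<pi> x =
     projective_family.lim UNIV
       (Ionescu_Tulcea.CI (stage_kernel M \<pi> x) (\<lambda>_. stage_measure M)) (\<lambda>_. stage_measure M)"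

text \<open>The kernels are measurable and stochastic, so the Ionescu-Tulcea construction applies.\<close>

lemma transition_eq_distr:
  assumes "\<theta> \<noteq> \<infinity>" "Some (jump M (flow M x (enn2real \<theta>)) a) \<in> topspace (state_top M)" "discount M \<ge> 0"
  shows "transition M (Some x) (\<theta>, a) =
    distr (measure_pmf (bernoulli_pmf (exp (- discount M * enn2real \<theta>)))) (state_measure M)
      (\<lambda>c. if c then Some (jump M (flow M x (enn2real \<theta>)) a) else None)" (is "_ = ?D")
proof -
  have p: "0 \<le> exp (- discount M * enn2real \<theta>)" "exp (- discount M * enn2real \<theta>) \<le> 1"
    using assms(3) by (auto simp: mult_nonneg_nonneg)
  have "?D = measure_of (space ?D) (sets ?D) (emeasure ?D)" by (rule measure_of_of_measure[symmetric])
  also have "\<dots> = measure_of (space (state_measure M)) (sets (state_measure M)) (emeasure ?D)" by simp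
  also have "\<dots> = transition M (Some x) (\<theta>, a)"
    using assms(1) unfolding transition.simps Let_def
    apply simp
    apply (rule measure_of_eq)
     apply (metis sets.space_closed space_borel_of)
    subgoal for \<Gamma>
    proof -
      assume "\<Gamma> \<in> sigma_sets (topspace (state_top M)) (sets (state_measure M))"
      then have G: "\<Gamma> \<in> sets (state_measure M)"
        by (metis sets.sigma_sets_eq space_borel_of)
      let ?f = "\<lambda>c. if c then Some (jump M (flow M x (enn2real \<theta>)) a) else None"
      have "emeasure (distr (measure_pmf (bernoulli_pmf (exp (- (discount M * enn2real \<theta>))))) (state_measure M) ?f) \<Gamma>
        = emeasure (measure_pmf (bernoulli_pmf (exp (- (discount M * enn2real \<theta>))))) (?f -` \<Gamma>)"
        using G assms(2) by (subst emeasure_distr) (auto simp: topspace_state_top)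
      also have "\<dots> = (\<integral>\<^sup>+c. indicator (?f -` \<Gamma>) c \<partial>measure_pmf (bernoulli_pmf (exp (- (discount M * enn2real \<theta>)))))"
        by simp
      also have "\<dots> = ennreal (exp (- (discount M * enn2real \<theta>))) *
             indicator \<Gamma> (Some (jump M (flow M x (enn2real \<theta>)) a)) +
             ennreal (1 - exp (- (discount M * enn2real \<theta>))) * indicator \<Gamma> None"
        using p by (subst nn_integral_bernoulli_pmf) (auto simp: indicator_def mult.commute)
      finally show ?thesis by simp
    qed
    done
  finally show ?thesis by simp
qed

lemma measurable_Some_state: "Some \<in> restrict_space borel (states M) \<rightarrow>\<^sub>M state_measure M"
  unfolding borel_of_def
proof (rule measurable_measure_of)
  show "Some \<in> space (restrict_space borel (states M)) \<rightarrow> topspace (state_top M)"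
    by (auto simp: topspace_state_top space_restrict_space)
  fix U assume "U \<in> {U. openin (state_top M) U}"
  then have "openin (top_of_set (states M)) (Some -` U)" by (simp add: openin_state_top)
  then obtain T where "open T" "Some -` U = states M \<inter> T" by (auto simp: openin_open)
  then show "Some -` U \<inter> space (restrict_space borel (states M)) \<in> sets (restrict_space borel (states M))"
    unfolding sets_restrict_space space_restrict_space by (intro image_eqI[of _ _ T]) auto
qed (auto dest: openin_subset)

lemma measurable_the_state: "the \<in> restrict_space (state_measure M) (Some ` states M) \<rightarrow>\<^sub>M restrict_space borel (states M)"
proof (rule measurable_restrict_space2)
  show "the \<in> borel_measurable (restrict_space (state_measure M) (Some ` states M))"
  proof (rule borel_measurableI)
    fix S :: "'a set" assume "open S"
    then have "openin (state_top M) (Some ` (S \<inter> states M))"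
      by (auto simp: openin_state_top inj_vimage_image_eq openin_open)
    moreover have "the -` S \<inter> space (restrict_space (state_measure M) (Some ` states M)) = Some ` (S \<inter> states M)"
      by (auto simp: space_restrict_space topspace_state_top)
    ultimately show "the -` S \<inter> space (restrict_space (state_measure M) (Some ` states M)) \<in> sets (restrict_space (state_measure M) (Some ` states M))"
      by (auto simp: sets_restrict_space intro!: openin_in_borel_of image_eqI[where x="Some ` (S \<inter> states M)"])
  qed
qed (auto simp: space_restrict_space)

lemma None_sets_state: "{None} \<in> sets (state_measure M)"
  by (rule openin_in_borel_of) (simp add: openin_state_top vimage_def)

lemma measurable_jump_flow:
  assumes "valid_model M"
  shows "(\<lambda>z. Some (jump M (flow M (the (fst z)) (enn2real (fst (snd z)))) (snd (snd z)))) \<in>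
     restrict_space (state_measure M \<Otimes>\<^sub>M action_measure M) {z. fst z \<noteq> None} \<rightarrow>\<^sub>M state_measure M" (is "_ \<in> ?N \<rightarrow>\<^sub>M _")
proof -
  have mf: "(\<lambda>(x, t). flow M x t) \<in>
       restrict_space borel (states M \<times> {0..}) \<rightarrow>\<^sub>M restrict_space borel (states M)"
    and mj: "(\<lambda>(x, a). jump M x a) \<in>
       restrict_space borel (states M \<times> actions M) \<rightarrow>\<^sub>M restrict_space borel (states M)"
    using assms unfolding valid_model_def by blast+
  have f: "fst \<in> ?N \<rightarrow>\<^sub>M restrict_space (state_measure M) (Some ` states M)"
    by (intro measurable_restrict_space2 measurable_restrict_space1) (auto simp: space_restrict_space space_pair_measure topspace_state_top)
  have x: "(\<lambda>z. the (fst z)) \<in> ?N \<rightarrow>\<^sub>M restrict_space borel (states M)"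
    using measurable_compose[OF f measurable_the_state] .
  have s: "snd \<in> ?N \<rightarrow>\<^sub>M action_measure M" by (intro measurable_restrict_space1) simp
  have sb: "snd \<in> ?N \<rightarrow>\<^sub>M borel" using s by (simp add: measurable_restrict_space2_iff)
  have th: "(\<lambda>z. enn2real (fst (snd z))) \<in> borel_measurable ?N"
    using measurable_compose[OF sb, of fst borel] by (auto simp: borel_prod[symmetric])
  have ac: "(\<lambda>z. snd (snd z)) \<in> borel_measurable ?N"
    using measurable_compose[OF sb, of snd borel] by (auto simp: borel_prod[symmetric])
  have xb: "(\<lambda>z. the (fst z)) \<in> borel_measurable ?N" using x by (simp add: measurable_restrict_space2_iff)
  have x_in: "the (fst z) \<in> states M" if "z \<in> space ?N" for z using measurable_space[OF x that] by (simp add: space_restrict_space)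
  have a_in: "snd (snd z) \<in> actions M" if "z \<in> space ?N" for z using measurable_space[OF s that] by (auto simp: space_restrict_space action_set_def)
  have "(\<lambda>z. (the (fst z), enn2real (fst (snd z)))) \<in> ?N \<rightarrow>\<^sub>M restrict_space borel (states M \<times> {0..})"
    using x_in xb th by (intro measurable_restrict_space2) (auto simp: borel_prod[symmetric])
  from measurable_compose[OF this mf]
  have fl: "(\<lambda>z. flow M (the (fst z)) (enn2real (fst (snd z)))) \<in> ?N \<rightarrow>\<^sub>M restrict_space borel (states M)"
    by simp
  have flb: "(\<lambda>z. flow M (the (fst z)) (enn2real (fst (snd z)))) \<in> ?N \<rightarrow>\<^sub>M borel" using fl by (simp add: measurable_restrict_space2_iff)
  have fl_in: "flow M (the (fst z)) (enn2real (fst (snd z))) \<in> states M" if "z \<in> space ?N" for z using measurable_space[OF fl that] by (simp add: space_restrict_space)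
  have "(\<lambda>z. (flow M (the (fst z)) (enn2real (fst (snd z))), snd (snd z))) \<in> ?N \<rightarrow>\<^sub>M restrict_space borel (states M \<times> actions M)"
    using fl_in a_in flb ac by (intro measurable_restrict_space2) (auto simp: borel_prod[symmetric])
  from measurable_compose[OF this mj]
  have "(\<lambda>z. jump M (flow M (the (fst z)) (enn2real (fst (snd z)))) (snd (snd z))) \<in> ?N \<rightarrow>\<^sub>M restrict_space borel (states M)"
    by simp
  from measurable_compose[OF this measurable_Some_state] show ?thesis .
qed

lemma measurable_transition:
  assumes v: "valid_model M"
  shows "(\<lambda>(y,b). transition M y b) \<in> state_measure M \<Otimes>\<^sub>M action_measure M \<rightarrow>\<^sub>M prob_algebra (state_measure M)"
proof -
  let ?P = "state_measure M \<Otimes>\<^sub>M action_measure M"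
  let ?k = "\<lambda>z. Some (jump M (flow M (the (fst z)) (enn2real (fst (snd z)))) (snd (snd z)))"
  let ?p = "\<lambda>z. exp (- discount M * enn2real (fst (snd z)))"
  have d: "discount M \<ge> 0" using v by (auto simp: valid_model_def)
  have kin: "?k z \<in> topspace (state_top M)" if "z \<in> space ?P" "fst z \<noteq> None" for z
    using measurable_space[OF measurable_jump_flow[OF v], of z] that by (simp add: space_restrict_space)
  have eq: "transition M (fst z) (snd z) = (if fst z = None \<or> fst (snd z) = \<infinity> then return (state_measure M) None
      else distr (measure_pmf (bernoulli_pmf (?p z))) (state_measure M) (\<lambda>c. if c then ?k z else None))" if "z \<in> space ?P" for z
  proof (cases "fst z = None \<or> fst (snd z) = \<infinity>")
    case True then show ?thesis by (cases z; cases "fst z"; cases "snd z") auto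
  next
    case False
    then obtain x \<theta> a where z: "z = (Some x, \<theta>, a)" "\<theta> \<noteq> \<infinity>" by (cases z; cases "fst z"; cases "snd z") auto
    have "Some (jump M (flow M x (enn2real \<theta>)) a) \<in> topspace (state_top M)" using kin[OF that] z by simp
    from transition_eq_distr[OF z(2) this d] z show ?thesis by (simp del: transition.simps cong: if_cong)
  qed
  have pr: "prob_space (transition M (fst z) (snd z))" if "z \<in> space ?P" for z
    unfolding eq[OF that] using kin[OF that]
    by (auto intro!: prob_space_return measure_pmf.prob_space_distr simp: topspace_state_top)
  have st: "sets (transition M (fst z) (snd z)) = sets (state_measure M)" if "z \<in> space ?P" for z
    unfolding eq[OF that] by auto
  show ?thesis unfolding case_prod_beta
  proof (rule measurable_prob_algebraI)
    show "(\<lambda>z. transition M (fst z) (snd z)) \<in> ?P \<rightarrow>\<^sub>M subprob_algebra (state_measure M)"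
    proof (rule measurable_subprob_algebra)
      fix \<Gamma> assume G: "\<Gamma> \<in> sets (state_measure M)"
      have em: "emeasure (transition M (fst z) (snd z)) \<Gamma> = (if fst z = None \<or> fst (snd z) = \<infinity> then indicator \<Gamma> None else
         ennreal (?p z) * indicator \<Gamma> (?k z) + ennreal (1 - ?p z) * indicator \<Gamma> None)" if "z \<in> space ?P" for z
      proof (cases "fst z = None \<or> fst (snd z) = \<infinity>")
        case True then show ?thesis unfolding eq[OF that] using G by simp
      next
        case False
        let ?f = "\<lambda>c. if c then ?k z else None"
        have p: "0 \<le> ?p z" "?p z \<le> 1" using d by (auto simp: mult_nonneg_nonneg)
        have "emeasure (transition M (fst z) (snd z)) \<Gamma> = emeasure (measure_pmf (bernoulli_pmf (?p z))) (?f -` \<Gamma>)"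
          unfolding eq[OF that] using False G kin[OF that] by (simp, subst emeasure_distr) (auto simp: topspace_state_top)
        also have "\<dots> = (\<integral>\<^sup>+c. indicator (?f -` \<Gamma>) c \<partial>measure_pmf (bernoulli_pmf (?p z)))" by simp
        also have "\<dots> = ennreal (?p z) * indicator \<Gamma> (?k z) + ennreal (1 - ?p z) * indicator \<Gamma> None"
          using p by (subst nn_integral_bernoulli_pmf) (auto simp: indicator_def mult.commute)
        finally show ?thesis by (simp only: False if_False)
      qed
      have sb: "snd \<in> ?P \<rightarrow>\<^sub>M borel" using measurable_snd[of "state_measure M" "action_measure M"]
        by (simp add: measurable_restrict_space2_iff)
      have th[measurable]: "(\<lambda>z. fst (snd z)) \<in> borel_measurable ?P"
        using measurable_compose[OF sb, of fst borel] by (auto simp: borel_prod[symmetric])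
      have N: "{z \<in> space ?P. fst z = None} \<in> sets ?P"
        using measurable_sets[OF measurable_fst None_sets_state, of M "action_measure M"]
        by (simp add: vimage_def Int_def conj_commute)
      have k: "(\<lambda>z. if fst z = None then 0 else indicator \<Gamma> (?k z) :: ennreal) \<in> borel_measurable ?P"
        apply (subst measurable_If_restrict_space_iff[OF N])
        using measurable_compose[OF measurable_jump_flow[OF v] borel_measurable_indicator[OF G]] by simp
      have "(\<lambda>z. if fst z = None \<or> fst (snd z) = \<infinity> then indicator \<Gamma> None else
         ennreal (?p z) * (if fst z = None then 0 else indicator \<Gamma> (?k z)) + ennreal (1 - ?p z) * indicator \<Gamma> None :: ennreal) \<in> borel_measurable ?P"
        using N k by (intro measurable_If) (auto intro!: sets.sets_Collect_disj)
      then show "(\<lambda>z. emeasure (transition M (fst z) (snd z)) \<Gamma>) \<in> borel_measurable ?P"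
        by (subst measurable_cong[OF em]) (auto elim!: measurable_cong[THEN iffD1, rotated])
    qed (use pr st in \<open>auto intro: prob_space_imp_subprob_space\<close>)
  qed (rule pr)
qed

lemma measurable_stage_kernel:
  assumes v: "valid_model M" and pi: "\<pi> \<in> strategies M" and x: "x \<in> topspace (state_top M)"
  shows "stage_kernel M \<pi> x n \<in> Pi\<^sub>M {0..<n} (\<lambda>_. stage_measure M) \<rightarrow>\<^sub>M prob_algebra (stage_measure M)"
proof -
  let ?H = "Pi\<^sub>M {0..<n} (\<lambda>_. stage_measure M)"
  have p: "\<pi> n \<in> ?H \<Otimes>\<^sub>M state_measure M \<rightarrow>\<^sub>M prob_algebra (action_measure M)"
    using pi by (auto simp: strategies_def)
  have q: "(\<lambda>\<omega>. if n = 0 then return (state_measure M) x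
      else transition M (fst (\<omega> (n - 1))) (snd (\<omega> (n - 1)))) \<in> ?H \<rightarrow>\<^sub>M prob_algebra (state_measure M)"
  proof (cases n)
    case 0 then show ?thesis using x by (auto intro!: measurable_const simp: space_prob_algebra prob_space_return)
  next
    case (Suc m)
    have "(\<lambda>\<omega>. \<omega> m) \<in> ?H \<rightarrow>\<^sub>M stage_measure M" using Suc by (intro measurable_component_singleton) auto
    from measurable_compose[OF this measurable_transition[OF v]] show ?thesis using Suc by (simp add: case_prod_beta)
  qed
  have r: "(\<lambda>(z, b). return (stage_measure M) (snd z, b))
      \<in> (?H \<Otimes>\<^sub>M state_measure M) \<Otimes>\<^sub>M action_measure M \<rightarrow>\<^sub>M prob_algebra (stage_measure M)"
    unfolding case_prod_beta
    by (rule measurable_compose[OF _ measurable_return_prob_space]) (intro measurable_Pair measurable_compose[OF measurable_fst measurable_snd] measurable_snd)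
  have "(\<lambda>z. \<pi> n z \<bind> (\<lambda>b. return (stage_measure M) (snd z, b)))
      \<in> ?H \<Otimes>\<^sub>M state_measure M \<rightarrow>\<^sub>M prob_algebra (stage_measure M)"
    by (rule measurable_bind_prob_space2[OF p r])
  then have "(\<lambda>(\<omega>, y). \<pi> n (\<omega>, y) \<bind> (\<lambda>b. return (stage_measure M) (y, b)))
      \<in> ?H \<Otimes>\<^sub>M state_measure M \<rightarrow>\<^sub>M prob_algebra (stage_measure M)"
    by (simp add: case_prod_beta')
  from measurable_bind_prob_space2[OF q this] show ?thesis
    by (simp only: stage_kernel_def[abs_def])
qed

lemma Ionescu_Tulcea_stage_kernel:
  assumes "valid_model M" "\<pi> \<in> strategies M" "x \<in> topspace (state_top M)"
  shows "Ionescu_Tulcea (stage_kernel M \<pi> x) (\<lambda>_. stage_measure M)"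
proof (rule Ionescu_Tulcea.intro, goal_cases)
  case (1 n)
  show ?case
    by (rule measurable_prob_algebraD[OF measurable_stage_kernel[OF assms]])
next
  case (2 n \<omega>)
  from measurable_space[OF measurable_stage_kernel[OF assms] this] show ?case
    by (simp only: space_prob_algebra mem_Collect_eq)
qed

definition performance :: "('x::polish_space, 'a::polish_space) impulse_model \<Rightarrow> 'x option
    \<Rightarrow> ('x, 'a) strategy \<Rightarrow> ('x option \<Rightarrow> ennreal \<times> 'a \<Rightarrow> ennreal) \<Rightarrow> ennreal" where
  "performance M x \<pi> C =
     (\<integral>\<^sup>+\<omega>. (\<Sum>i. C (fst (\<omega> i)) (snd (\<omega> i))) \<partial>strategic_measure M \<pi> x)"

definition bellman :: "('x::polish_space, 'a::polish_space) impulse_model \<Rightarrow> (nat \<Rightarrow> real)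
    \<Rightarrow> 'x option \<Rightarrow> ennreal" where
  "bellman M g x = (INF \<pi>\<in>strategies M.
     performance M x \<pi> (cost M 0)
     + (\<Sum>j=1..num_constraints M. ennreal (g j) * performance M x \<pi> (cost M j)))"

section \<open>Linear programs and Lagrangians\<close>

definition pos_states :: "('x::polish_space, 'a::polish_space) impulse_model \<Rightarrow> 'x option set" where
  "pos_states M = {x \<in> topspace (state_top M).
     (INF \<pi>\<in>strategies M. performance M x \<pi> (total_cost M)) > 0}"

abbreviation pos_measure ::
    "('x::polish_space, 'a::polish_space) impulse_model \<Rightarrow> 'x option measure" where
  "pos_measure M \<equiv> restrict_space (state_measure M) (pos_states M)"

text \<open>Only the values on \<^term>\<open>pos_states M\<close> of a test function matter.\<close>

definition test_functions ::
    "('x::polish_space, 'a::polish_space) impulse_model \<Rightarrow> ('x option \<Rightarrow> real) set" where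
  "test_functions M = {W \<in> borel_measurable (pos_measure M). bounded (W ` pos_states M)}"

definition finite_measures ::
    "('x::polish_space, 'a::polish_space) impulse_model \<Rightarrow> ('x option \<times> ennreal \<times> 'a) measure set" where
  "finite_measures M =
     {\<mu>. sets \<mu> = sets (pos_measure M \<Otimes>\<^sub>M action_measure M) \<and> finite_measure \<mu>}"

definition multipliers :: "('x, 'a) impulse_model \<Rightarrow> (nat \<Rightarrow> real) set" where
  "multipliers M = {1..num_constraints M} \<rightarrow>\<^sub>E {0..}"

definition cost_integral :: "('x, 'a) impulse_model \<Rightarrow> nat
    \<Rightarrow> ('x option \<times> ennreal \<times> 'a) measure \<Rightarrow> ennreal" where
  "cost_integral M j \<mu> = (\<integral>\<^sup>+(y, b). cost M j y b \<partial>\<mu>)"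

definition occupation_measures :: "('x::polish_space, 'a::polish_space) impulse_model \<Rightarrow> 'x option
    \<Rightarrow> ('x option \<times> ennreal \<times> 'a) measure set" where
  "occupation_measures M x0 =
     {\<mu>. sets \<mu> = sets (pos_measure M \<Otimes>\<^sub>M action_measure M) \<and>
         sigma_finite_measure (distr \<mu> (pos_measure M) fst) \<and>
         (\<forall>\<Gamma>\<in>sets (pos_measure M).
            emeasure \<mu> (\<Gamma> \<times> action_set M)
            = indicator \<Gamma> x0 + (\<integral>\<^sup>+(y, b). emeasure (transition M y b) \<Gamma> \<partial>\<mu>)) \<and>
         (\<integral>\<^sup>+(y, b). total_cost M y b \<partial>\<mu>) < \<infinity>}"

definition lagrangian1 :: "('x, 'a) impulse_model
    \<Rightarrow> ('x option \<times> ennreal \<times> 'a) measure \<Rightarrow> (nat \<Rightarrow> real) \<Rightarrow> ereal" where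
  "lagrangian1 M \<mu> g = enn2ereal (cost_integral M 0 \<mu>)
     + (\<Sum>j=1..num_constraints M.
          ereal (g j) * (enn2ereal (cost_integral M j \<mu>) - ereal (constraint_bound M j)))"

definition dual_fun :: "('x::polish_space, 'a::polish_space) impulse_model \<Rightarrow> 'x option
    \<Rightarrow> (nat \<Rightarrow> real) \<Rightarrow> ereal" where
  "dual_fun M x0 g = (INF \<mu>\<in>occupation_measures M x0. lagrangian1 M \<mu> g)"

definition next_state_measure :: "('x::polish_space, 'a::polish_space) impulse_model
    \<Rightarrow> ('x option \<times> ennreal \<times> 'a) measure \<Rightarrow> 'x option measure" where
  "next_state_measure M \<mu> = \<mu> \<bind> (\<lambda>(y, b). restrict_space (transition M y b) (pos_states M))"

definition lagrangian2 :: "('x::polish_space, 'a::polish_space) impulse_model \<Rightarrow> 'x option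
    \<Rightarrow> ('x option \<times> ennreal \<times> 'a) measure \<Rightarrow> ('x option \<Rightarrow> real) \<Rightarrow> (nat \<Rightarrow> real) \<Rightarrow> ereal" where
  "lagrangian2 M x0 \<mu> W g = enn2ereal (cost_integral M 0 \<mu>)
     + ereal ((\<integral>x. W x \<partial>return (pos_measure M) x0)
              + (\<integral>x. W x \<partial>next_state_measure M \<mu>)
              - (\<integral>x. W x \<partial>distr \<mu> (pos_measure M) fst))
     + (\<Sum>j=1..num_constraints M.
          ereal (g j) * (enn2ereal (cost_integral M j \<mu>) - ereal (constraint_bound M j)))"

definition dual_objective :: "('x::polish_space, 'a::polish_space) impulse_model \<Rightarrow> 'x option
    \<Rightarrow> ('x option \<Rightarrow> real) \<Rightarrow> (nat \<Rightarrow> real) \<Rightarrow> ereal" where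
  "dual_objective M x0 W g = (INF \<mu>\<in>finite_measures M. lagrangian2 M x0 \<mu> W g)"

definition lp_feasible :: "('x::polish_space, 'a::polish_space) impulse_model \<Rightarrow> (nat \<Rightarrow> real)
    \<Rightarrow> ('x option \<Rightarrow> real) set" where
  "lp_feasible M g = {W \<in> test_functions M. \<forall>x\<in>pos_states M. \<forall>b\<in>action_set M.
     0 \<le> enn2ereal (cost M 0 x b) + (\<Sum>j=1..num_constraints M. ereal (g j) * enn2ereal (cost M j x b))
        + ereal (LINT y:pos_states M|transition M x b. W y) - ereal (W x)}"

definition lp_value :: "('x::polish_space, 'a::polish_space) impulse_model \<Rightarrow> 'x option
    \<Rightarrow> (nat \<Rightarrow> real) \<Rightarrow> ereal" where
  "lp_value M x0 g = (SUP W\<in>lp_feasible M g. ereal (W x0))"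

definition lp_solution :: "('x::polish_space, 'a::polish_space) impulse_model \<Rightarrow> 'x option
    \<Rightarrow> (nat \<Rightarrow> real) \<Rightarrow> ('x option \<Rightarrow> real) \<Rightarrow> bool" where
  "lp_solution M x0 g W \<longleftrightarrow> W \<in> lp_feasible M g \<and> (\<forall>W'\<in>lp_feasible M g. W' x0 \<le> W x0)"

definition is_maximizer :: "'a set \<Rightarrow> ('a \<Rightarrow> ereal) \<Rightarrow> 'a \<Rightarrow> bool" where
  "is_maximizer S f x \<longleftrightarrow> x \<in> S \<and> (\<forall>y\<in>S. f y \<le> f x)"

section \<open>Hypotheses\<close>

definition slater_condition ::
    "('x::polish_space, 'a::polish_space) impulse_model \<Rightarrow> 'x option \<Rightarrow> bool" where
  "slater_condition M x0 \<longleftrightarrow> (\<exists>\<mu>\<in>occupation_measures M x0.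
     \<forall>j\<in>{1..num_constraints M}. cost_integral M j \<mu> < ennreal (constraint_bound M j))"

definition cost_conditions :: "('x, 'a) impulse_model \<Rightarrow> bool" where
  "cost_conditions M \<longleftrightarrow>
     (\<exists>\<delta>::real. 0 < \<delta> \<and> (\<forall>x\<in>states M. \<forall>a\<in>actions M. ennreal \<delta> \<le> impulse_cost M 0 x a)) \<and>
     Max ((\<lambda>j. SUP x\<in>states M. gradual_cost M j x) ` {0..num_constraints M})
     + Max ((\<lambda>j. SUP (x, a)\<in>states M \<times> actions M. impulse_cost M j x a) ` {0..num_constraints M})
     < \<infinity>"

end

theory Submission
  imports Defs
begin

text \<open>
  Write \<open>c\<close> for the running cost with weights \<open>1, g\<^sub>1, \<dots>, g\<^sub>J\<close> on the individual costs.
  Value iteration from zero produces an increasing sequence of functions. Semicontinuity of the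
  model and compactness of the action set make every iterate lower semicontinuous, allow the minimum
  over the actions to be exchanged with the increasing limit (\<open>optimality_equation\<close>), and provide a
  measurable stationary policy that attains this minimum (\<open>optimal_selector\<close>). No strategy beats any
  iterate, and the policy pays at most the limit, so the limit is the Bellman function
  (\<open>bellman_eq\<close>). It vanishes outside the set \<open>V\<close> of the states with positive total cost, so that its
  optimality equation is an inequality between functions on \<open>V\<close>: the Bellman function is feasible
  for the linear program.

  An impulse costs at least \<open>\<delta>\<close>, discounted by the same factor \<open>exp (- \<alpha> \<theta>)\<close> that is the
  probability of surviving the step. Hence \<open>\<delta>\<close> times the probability of surviving a step is bounded
  by the cost of this step (\<open>survival_le_cost\<close>), and finite cost forces finite total mass:
  every measure in \<open>\<D>\<close> is finite (\<open>occupation_finite\<close>), and so is the occupation measure of the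
  optimal policy killed on leaving \<open>V\<close> (\<open>optimal_occupation_measure\<close>).

  Duality between functions and measures is then one integration. The \<open>\<mu>\<close>-dependent part of
  \<open>L\<^sub>2(\<mu>, W, g)\<close> is the integral of the slack \<open>c + Q W - W\<close> (\<open>lagrangian2_eq\<close>), so
  \<open>L\<^sub>2(\<mu>, W, g) \<ge> W(x\<^sub>0) - \<Sum> g\<^sub>j d\<^sub>j\<close> for feasible \<open>W\<close>; for \<open>\<mu> \<in> \<D>\<close> the terms with \<open>W\<close> cancel
  and \<open>L\<^sub>2 = L\<^sub>1\<close> (\<open>lagrangian2_occupation\<close>); and the occupation measure of the optimal policy
  satisfies \<open>L\<^sub>1(\<mu>, g) \<le> W\<^sup>*(x\<^sub>0) - \<Sum> g\<^sub>j d\<^sub>j\<close>. Together these three facts identify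
  \<open>W\<^sup>*(x\<^sub>0) - \<Sum> g\<^sub>j d\<^sub>j\<close> with \<open>h(g)\<close> and with the inner maximum over \<open>W\<close>, and they show that the
  Bellman function solves the linear program and the inner maximisation.

  The remaining step is Lagrangian duality on the convex set \<open>\<D>\<close> with finitely many affine
  constraints. Under the Slater condition the constraints can be moved into the objective one at a
  time (\<open>lagrange_multipliers\<close>). The multipliers obtained in this way make \<open>h\<close> at least as
  large as the infimum over \<open>\<mu>\<close> of the supremum of \<open>L\<^sub>2\<close> over \<open>(W, g)\<close> (\<open>strong_duality\<close>). Weak duality
  bounds every value of \<open>h\<close> by this infimum, so these multipliers maximise \<open>h\<close> and there is no gap.
\<close>

section \<open>Lower semicontinuous functions\<close>

lemma lsc_closedin_le:
  "lower_semicontinuous_map T f \<longleftrightarrow> (\<forall>c. closedin T {x \<in> topspace T. f x \<le> c})"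
proof -
  have "topspace T - {x \<in> topspace T. f x \<le> c} = {x \<in> topspace T. c < f x}" for c
    by auto
  then show ?thesis
    by (auto simp: lower_semicontinuous_map_def closedin_def)
qed

lemma lsc_const: "lower_semicontinuous_map T (\<lambda>x. c)"
  unfolding lower_semicontinuous_map_def
proof
  show "openin T {x \<in> topspace T. a < c}" for a by (cases "a < c") auto
qed

lemma lsc_cong:
  assumes "\<And>x. x \<in> topspace T \<Longrightarrow> f x = g x"
  shows "lower_semicontinuous_map T f \<longleftrightarrow> lower_semicontinuous_map T g"
  using assms by (simp add: lower_semicontinuous_map_def cong: conj_cong)

lemma lsc_SUP:
  fixes f :: "'i \<Rightarrow> 'a \<Rightarrow> 'b::complete_linorder"
  assumes "\<And>i. i \<in> I \<Longrightarrow> lower_semicontinuous_map T (f i)"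
  shows "lower_semicontinuous_map T (\<lambda>x. SUP i\<in>I. f i x)"
  unfolding lower_semicontinuous_map_def
proof
  fix c
  have "{x \<in> topspace T. c < (SUP i\<in>I. f i x)} = (\<Union>i\<in>I. {x \<in> topspace T. c < f i x})"
    by (auto simp: less_SUP_iff)
  then show "openin T {x \<in> topspace T. c < (SUP i\<in>I. f i x)}"
    using assms by (auto simp: lower_semicontinuous_map_def)
qed

text \<open>Addition is monotone and continuous on \<^typ>\<open>ennreal\<close>, so thresholds slightly below the two values
  still have a sum above \<open>c\<close>. A summand equal to \<open>0\<close> has no threshold below it and is dropped instead.\<close>

lemma lsc_add:
  fixes f g :: "'a \<Rightarrow> ennreal"
  assumes f: "lower_semicontinuous_map T f" and g: "lower_semicontinuous_map T g"
  shows "lower_semicontinuous_map T (\<lambda>x. f x + g x)"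
  unfolding lower_semicontinuous_map_def
proof
  fix c
  show "openin T {x \<in> topspace T. c < f x + g x}"
  proof (subst openin_subopen, clarify)
    fix x assume x: "x \<in> topspace T" "c < f x + g x"
    have opf: "openin T {z \<in> topspace T. a < f z}" and opg: "openin T {z \<in> topspace T. a < g z}" for a
      using f g by (auto simp: lower_semicontinuous_map_def)
    consider "f x = 0" | "g x = 0" | "0 < f x" "0 < g x"
      by (auto simp: zero_less_iff_neq_zero)
    then show "\<exists>U. openin T U \<and> x \<in> U \<and> U \<subseteq> {x \<in> topspace T. c < f x + g x}"
    proof cases
      case 1
      then show ?thesis
        using x opg[of c] by (intro exI[of _ "{z \<in> topspace T. c < g z}"]) (auto simp: add_increasing intro: less_le_trans)
    next
      case 2
      then show ?thesis
        using x opf[of c] by (intro exI[of _ "{z \<in> topspace T. c < f z}"]) (auto simp: add_increasing2 intro: less_le_trans)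
    next
      case 3
      have "open {p :: ennreal \<times> ennreal. c < fst p + snd p}"
        by (intro open_Collect_less continuous_intros)
      with x obtain A B where AB: "open A" "open B" "f x \<in> A" "g x \<in> B" "A \<times> B \<subseteq> {p. c < fst p + snd p}"
        by (auto elim: open_prod_elim[of _ "(f x, g x)"])
      obtain a where a: "a < f x" "{a<..f x} \<subseteq> A"
        using open_left[OF AB(1,3) 3(1)] by blast
      obtain b where b: "b < g x" "{b<..g x} \<subseteq> B"
        using open_left[OF AB(2,4) 3(2)] by blast
      have "c < f z + g z" if "a < f z" "b < g z" for z
      proof -
        \<comment> \<open>Truncation at the values in \<open>x\<close> brings the point back into the open rectangle.\<close>
        have "min (f z) (f x) \<in> A" "min (g z) (g x) \<in> B"
          using a b that by (auto simp: min_def)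
        with AB(5) have "c < min (f z) (f x) + min (g z) (g x)" by auto
        also have "\<dots> \<le> f z + g z" by (intro add_mono) auto
        finally show ?thesis .
      qed
      then show ?thesis
        using x a b opf[of a] opg[of b]
        by (intro exI[of _ "{z \<in> topspace T. a < f z} \<inter> {z \<in> topspace T. b < g z}"]) auto
    qed
  qed
qed

lemma lsc_sum:
  fixes f :: "'i \<Rightarrow> 'a \<Rightarrow> ennreal"
  assumes "\<And>i. i \<in> I \<Longrightarrow> lower_semicontinuous_map T (f i)"
  shows "lower_semicontinuous_map T (\<lambda>x. \<Sum>i\<in>I. f i x)"
  using assms by (induction I rule: infinite_finite_induct) (auto intro: lsc_const lsc_add)

lemma lsc_cmult:
  assumes f: "lower_semicontinuous_map T f"
  shows "lower_semicontinuous_map T (\<lambda>x. ennreal r * f x)"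
proof (cases "r \<le> 0")
  case True
  then show ?thesis by (simp add: ennreal_neg lsc_const)
next
  case False
  then have "c < ennreal r * y \<longleftrightarrow> c / ennreal r < y" for c y
    by (simp add: divide_less_ennreal mult.commute)
  then show ?thesis
    using f by (simp add: lower_semicontinuous_map_def)
qed

text \<open>The sublevel sets at the values of \<open>f\<close> are closed and form a chain, so they have the finite
  intersection property; any point in all of them is a minimiser.\<close>

lemma lsc_attains_min:
  fixes f :: "'b \<Rightarrow> 'c::linorder"
  assumes Y: "compact_space Y" and f: "lower_semicontinuous_map Y f"
    and K: "closedin Y K" "K \<noteq> {}"
  shows "\<exists>b\<in>K. \<forall>b'\<in>K. f b \<le> f b'"
proof -
  let ?C = "\<lambda>y. {b \<in> topspace Y. f b \<le> f y} \<inter> K"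
  have cl: "closedin Y (?C y)" for y
    using f K by (auto simp: lsc_closedin_le)
  have KY: "K \<subseteq> topspace Y" using K(1) by (rule closedin_subset)
  have fin: "\<Inter>(?C ` F) \<noteq> {}" if F: "finite F" "F \<noteq> {}" "F \<subseteq> K" for F
  proof -
    obtain m where m: "m \<in> F" "\<And>y. y \<in> F \<Longrightarrow> f m \<le> f y"
      using F by (metis arg_min_if_finite(1) arg_min_least)
    then have "m \<in> \<Inter>(?C ` F)" using F KY by blast
    then show ?thesis by blast
  qed
  have prem: "(\<forall>C\<in>?C ` K. closedin Y C) \<and> (\<forall>\<F>. finite \<F> \<and> \<F> \<subseteq> ?C ` K \<longrightarrow> \<Inter>\<F> \<noteq> {})"
  proof (intro conjI allI impI)
    fix \<F> assume *: "finite \<F> \<and> \<F> \<subseteq> ?C ` K"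
    then obtain F where F: "F \<subseteq> K" "finite F" "\<F> = ?C ` F"
      by (meson finite_subset_image)
    show "\<Inter>\<F> \<noteq> {}"
    proof (cases "F = {}")
      case False then show ?thesis using fin[of F] F by simp
    qed (use F in auto)
  qed (use cl in auto)
  have "\<Inter>(?C ` K) \<noteq> {}"
    by (rule Y[unfolded compact_space_fip, THEN spec, THEN mp, OF prem])
  then obtain b where "b \<in> \<Inter>(?C ` K)" by blast
  then have "b \<in> K \<and> (\<forall>b'\<in>K. f b \<le> f b')"
    using K(2) by auto
  then show ?thesis by blast
qed

text \<open>Projection along a compact factor is a closed map.\<close>

lemma lsc_exists_le_closedin:
  assumes Y: "compact_space Y" and F: "lower_semicontinuous_map (prod_topology T Y) (\<lambda>(x, b). F x b)"
    and K: "closedin Y K"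
  shows "closedin T {x \<in> topspace T. \<exists>b\<in>K. F x b \<le> c}"
proof -
  have "closedin (prod_topology T Y) ({z \<in> topspace (prod_topology T Y). (\<lambda>(x, b). F x b) z \<le> c} \<inter> (topspace T \<times> K))"
    using F K by (intro closedin_Int) (auto simp only: lsc_closedin_le closedin_prod_Times_iff closedin_topspace)
  then have "closedin T (fst ` ({z \<in> topspace (prod_topology T Y). (\<lambda>(x, b). F x b) z \<le> c} \<inter> (topspace T \<times> K)))"
    using closed_map_fst[OF Y, of T] by (auto simp only: closed_map_def)
  also have "fst ` ({z \<in> topspace (prod_topology T Y). (\<lambda>(x, b). F x b) z \<le> c} \<inter> (topspace T \<times> K))
      = {x \<in> topspace T. \<exists>b\<in>K. F x b \<le> c}"
    using closedin_subset[OF K] by force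
  finally show ?thesis .
qed

lemma lsc_section:
  assumes F: "lower_semicontinuous_map (prod_topology T Y) (\<lambda>(x, b). F x b)" and x: "x \<in> topspace T"
  shows "lower_semicontinuous_map Y (F x)"
  unfolding lower_semicontinuous_map_def
proof
  fix c
  have cm: "continuous_map Y (prod_topology T Y) (\<lambda>b. (x, b))"
    using x by (intro continuous_map_pairedI) auto
  have "openin Y {b \<in> topspace Y. (x, b) \<in> {z \<in> topspace (prod_topology T Y). c < (\<lambda>(x, b). F x b) z}}"
    using F by (intro openin_continuous_map_preimage[OF cm]) (auto simp: lower_semicontinuous_map_def)
  also have "{b \<in> topspace Y. (x, b) \<in> {z \<in> topspace (prod_topology T Y). c < (\<lambda>(x, b). F x b) z}}
     = {b \<in> topspace Y. c < F x b}" using x by auto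
  finally show "openin Y {b \<in> topspace Y. c < F x b}" .
qed

text \<open>Minimisation over a compact parameter set: the infimum is attained and is again lower
  semicontinuous. This is what keeps value iteration inside the class of lower semicontinuous functions.\<close>

lemma lsc_INF_attained:
  fixes F :: "'t \<Rightarrow> 'b \<Rightarrow> 'c::complete_linorder"
  assumes Y: "compact_space Y" and F: "lower_semicontinuous_map (prod_topology T Y) (\<lambda>(x, b). F x b)"
    and K: "closedin Y K" "K \<noteq> {}" and x: "x \<in> topspace T"
  shows "\<exists>b\<in>K. F x b = (INF b\<in>K. F x b)"
  using lsc_attains_min[OF Y lsc_section[OF F x] K]
  by (meson INF_greatest INF_lower antisym)

lemma lsc_INF_compact:
  fixes F :: "'t \<Rightarrow> 'b \<Rightarrow> 'c::complete_linorder"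
  assumes Y: "compact_space Y" and F: "lower_semicontinuous_map (prod_topology T Y) (\<lambda>(x, b). F x b)"
    and K: "closedin Y K"
  shows "lower_semicontinuous_map T (\<lambda>x. INF b\<in>K. F x b)"
proof (cases "K = {}")
  case False
  have "{x \<in> topspace T. (INF b\<in>K. F x b) \<le> c} = {x \<in> topspace T. \<exists>b\<in>K. F x b \<le> c}" for c
    using lsc_INF_attained[OF Y F K False] by (metis (no_types, lifting) INF_lower order.trans)
  then show ?thesis
    using lsc_exists_le_closedin[OF Y F K] by (simp add: lsc_closedin_le)
qed (simp add: lsc_const)

lemma lsc_borel_measurable:
  fixes f :: "'a \<Rightarrow> ennreal"
  assumes "lower_semicontinuous_map T f"
  shows "f \<in> borel_measurable (borel_of T)"
  using assms by (intro borel_measurableI_greater)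
    (auto simp: lower_semicontinuous_map_def intro: openin_in_borel_of)

lemma sets_borel_of_top_of_set: "sets (borel_of (top_of_set S)) = sets (restrict_space borel S)"
proof -
  have "sets (restrict_space borel S) = {(\<lambda>x. x) -` A \<inter> S |A. A \<in> sigma_sets UNIV {U. open U}}"
    by (auto simp: sets_restrict_space borel_def image_iff Int_commute)
  also have "\<dots> = sigma_sets S {(\<lambda>x. x) -` A \<inter> S |A. A \<in> {U. open U}}"
    by (rule sigma_sets_vimage_commute) auto
  also have "{(\<lambda>x. x) -` A \<inter> S |A. A \<in> {U. open U}} = {U. openin (top_of_set S) U}"
    by (auto simp: openin_open Int_commute)
  finally show ?thesis
    by (simp add: sets_borel_of)
qed

text \<open>With countable bases an open set of the product is a countable union of rectangles. Hence lower
  semicontinuous functions of two variables are measurable for the product \<open>\<sigma>\<close>-algebra.\<close>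

lemma openin_prod_in_pair_borel:
  assumes T: "second_countable T" and Y: "second_countable Y" and U: "openin (prod_topology T Y) U"
  shows "U \<in> sets (borel_of T \<Otimes>\<^sub>M borel_of Y)"
proof -
  obtain \<B> where B: "countable \<B>" "\<And>V. V \<in> \<B> \<Longrightarrow> openin T V"
      "\<And>W x. openin T W \<Longrightarrow> x \<in> W \<Longrightarrow> \<exists>V\<in>\<B>. x \<in> V \<and> V \<subseteq> W"
    using T by (force simp: second_countable_def)
  obtain \<C> where C: "countable \<C>" "\<And>V. V \<in> \<C> \<Longrightarrow> openin Y V"
      "\<And>W x. openin Y W \<Longrightarrow> x \<in> W \<Longrightarrow> \<exists>V\<in>\<C>. x \<in> V \<and> V \<subseteq> W"
    using Y by (force simp: second_countable_def)
  let ?R = "{R \<in> (\<lambda>(V, W). V \<times> W) ` (\<B> \<times> \<C>). R \<subseteq> U}"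
  have "U \<subseteq> \<Union>?R"
  proof
    fix z assume z: "z \<in> U"
    then obtain V W where "openin T V" "openin Y W" "fst z \<in> V" "snd z \<in> W" "V \<times> W \<subseteq> U"
      using U by (metis openin_prod_topology_alt prod.collapse)
    then obtain V' W' where "V' \<in> \<B>" "W' \<in> \<C>" "fst z \<in> V'" "snd z \<in> W'" "V' \<times> W' \<subseteq> U"
      using B(3)[of V "fst z"] C(3)[of W "snd z"] by blast
    then show "z \<in> \<Union>?R"
      by (intro UnionI[of "V' \<times> W'"]) (auto simp: mem_Times_iff)
  qed
  then have "U = \<Union>?R" by auto
  also have "\<dots> \<in> sets (borel_of T \<Otimes>\<^sub>M borel_of Y)"
    using B(1,2) C(1,2) by (intro sets.countable_Union) (auto intro!: pair_measureI openin_in_borel_of)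
  finally show ?thesis .
qed

lemma lsc_pair_measurable:
  fixes f :: "_ \<Rightarrow> ennreal"
  assumes "second_countable T" "second_countable Y" "lower_semicontinuous_map (prod_topology T Y) f"
  shows "f \<in> borel_measurable (borel_of T \<Otimes>\<^sub>M borel_of Y)"
proof (rule borel_measurableI_greater)
  fix c
  have "openin (prod_topology T Y) {x \<in> topspace (prod_topology T Y). c < f x}"
    using assms(3) by (auto simp only: lower_semicontinuous_map_def)
  from openin_prod_in_pair_borel[OF assms(1,2) this]
  show "{x \<in> space (borel_of T \<Otimes>\<^sub>M borel_of Y). c < f x} \<in> sets (borel_of T \<Otimes>\<^sub>M borel_of Y)"
    by (simp add: space_pair_measure)
qed

text \<open>The Lipschitz envelopes \<open>x \<mapsto> inf\<^sub>y f(y) + n d(x, y)\<close> are continuous and increase to \<open>f\<close>: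
  far from \<open>x\<close> the penalty \<open>n d(x, y)\<close> dominates, near \<open>x\<close> lower semicontinuity does. They transfer the
  continuity of the transition kernel from continuous to lower semicontinuous integrands.\<close>

lemma lsc_approx_continuous:
  fixes f :: "'x::metric_space \<Rightarrow> ennreal"
  assumes f: "lower_semicontinuous_map (top_of_set S) f" and K: "\<And>x. x \<in> S \<Longrightarrow> f x \<le> ennreal K" "0 \<le> K"
  obtains u :: "nat \<Rightarrow> 'x \<Rightarrow> real" where
    "\<And>n. continuous_on S (u n)" "\<And>n x. x \<in> S \<Longrightarrow> 0 \<le> u n x" "\<And>n x. x \<in> S \<Longrightarrow> u n x \<le> K"
    "\<And>m n x. x \<in> S \<Longrightarrow> m \<le> n \<Longrightarrow> u m x \<le> u n x" "\<And>x. x \<in> S \<Longrightarrow> f x = (SUP n. ennreal (u n x))"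
proof
  define r where "r x = enn2real (f x)" for x
  define u where "u n x = (INF y\<in>S. r y + real n * dist x y)" for n x
  have r: "0 \<le> r x" "r x \<le> K" "f x = ennreal (r x)" if "x \<in> S" for x
  proof -
    show "0 \<le> r x" by (simp add: r_def)
    show "f x = ennreal (r x)" unfolding r_def
      using le_less_trans[OF K(1)[OF that] ennreal_less_top] by simp
    then show "r x \<le> K" using K(1)[OF that] K(2) by simp
  qed
  have bdd: "bdd_below ((\<lambda>y. r y + real n * dist x y) ` S)" for n x
    using r by (intro bdd_belowI2[of _ 0]) auto
  have lower: "u n x \<le> r y + real n * dist x y" if "y \<in> S" for n x y
    unfolding u_def by (rule cINF_lower[OF bdd that])
  show nn: "0 \<le> u n x" if "x \<in> S" for n x
    unfolding u_def using that r by (intro cINF_greatest) auto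
  have le_r: "u n x \<le> r x" if "x \<in> S" for n x
    using lower[OF that, of n x] by simp
  show "u n x \<le> K" if "x \<in> S" for n x
    using le_r[OF that, of n] r(2)[OF that] by simp
  show mono: "u m x \<le> u n x" if "x \<in> S" "m \<le> n" for m n x
  proof -
    have "u m x \<le> r y + real n * dist x y" if "y \<in> S" for y
      using lower[OF that, of m x] \<open>m \<le> n\<close> mult_right_mono[of "real m" "real n" "dist x y"] by simp
    then show ?thesis unfolding u_def[of n] using that by (intro cINF_greatest) auto
  qed
  have lip: "u n x \<le> u n z + real n * dist x z" if "x \<in> S" "z \<in> S" for n x z
  proof -
    have "u n x - real n * dist x z \<le> r y + real n * dist z y" if "y \<in> S" for y
    proof -
      have "real n * dist x y \<le> real n * (dist x z + dist z y)"
        by (intro mult_left_mono dist_triangle) auto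
      then show ?thesis using lower[OF that, of n x] by (simp add: algebra_simps)
    qed
    then have "u n x - real n * dist x z \<le> u n z"
      unfolding u_def[of n z] using that by (intro cINF_greatest) auto
    then show ?thesis by simp
  qed
  show "continuous_on S (u n)" for n
  proof (rule lipschitz_on_continuous_on[of "real n"], rule lipschitz_onI)
    fix x y assume "x \<in> S" "y \<in> S"
    then show "dist (u n x) (u n y) \<le> real n * dist x y"
      using lip[of x y n] lip[of y x n] by (auto simp: dist_real_def dist_commute)
  qed auto
  show "f x = (SUP n. ennreal (u n x))" if x: "x \<in> S" for x
  proof (rule antisym)
    show "(SUP n. ennreal (u n x)) \<le> f x"
      using le_r[OF x] r(3)[OF x] by (intro SUP_least) (simp add: ennreal_leI)
    show "f x \<le> (SUP n. ennreal (u n x))"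
    proof (rule dense_le)
      fix c assume c: "c < f x"
      then obtain k where k: "c = ennreal k" "0 \<le> k"
        by (metis ennreal_cases not_top_less top.not_eq_extremum order_less_le_trans top_greatest)
      have "openin (top_of_set S) {z \<in> topspace (top_of_set S). c < f z}"
        using f by (auto simp: lower_semicontinuous_map_def)
      then obtain e where e: "e > 0" "\<And>z. z \<in> S \<Longrightarrow> dist z x < e \<Longrightarrow> c < f z"
        using x c by (auto simp: openin_euclidean_subtopology_iff)
      obtain n where n: "k < real n * e"
        using e(1) by (metis reals_Archimedean3)
      have "k \<le> r y + real n * dist x y" if y: "y \<in> S" for y
      proof (cases "dist y x < e")
        case True
        then have "ennreal k < ennreal (r y)" using e(2)[OF y] r(3)[OF y] k by simp
        then have "k < r y" using k by (simp add: ennreal_less_iff)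
        then show ?thesis by (simp add: add_increasing2 less_imp_le)
      next
        case False
        then have "real n * e \<le> real n * dist x y" by (intro mult_left_mono) (auto simp: dist_commute)
        then show ?thesis using n r(1)[OF y] by simp
      qed
      then have "k \<le> u n x"
        unfolding u_def using x by (intro cINF_greatest) auto
      then show "c \<le> (SUP n. ennreal (u n x))"
        unfolding k by (intro SUP_upper2[of n]) (auto intro: ennreal_leI)
    qed
  qed
qed

section \<open>Measurable selection from compact-valued maps\<close>

text \<open>Successive minimisation of \<open>\<phi>\<^sub>0, \<phi>\<^sub>1, \<dots>\<close>. If these functions separate points, the sets
  have at most one point in common: the lexicographic minimiser, which involves no arbitrary choice.\<close>

primrec lex_min :: "'b set \<Rightarrow> (nat \<Rightarrow> 'b \<Rightarrow> ennreal) \<Rightarrow> nat \<Rightarrow> 'b set" where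
  "lex_min D \<phi> 0 = D"
| "lex_min D \<phi> (Suc n) = {b \<in> lex_min D \<phi> n. \<forall>b'\<in>lex_min D \<phi> n. \<phi> n b \<le> \<phi> n b'}"

lemma lex_min_closedin:
  assumes Y: "compact_space Y" and \<phi>: "\<And>n. continuous_map Y euclidean (\<phi> n)"
    and D: "closedin Y D" "D \<noteq> {}"
  shows "closedin Y (lex_min D \<phi> n) \<and> lex_min D \<phi> n \<noteq> {}"
proof (induction n)
  case (Suc n)
  have cl: "closedin Y {b \<in> topspace Y. \<phi> n b \<le> c}" for c
    using closedin_continuous_map_preimage[OF \<phi>[of n], of "{..c}"] by simp
  obtain b where b: "b \<in> lex_min D \<phi> n" "\<forall>b'\<in>lex_min D \<phi> n. \<phi> n b \<le> \<phi> n b'"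
    using lsc_attains_min[OF Y, of "\<phi> n" "lex_min D \<phi> n"] cl Suc by (auto simp: lsc_closedin_le)
  then have "lex_min D \<phi> (Suc n) = lex_min D \<phi> n \<inter> {b' \<in> topspace Y. \<phi> n b' \<le> \<phi> n b}"
    using Suc closedin_subset by fastforce
  then show ?case using Suc cl b by auto
qed (use D in simp)

text \<open>Measurability of a map \<open>x \<mapsto> D x\<close> with closed values is expressed by its hitting sets
  \<open>{x. D x \<inter> K \<noteq> {}}\<close>. A minimisation step preserves it: \<open>K\<close> meets the set of minimisers iff the minimum of \<open>\<phi>\<close>
  over \<open>D x \<inter> K\<close> is no larger than the one over \<open>D x\<close>, and both minima are measurable functions
  of \<open>x\<close> because their sublevel sets are again hitting sets.\<close>

lemma lex_min_hits_measurable: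
  assumes Y: "compact_space Y" and \<phi>: "\<And>n. continuous_map Y euclidean (\<phi> n)"
    and D: "\<And>x. x \<in> space S \<Longrightarrow> closedin Y (D x)" "\<And>x. x \<in> space S \<Longrightarrow> D x \<noteq> {}"
    and hit: "\<And>K. closedin Y K \<Longrightarrow> {x \<in> space S. D x \<inter> K \<noteq> {}} \<in> sets S"
    and K: "closedin Y K"
  shows "{x \<in> space S. lex_min (D x) \<phi> n \<inter> K \<noteq> {}} \<in> sets S"
  using K
proof (induction n arbitrary: K)
  case 0
  then show ?case using hit by simp
next
  case (Suc n)
  let ?L = "\<lambda>x. lex_min (D x) \<phi> n"
  define m where "m K x = (INF b\<in>?L x \<inter> K. \<phi> n b)" for K x
  have cl: "closedin Y {b \<in> topspace Y. \<phi> n b \<le> c}" for c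
    using closedin_continuous_map_preimage[OF \<phi>[of n], of "{..c}"] by simp
  have L: "closedin Y (?L x)" "?L x \<noteq> {}" if "x \<in> space S" for x
    using lex_min_closedin[OF Y \<phi> D[OF that]] by auto
  have att: "\<exists>b\<in>?L x \<inter> K. \<phi> n b = m K x" if x: "x \<in> space S" and K: "closedin Y K" and ne: "?L x \<inter> K \<noteq> {}" for x K
  proof -
    obtain b where b: "b \<in> ?L x \<inter> K" "\<forall>b'\<in>?L x \<inter> K. \<phi> n b \<le> \<phi> n b'"
      using lsc_attains_min[OF Y, of "\<phi> n" "?L x \<inter> K"] cl L(1)[OF x] K ne
      by (auto simp: lsc_closedin_le)
    then have "\<phi> n b = m K x"
      unfolding m_def by (meson INF_greatest INF_lower antisym)
    with b show ?thesis by blast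
  qed
  have meas: "m K \<in> borel_measurable S" if K: "closedin Y K" for K
  proof (rule borel_measurableI_le)
    fix c :: ennreal
    show "{x \<in> space S. m K x \<le> c} \<in> sets S"
    proof (cases "c = top")
      case False
      have "m K x \<le> c \<longleftrightarrow> ?L x \<inter> (K \<inter> {b \<in> topspace Y. \<phi> n b \<le> c}) \<noteq> {}" if x: "x \<in> space S" for x
      proof
        assume le: "m K x \<le> c"
        then have "?L x \<inter> K \<noteq> {}" using False by (auto simp: m_def top_unique)
        from att[OF x K this] le show "?L x \<inter> (K \<inter> {b \<in> topspace Y. \<phi> n b \<le> c}) \<noteq> {}"
          using closedin_subset[OF K] by auto
      next
        assume "?L x \<inter> (K \<inter> {b \<in> topspace Y. \<phi> n b \<le> c}) \<noteq> {}"
        then show "m K x \<le> c" unfolding m_def by (auto intro: INF_lower2)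
      qed
      then have "{x \<in> space S. m K x \<le> c} = {x \<in> space S. ?L x \<inter> (K \<inter> {b \<in> topspace Y. \<phi> n b \<le> c}) \<noteq> {}}"
        by blast
      also have "\<dots> \<in> sets S" using K cl by (intro Suc.IH) auto
      finally show ?thesis .
    qed auto
  qed
  have "lex_min (D x) \<phi> (Suc n) \<inter> K \<noteq> {} \<longleftrightarrow> ?L x \<inter> K \<noteq> {} \<and> m K x \<le> m (topspace Y) x"
    if x: "x \<in> space S" for x
  proof
    assume "lex_min (D x) \<phi> (Suc n) \<inter> K \<noteq> {}"
    then obtain b where b: "b \<in> ?L x \<inter> K" "\<forall>b'\<in>?L x. \<phi> n b \<le> \<phi> n b'" by auto
    then have "m K x \<le> m (topspace Y) x"
      unfolding m_def by (meson INF_greatest INF_lower IntD1 order_trans)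
    with b show "?L x \<inter> K \<noteq> {} \<and> m K x \<le> m (topspace Y) x" by blast
  next
    assume R: "?L x \<inter> K \<noteq> {} \<and> m K x \<le> m (topspace Y) x"
    then obtain b where b: "b \<in> ?L x \<inter> K" "\<phi> n b = m K x" using att[OF x Suc.prems] by blast
    have "\<phi> n b \<le> \<phi> n b'" if "b' \<in> ?L x" for b'
    proof -
      have "m (topspace Y) x \<le> \<phi> n b'"
        unfolding m_def using that closedin_subset[OF L(1)[OF x]] by (intro INF_lower) auto
      with R b show ?thesis by (auto intro: order_trans)
    qed
    then show "lex_min (D x) \<phi> (Suc n) \<inter> K \<noteq> {}" using b by auto
  qed
  then have "{x \<in> space S. lex_min (D x) \<phi> (Suc n) \<inter> K \<noteq> {}}
      = {x \<in> space S. ?L x \<inter> K \<noteq> {}} \<inter> {x \<in> space S. m K x \<le> m (topspace Y) x}"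
    by blast
  also have "\<dots> \<in> sets S"
    using Suc meas[OF Suc.prems] meas[OF closedin_topspace] by (intro sets.Int) auto
  finally show ?case .
qed

text \<open>The selected point lies in the closed set \<open>K\<close> iff every stage of the lexicographic minimisation
  hits \<open>K\<close>, by compactness; this is a countable intersection of measurable conditions.\<close>

lemma measurable_selection:
  assumes Y: "compact_space Y" and \<phi>: "\<And>n::nat. continuous_map Y euclidean (\<phi> n :: 'b \<Rightarrow> ennreal)"
    and sep: "\<And>b b'. b \<in> topspace Y \<Longrightarrow> b' \<in> topspace Y \<Longrightarrow> (\<And>n. \<phi> n b = \<phi> n b') \<Longrightarrow> b = b'"
    and D: "\<And>x. x \<in> space S \<Longrightarrow> closedin Y (D x)" "\<And>x. x \<in> space S \<Longrightarrow> D x \<noteq> {}"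
    and hit: "\<And>K. closedin Y K \<Longrightarrow> {x \<in> space S. D x \<inter> K \<noteq> {}} \<in> sets S"
  obtains s where "s \<in> S \<rightarrow>\<^sub>M borel_of Y" "\<And>x. x \<in> space S \<Longrightarrow> s x \<in> D x"
proof -
  let ?L = "\<lambda>x n. lex_min (D x) \<phi> n"
  have dec: "decseq (?L x)" for x
    by (intro decseq_SucI) auto
  have L: "closedin Y (?L x n)" "?L x n \<noteq> {}" if "x \<in> space S" for x n
    using lex_min_closedin[OF Y \<phi> D[OF that]] by auto
  have ex: "\<exists>b. \<forall>n. b \<in> ?L x n \<inter> K" if "x \<in> space S" "closedin Y K" "\<And>n. ?L x n \<inter> K \<noteq> {}" for x K
  proof -
    have "(\<Inter>n. ?L x n \<inter> K) \<noteq> {}"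
      using that L(1)[OF that(1)] dec[of x]
      by (intro compact_space_imp_nest[OF Y] decseq_SucI) auto
    then show ?thesis by auto
  qed
  have uniq: "b = b'" if x: "x \<in> space S" and b: "\<And>n. b \<in> ?L x n" "\<And>n. b' \<in> ?L x n" for x b b'
  proof (rule sep)
    show "b \<in> topspace Y" "b' \<in> topspace Y"
      using b closedin_subset[OF L(1)[OF x]] by blast+
    show "\<phi> n b = \<phi> n b'" for n
      using b[of "Suc n"] b[of n] by (auto intro: antisym)
  qed
  define s where "s x = (SOME b. \<forall>n. b \<in> ?L x n)" for x
  have s: "s x \<in> ?L x n" if "x \<in> space S" for x n
  proof -
    have "?L x n \<inter> topspace Y \<noteq> {}" for n
      using L[OF that] closedin_subset[of Y "?L x n"] by blast
    from ex[OF that closedin_topspace this] have "\<exists>b. \<forall>n. b \<in> ?L x n" by blast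
    from someI_ex[OF this] show ?thesis unfolding s_def by blast
  qed
  have sK: "{x \<in> space S. s x \<in> K} \<in> sets S" if K: "closedin Y K" for K
  proof -
    have "{x \<in> space S. s x \<in> K} = (\<Inter>n. {x \<in> space S. ?L x n \<inter> K \<noteq> {}})"
    proof (intro equalityI subsetI)
      fix x assume "x \<in> (\<Inter>n. {x \<in> space S. ?L x n \<inter> K \<noteq> {}})"
      then have x: "x \<in> space S" "\<And>n. ?L x n \<inter> K \<noteq> {}" by auto
      from ex[OF x(1) K x(2)] obtain b where "\<And>n. b \<in> ?L x n" "b \<in> K" by auto
      with uniq[OF x(1) this(1) s[OF x(1)]] x(1) show "x \<in> {x \<in> space S. s x \<in> K}" by simp
    qed (use s in auto)
    then show ?thesis
      using lex_min_hits_measurable[OF Y \<phi> D hit K] by auto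
  qed
  have in_D: "s x \<in> D x" if "x \<in> space S" for x
    using s[OF that, of 0] by simp
  have "s \<in> S \<rightarrow>\<^sub>M borel_of Y"
    unfolding borel_of_def
  proof (rule measurable_measure_of)
    show "s \<in> space S \<rightarrow> topspace Y"
      using in_D D(1) closedin_subset by blast
    then show "s -` U \<inter> space S \<in> sets S" if "U \<in> {U. openin Y U}" for U
    proof -
      have "s -` U \<inter> space S = space S - {x \<in> space S. s x \<in> topspace Y - U}"
        using \<open>s \<in> space S \<rightarrow> topspace Y\<close> by auto
      also have "\<dots> \<in> sets S" using sK[of "topspace Y - U"] that by auto
      finally show ?thesis .
    qed
  qed (auto dest: openin_subset)
  with in_D that show thesis by blast
qed

section \<open>Sums of measures\<close>

definition add_measure :: "'a measure \<Rightarrow> 'a measure \<Rightarrow> 'a measure" where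
  "add_measure \<mu> \<nu> = measure_of (space \<mu>) (sets \<mu>) (\<lambda>A. emeasure \<mu> A + emeasure \<nu> A)"

lemma space_add_measure[simp]: "space (add_measure \<mu> \<nu>) = space \<mu>"
  and sets_add_measure[simp, measurable_cong]: "sets (add_measure \<mu> \<nu>) = sets \<mu>"
  by (simp_all add: add_measure_def)

lemma emeasure_add_measure:
  assumes "sets \<nu> = sets \<mu>" "A \<in> sets \<mu>"
  shows "emeasure (add_measure \<mu> \<nu>) A = emeasure \<mu> A + emeasure \<nu> A"
  unfolding add_measure_def
proof (rule emeasure_measure_of_sigma[OF sets.sigma_algebra_axioms _ _ assms(2)])
  show "positive (sets \<mu>) (\<lambda>A. emeasure \<mu> A + emeasure \<nu> A)"
    by (simp add: positive_def)
  show "countably_additive (sets \<mu>) (\<lambda>A. emeasure \<mu> A + emeasure \<nu> A)"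
    using assms(1) by (auto simp: countably_additive_def suminf_add[symmetric] suminf_emeasure)
qed

lemma nn_integral_add_measure:
  assumes s: "sets \<nu> = sets \<mu>" and f: "f \<in> borel_measurable \<mu>"
  shows "(\<integral>\<^sup>+x. f x \<partial>add_measure \<mu> \<nu>) = (\<integral>\<^sup>+x. f x \<partial>\<mu>) + (\<integral>\<^sup>+x. f x \<partial>\<nu>)"
  using f
proof induction
  case (cong f g)
  moreover have "space \<nu> = space \<mu>" using s by (rule sets_eq_imp_space_eq)
  ultimately show ?case by (simp cong: nn_integral_cong_simp)
next
  case (set A)
  then show ?case using s by (simp add: emeasure_add_measure)
next
  case (mult u c)
  moreover from mult have "u \<in> borel_measurable \<nu>" using s by (simp cong: measurable_cong_sets)
  ultimately show ?case by (simp add: nn_integral_cmult distrib_left)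
next
  case (add u v)
  moreover from add have "u \<in> borel_measurable \<nu>" "v \<in> borel_measurable \<nu>" using s by (simp_all cong: measurable_cong_sets)
  ultimately show ?case by (simp add: nn_integral_add ac_simps)
next
  case (seq U)
  have UV: "U i \<in> borel_measurable \<nu>" for i using seq(1) s by (simp cong: measurable_cong_sets)
  have sp: "space \<nu> = space \<mu>" using s by (rule sets_eq_imp_space_eq)
  have inc: "incseq (\<lambda>i. \<integral>\<^sup>+x. U i x \<partial>\<rho>)" for \<rho> :: "'a measure"
    using seq(3) by (auto simp: incseq_def le_fun_def intro!: nn_integral_mono)
  have "(\<integral>\<^sup>+x. (SUP i. U i x) \<partial>\<rho>) = (SUP i. \<integral>\<^sup>+x. U i x \<partial>\<rho>)"
    if "\<And>i. U i \<in> borel_measurable \<rho>" for \<rho>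
    using seq(3) that by (intro nn_integral_monotone_convergence_SUP)
  from this[of \<mu>] this[of \<nu>] this[of "add_measure \<mu> \<nu>"] seq UV inc
  show ?case by (simp add: SUP_apply ennreal_SUP_add[symmetric] image_comp)
qed

lemma integral_add_measure:
  fixes f :: "'a \<Rightarrow> real"
  assumes s: "sets \<nu> = sets \<mu>" and \<mu>: "integrable \<mu> f" and \<nu>: "integrable \<nu> f"
  shows "(\<integral>x. f x \<partial>add_measure \<mu> \<nu>) = (\<integral>x. f x \<partial>\<mu>) + (\<integral>x. f x \<partial>\<nu>)"
proof -
  have [measurable]: "f \<in> borel_measurable \<mu>" using \<mu> by simp
  have fin: "(\<integral>\<^sup>+x. ennreal (f x) \<partial>\<mu>) < top" "(\<integral>\<^sup>+x. ennreal (- f x) \<partial>\<mu>) < top"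
     "(\<integral>\<^sup>+x. ennreal (f x) \<partial>\<nu>) < top" "(\<integral>\<^sup>+x. ennreal (- f x) \<partial>\<nu>) < top"
    using \<mu> \<nu> by (auto simp: real_integrable_def less_top)
  have "integrable (add_measure \<mu> \<nu>) f"
    using fin s by (simp add: real_integrable_def nn_integral_add_measure less_top)
  then show ?thesis
    using \<mu> \<nu> s fin by (simp add: real_lebesgue_integral_def nn_integral_add_measure enn2real_plus)
qed

section \<open>Lagrange multipliers under a Slater condition\<close>

text \<open>The multiplier is the supremum of \<open>0\<close> and the slopes \<open>(p - F \<mu>) / h \<mu>\<close> of the points that
  violate the constraint. It exceeds no slope \<open>(F \<nu> - p) / (- h \<nu>)\<close> of a strictly feasible point: mixing a violating with a
  strictly feasible point so that the constraint becomes tight gives a feasible point, where \<open>F\<close> is at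
  least \<open>p\<close>.\<close>

lemma lagrange_multiplier_single:
  fixes F h :: "'m \<Rightarrow> real"
  assumes conv: "\<And>\<mu> \<nu> t. \<mu> \<in> D \<Longrightarrow> \<nu> \<in> D \<Longrightarrow> 0 \<le> t \<Longrightarrow> t \<le> 1 \<Longrightarrow>
      \<exists>\<kappa>\<in>D. F \<kappa> = t * F \<mu> + (1 - t) * F \<nu> \<and> h \<kappa> = t * h \<mu> + (1 - t) * h \<nu>"
    and slater: "\<exists>\<mu>\<in>D. h \<mu> < 0"
    and bound: "\<And>\<mu>. \<mu> \<in> D \<Longrightarrow> h \<mu> \<le> 0 \<Longrightarrow> p \<le> F \<mu>"
  shows "\<exists>l\<ge>0. \<forall>\<mu>\<in>D. p \<le> F \<mu> + l * h \<mu>"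
proof -
  let ?A = "insert 0 ((\<lambda>\<mu>. (p - F \<mu>) / h \<mu>) ` {\<mu> \<in> D. 0 < h \<mu>})"
  have le: "a \<le> (F \<nu> - p) / (- h \<nu>)" if a: "a \<in> ?A" and \<nu>: "\<nu> \<in> D" "h \<nu> < 0" for a \<nu>
  proof (cases "a = 0")
    case True
    then show ?thesis using bound[OF \<nu>(1)] \<nu>(2) by (simp add: divide_nonneg_neg field_simps)
  next
    case False
    then obtain \<mu> where \<mu>: "\<mu> \<in> D" "0 < h \<mu>" "a = (p - F \<mu>) / h \<mu>" using a by auto
    \<comment> \<open>The weight for which the mixture satisfies \<open>h = 0\<close>.\<close>
    define t where "t = - h \<nu> / (h \<mu> - h \<nu>)"
    have t: "0 \<le> t" "t \<le> 1" "t * (h \<mu> - h \<nu>) = - h \<nu>"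
      using \<mu>(2) \<nu>(2) by (simp_all add: t_def field_simps)
    obtain \<kappa> where \<kappa>: "\<kappa> \<in> D" "F \<kappa> = t * F \<mu> + (1 - t) * F \<nu>" "h \<kappa> = t * h \<mu> + (1 - t) * h \<nu>"
      using conv[OF \<mu>(1) \<nu>(1) t(1,2)] by auto
    have "h \<kappa> = 0" using \<kappa>(3) t(3) by (simp add: algebra_simps)
    then have "p \<le> t * F \<mu> + (1 - t) * F \<nu>" using bound[OF \<kappa>(1)] \<kappa>(2) by simp
    then have "p * (h \<mu> - h \<nu>) \<le> (t * F \<mu> + (1 - t) * F \<nu>) * (h \<mu> - h \<nu>)"
      using \<mu>(2) \<nu>(2) by (intro mult_right_mono) auto
    also have "\<dots> = (t * (h \<mu> - h \<nu>)) * F \<mu> + ((h \<mu> - h \<nu>) - t * (h \<mu> - h \<nu>)) * F \<nu>"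
      by (simp add: algebra_simps)
    finally have "p * (h \<mu> - h \<nu>) \<le> - h \<nu> * F \<mu> + h \<mu> * F \<nu>" unfolding t(3) by simp
    then show ?thesis
      unfolding \<mu>(3) using \<mu>(2) \<nu>(2) by (simp add: pos_divide_le_eq pos_le_divide_eq field_simps)
  qed
  obtain \<nu>0 where \<nu>0: "\<nu>0 \<in> D" "h \<nu>0 < 0" using slater by blast
  have bdd: "bdd_above ?A" using le[OF _ \<nu>0] by (rule bdd_aboveI)
  have up: "a \<le> Sup ?A" if "a \<in> ?A" for a using that bdd by (rule cSup_upper)
  have "p \<le> F \<mu> + Sup ?A * h \<mu>" if \<mu>: "\<mu> \<in> D" for \<mu>
  proof -
    consider "0 < h \<mu>" | "h \<mu> = 0" | "h \<mu> < 0" by linarith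
    then show ?thesis
    proof cases
      case 1
      then have "(p - F \<mu>) / h \<mu> \<le> Sup ?A" using \<mu> by (intro up) auto
      then show ?thesis using 1 by (simp add: pos_divide_le_eq algebra_simps)
    next
      case 2
      then show ?thesis using bound[OF \<mu>] by simp
    next
      case 3
      have "Sup ?A \<le> (F \<mu> - p) / (- h \<mu>)" using le[OF _ \<mu> 3] by (intro cSup_least) auto
      then have "Sup ?A * (- h \<mu>) \<le> F \<mu> - p" using 3 by (subst (asm) pos_le_divide_eq) auto
      then show ?thesis by simp
    qed
  qed
  then show ?thesis using up[of 0] by auto
qed

text \<open>Induction on the number of constraints: the last one is moved into the objective on the convex
  set on which the other ones hold, and the induction hypothesis applies to the new objective on all of
  \<open>D\<close>. Convexity is phrased through the values of \<open>F\<close> and \<open>h\<close> at some mixture in \<open>D\<close>, because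
  \<open>D\<close> is going to be a set of measures, a type without vector space structure.\<close>

lemma lagrange_multipliers:
  fixes F :: "'m \<Rightarrow> real" and h :: "nat \<Rightarrow> 'm \<Rightarrow> real"
  assumes conv: "\<And>\<mu> \<nu> t. \<mu> \<in> D \<Longrightarrow> \<nu> \<in> D \<Longrightarrow> 0 \<le> t \<Longrightarrow> t \<le> 1 \<Longrightarrow>
      \<exists>\<kappa>\<in>D. F \<kappa> = t * F \<mu> + (1 - t) * F \<nu> \<and> (\<forall>j\<in>{1..n}. h j \<kappa> = t * h j \<mu> + (1 - t) * h j \<nu>)"
    and slater: "\<exists>\<mu>\<in>D. \<forall>j\<in>{1..n}. h j \<mu> < 0"
    and bound: "\<And>\<mu>. \<mu> \<in> D \<Longrightarrow> \<forall>j\<in>{1..n}. h j \<mu> \<le> 0 \<Longrightarrow> p \<le> F \<mu>"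
  shows "\<exists>g. (\<forall>j. 0 \<le> g j) \<and> (\<forall>\<mu>\<in>D. p \<le> F \<mu> + (\<Sum>j=1..n. g j * h j \<mu>))"
  using assms
proof (induction n arbitrary: F)
  case 0
  then show ?case by (intro exI[of _ "\<lambda>_. 0"]) auto
next
  case (Suc n)
  let ?D = "{\<mu> \<in> D. \<forall>j\<in>{1..n}. h j \<mu> \<le> 0}"
  have "\<exists>l\<ge>0. \<forall>\<mu>\<in>?D. p \<le> F \<mu> + l * h (Suc n) \<mu>"
  proof (rule lagrange_multiplier_single)
    fix \<mu> \<nu> and t :: real assume *: "\<mu> \<in> ?D" "\<nu> \<in> ?D" "0 \<le> t" "t \<le> 1"
    then obtain \<kappa> where \<kappa>: "\<kappa> \<in> D" "F \<kappa> = t * F \<mu> + (1 - t) * F \<nu>"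
        "\<forall>j\<in>{1..Suc n}. h j \<kappa> = t * h j \<mu> + (1 - t) * h j \<nu>"
      using Suc.prems(1)[of \<mu> \<nu> t] by blast
    have "h j \<kappa> \<le> 0" if "j \<in> {1..n}" for j
    proof -
      have "h j \<kappa> = t * h j \<mu> + (1 - t) * h j \<nu>" using \<kappa>(3) that by simp
      moreover have "t * h j \<mu> \<le> 0" "(1 - t) * h j \<nu> \<le> 0"
        using * that by (auto intro!: mult_nonneg_nonpos)
      ultimately show ?thesis by linarith
    qed
    then show "\<exists>\<kappa>\<in>?D. F \<kappa> = t * F \<mu> + (1 - t) * F \<nu> \<and> h (Suc n) \<kappa> = t * h (Suc n) \<mu> + (1 - t) * h (Suc n) \<nu>"
      using \<kappa> by (intro bexI[of _ \<kappa>]) auto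
  next
    show "\<exists>\<mu>\<in>?D. h (Suc n) \<mu> < 0"
      using Suc.prems(2) by (fastforce intro: less_imp_le)
  next
    fix \<mu> assume "\<mu> \<in> ?D" "h (Suc n) \<mu> \<le> 0"
    then show "p \<le> F \<mu>" by (intro Suc.prems(3)) (auto simp: le_Suc_eq)
  qed
  then obtain l where l: "0 \<le> l" "\<And>\<mu>. \<mu> \<in> ?D \<Longrightarrow> p \<le> F \<mu> + l * h (Suc n) \<mu>" by blast
  have "\<exists>g. (\<forall>j. 0 \<le> g j) \<and> (\<forall>\<mu>\<in>D. p \<le> (F \<mu> + l * h (Suc n) \<mu>) + (\<Sum>j=1..n. g j * h j \<mu>))"
  proof (rule Suc.IH)
    fix \<mu> \<nu> and t :: real assume *: "\<mu> \<in> D" "\<nu> \<in> D" "0 \<le> t" "t \<le> 1"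
    then obtain \<kappa> where \<kappa>: "\<kappa> \<in> D" "F \<kappa> = t * F \<mu> + (1 - t) * F \<nu>"
        "\<forall>j\<in>{1..Suc n}. h j \<kappa> = t * h j \<mu> + (1 - t) * h j \<nu>"
      using Suc.prems(1)[of \<mu> \<nu> t] by blast
    have hk: "h (Suc n) \<kappa> = t * h (Suc n) \<mu> + (1 - t) * h (Suc n) \<nu>" using \<kappa>(3) by simp
    have "F \<kappa> + l * h (Suc n) \<kappa> = t * (F \<mu> + l * h (Suc n) \<mu>) + (1 - t) * (F \<nu> + l * h (Suc n) \<nu>)"
      unfolding \<kappa>(2) hk by (simp add: algebra_simps)
    then show "\<exists>\<kappa>\<in>D. F \<kappa> + l * h (Suc n) \<kappa> = t * (F \<mu> + l * h (Suc n) \<mu>) + (1 - t) * (F \<nu> + l * h (Suc n) \<nu>)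
        \<and> (\<forall>j\<in>{1..n}. h j \<kappa> = t * h j \<mu> + (1 - t) * h j \<nu>)"
      using \<kappa> by (intro bexI[of _ \<kappa>]) auto
  next
    show "\<exists>\<mu>\<in>D. \<forall>j\<in>{1..n}. h j \<mu> < 0" using Suc.prems(2) by fastforce
  next
    show "p \<le> F \<mu> + l * h (Suc n) \<mu>" if "\<mu> \<in> D" "\<forall>j\<in>{1..n}. h j \<mu> \<le> 0" for \<mu> using that by (intro l(2)) auto
  qed
  then obtain g where g: "\<And>j. 0 \<le> g j" "\<And>\<mu>. \<mu> \<in> D \<Longrightarrow> p \<le> (F \<mu> + l * h (Suc n) \<mu>) + (\<Sum>j=1..n. g j * h j \<mu>)" by blast
  have eq: "(\<Sum>j=1..n. (g(Suc n := l)) j * h j \<mu>) = (\<Sum>j=1..n. g j * h j \<mu>)" for \<mu>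
    by (intro sum.cong) auto
  show ?case
    using g(2) g(1) l(1) by (intro exI[of _ "g(Suc n := l)"]) (auto simp: eq[simplified] algebra_simps)
qed

section \<open>The topology of the state space\<close>

lemma None_in_topspace[simp]: "None \<in> topspace (state_top M)"
  and Some_in_topspace[simp]: "Some x \<in> topspace (state_top M) \<longleftrightarrow> x \<in> states M"
  by (auto simp: topspace_state_top)

lemma continuous_map_state_top:
  "continuous_map (state_top M) euclidean u \<longleftrightarrow> continuous_on (states M) (u \<circ> Some)"
proof -
  have "Some -` {y \<in> topspace (state_top M). u y \<in> U} = states M \<inter> (u \<circ> Some) -` U" for U
    by auto
  then show ?thesis
    by (auto simp: continuous_map openin_state_top continuous_on_open_gen[of _ _ UNIV] comp_def)
qed

lemma lsc_state_top:
  "lower_semicontinuous_map (state_top M) u \<longleftrightarrow> lower_semicontinuous_map (top_of_set (states M)) (u \<circ> Some)"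
proof -
  have "Some -` {y \<in> topspace (state_top M). c < u y} = {x \<in> states M. c < u (Some x)}" for c
    by auto
  then show ?thesis
    by (simp add: lower_semicontinuous_map_def openin_state_top)
qed

lemma second_countable_euclidean: "second_countable (euclidean :: 'a::second_countable_topology topology)"
proof -
  obtain B :: "'a set set" where "countable B" "topological_basis B"
    using ex_countable_basis by blast
  then show ?thesis
    unfolding second_countable_def topological_basis_def
    by (intro exI[of _ B]) (metis \<open>topological_basis B\<close> open_openin topological_basisE topological_basis_open)
qed

lemma second_countable_top_of_set: "second_countable (top_of_set (S :: 'a::second_countable_topology set))"
  by (intro second_countable_subtopology second_countable_euclidean)

lemma second_countable_state_top:
  "second_countable (state_top (M :: ('x::polish_space, 'a) impulse_model))"
proof -
  obtain \<B> where B: "countable \<B>" "\<And>V. V \<in> \<B> \<Longrightarrow> openin (top_of_set (states M)) V"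
      "\<And>W x. openin (top_of_set (states M)) W \<Longrightarrow> x \<in> W \<Longrightarrow> \<exists>V\<in>\<B>. x \<in> V \<and> V \<subseteq> W"
    using second_countable_top_of_set[of "states M"] unfolding second_countable_def by metis
  show ?thesis
    unfolding second_countable_def
  proof (intro exI[of _ "insert {None} ((`) Some ` \<B>)"] conjI ballI allI impI)
    fix U y assume U: "openin (state_top M) U \<and> y \<in> U"
    show "\<exists>V\<in>insert {None} ((`) Some ` \<B>). y \<in> V \<and> V \<subseteq> U"
    proof (cases y)
      case (Some x)
      then obtain V where "V \<in> \<B>" "x \<in> V" "V \<subseteq> Some -` U"
        using B(3)[of "Some -` U" x] U by (auto simp: openin_state_top)
      then show ?thesis using Some by auto
    qed (use U in auto)
  qed (use B in \<open>auto simp: openin_state_top vimage_def image_iff\<close>)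
qed

section \<open>Kernel and costs of the induced decision process\<close>

locale bounded_semicontinuous_model =
  fixes M :: "('x::polish_space, 'a::polish_space) impulse_model"
  assumes valid: "valid_model M" and semicont: "semicontinuous_mdp M" and costs: "cost_conditions M"
begin

abbreviation "S \<equiv> topspace (state_top M)"
abbreviation "B \<equiv> action_set M"
abbreviation "SB \<equiv> prod_topology (state_top M) (top_of_set B)"

lemma compact_actions: "compact_space (top_of_set B)"
  using semicont by (auto simp: semicontinuous_mdp_def compact_space_def compactin_subtopology)

lemma actions_nonempty: "B \<noteq> {}"
  using valid by (auto simp: valid_model_def action_set_def)

lemma closedin_actions: "closedin (top_of_set B) B"
  using closedin_topspace[of "top_of_set B"] by simp

lemma space_action[simp]: "space (action_measure M) = B"
  by (simp add: space_restrict_space)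

lemma sets_pair_borel: "sets (state_measure M \<Otimes>\<^sub>M borel_of (top_of_set B)) = sets (stage_measure M)"
  by (intro sets_pair_measure_cong sets_borel_of_top_of_set refl)

lemma lsc_stage_measurable:
  fixes f :: "_ \<Rightarrow> ennreal"
  assumes "lower_semicontinuous_map SB f"
  shows "f \<in> borel_measurable (stage_measure M)"
  using lsc_pair_measurable[OF second_countable_state_top second_countable_top_of_set assms]
  by (simp only: measurable_cong_sets[OF sets_pair_borel refl])

lemma flow_in_states: "x \<in> states M \<Longrightarrow> 0 \<le> t \<Longrightarrow> flow M x t \<in> states M"
  using valid measurable_space[of "\<lambda>(x, t). flow M x t" "restrict_space borel (states M \<times> {0..})" "restrict_space borel (states M)" "(x, t)"]
  by (auto simp: valid_model_def space_restrict_space)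

lemma jump_in_states: "x \<in> states M \<Longrightarrow> a \<in> actions M \<Longrightarrow> jump M x a \<in> states M"
  using valid measurable_space[of "\<lambda>(x, a). jump M x a" "restrict_space borel (states M \<times> actions M)" "restrict_space borel (states M)" "(x, a)"]
  by (auto simp: valid_model_def space_restrict_space)

lemma transition_measurable:
  "(\<lambda>(y, b). transition M y b) \<in> stage_measure M \<rightarrow>\<^sub>M prob_algebra (state_measure M)"
  by (rule measurable_transition[OF valid])

lemma transition_in_space:
  assumes "y \<in> S" "b \<in> B"
  shows "prob_space (transition M y b)" "sets (transition M y b) = sets (state_measure M)"
    "space (transition M y b) = S"
proof -
  have "(y, b) \<in> space (stage_measure M)" using assms by (auto simp: space_pair_measure)
  from measurable_space[OF transition_measurable this]
  show *: "prob_space (transition M y b)" "sets (transition M y b) = sets (state_measure M)"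
    by (auto simp: space_prob_algebra)
  from sets_eq_imp_space_eq[OF *(2)] show "space (transition M y b) = S" by simp
qed

lemma nn_integral_transition_None:
  "u \<in> borel_measurable (state_measure M) \<Longrightarrow> (\<integral>\<^sup>+z. u z \<partial>transition M None b) = u None"
  by (simp add: nn_integral_return)

lemma nn_integral_transition_Some:
  assumes x: "x \<in> states M" and a: "a \<in> actions M" and u: "u \<in> borel_measurable (state_measure M)"
  shows "(\<integral>\<^sup>+z. u z \<partial>transition M (Some x) (\<theta>, a)) =
     (if \<theta> = \<infinity> then u None else
        ennreal (exp (- discount M * enn2real \<theta>)) * u (Some (jump M (flow M x (enn2real \<theta>)) a))
        + ennreal (1 - exp (- discount M * enn2real \<theta>)) * u None)"
proof (cases "\<theta> = \<infinity>")
  case True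
  then show ?thesis using u by (simp add: nn_integral_return)
next
  case False
  let ?p = "exp (- discount M * enn2real \<theta>)" and ?k = "Some (jump M (flow M x (enn2real \<theta>)) a)"
  have k: "?k \<in> S" using x a by (simp add: flow_in_states jump_in_states)
  have d: "0 \<le> discount M" using valid by (auto simp: valid_model_def)
  then have p: "0 \<le> ?p" "?p \<le> 1" by (auto simp: mult_nonneg_nonneg)
  have "(\<integral>\<^sup>+z. u z \<partial>transition M (Some x) (\<theta>, a)) =
      (\<integral>\<^sup>+c. u (if c then ?k else None) \<partial>measure_pmf (bernoulli_pmf ?p))"
    unfolding transition_eq_distr[OF False k d]
    using u k by (subst nn_integral_distr) auto
  also have "\<dots> = u ?k * ennreal ?p + u None * ennreal (1 - ?p)"
    by (subst nn_integral_bernoulli_pmf[OF p]) (simp_all only: if_True if_False zero_le)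
  finally show ?thesis
    by (simp only: False if_False mult.commute)
qed

text \<open>The kernel is continuous against bounded continuous integrands. A bounded lower semicontinuous
  integrand is an increasing limit of these, and a supremum of continuous functions is
  lower semicontinuous.\<close>

lemma lsc_transition:
  assumes u: "lower_semicontinuous_map (state_top M) u" and K: "\<And>y. y \<in> S \<Longrightarrow> u y \<le> ennreal K" "0 \<le> K"
  shows "lower_semicontinuous_map SB (\<lambda>(y, b). \<integral>\<^sup>+z. u z \<partial>transition M y b)"
proof -
  obtain v :: "nat \<Rightarrow> 'x \<Rightarrow> real" where v: "\<And>n. continuous_on (states M) (v n)"
      "\<And>n x. x \<in> states M \<Longrightarrow> 0 \<le> v n x" "\<And>n x. x \<in> states M \<Longrightarrow> v n x \<le> K"
      "\<And>m n x. x \<in> states M \<Longrightarrow> m \<le> n \<Longrightarrow> v m x \<le> v n x"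
      "\<And>x. x \<in> states M \<Longrightarrow> (u \<circ> Some) x = (SUP n. ennreal (v n x))"
    using lsc_approx_continuous[OF u[unfolded lsc_state_top], of K] K by (auto simp: comp_def)
  have uN: "u None \<le> ennreal K" "u None < top"
    using K(1)[of None] by (auto intro: le_less_trans)
  \<comment> \<open>The cemetery is isolated, so its value does not affect continuity.\<close>
  define w where "w n y = (case y of None \<Rightarrow> enn2real (u None) | Some x \<Rightarrow> v n x)" for n :: nat and y
  have wcont: "continuous_map (state_top M) euclideanreal (w n)" for n
    unfolding continuous_map_state_top using v(1)[of n] by (simp add: comp_def w_def)
  have w: "0 \<le> w n y" "w n y \<le> K" if "y \<in> S" for n y
    using that v(2,3) uN K(2) by (auto simp: w_def split: option.splits)
       (metis K(2) enn2real_leI)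
  have wmono: "w m y \<le> w n y" if "y \<in> S" "m \<le> n" for m n y
    using that v(4) by (auto simp: w_def split: option.splits)
  have wsup: "u y = (SUP n. ennreal (w n y))" if "y \<in> S" for y
    using that v(5) uN by (cases y) (auto simp: w_def)
  have wmeas: "w n \<in> borel_measurable (state_measure M)" for n
  proof (rule borel_measurableI)
    fix U :: "real set" assume "open U"
    then have "openin (state_top M) {y \<in> S. w n y \<in> U}"
      by (intro openin_continuous_map_preimage[OF wcont]) auto
    then show "w n -` U \<inter> space (state_measure M) \<in> sets (state_measure M)"
      by (auto dest!: openin_in_borel_of simp: vimage_def Int_def conj_commute)
  qed
  have bdd: "bounded (w n ` S)" for n
    using w by (intro boundedI[of _ K]) (auto simp: abs_of_nonneg)
  have cont: "continuous_map SB euclideanreal (\<lambda>(y, b). \<integral>z. w n z \<partial>transition M y b)" for n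
    using semicont wcont bdd by (auto simp: semicontinuous_mdp_def)
  have lsc_n: "lower_semicontinuous_map SB (\<lambda>z. ennreal (case z of (y, b) \<Rightarrow> \<integral>z. w n z \<partial>transition M y b))" for n
    unfolding lower_semicontinuous_map_def
  proof
    fix c
    have "open {r :: real. c < ennreal r}"
      by (intro open_Collect_less continuous_on_const continuous_on_ennreal continuous_on_id)
    from openin_continuous_map_preimage[OF cont, of "{r. c < ennreal r}" n] this
    show "openin SB {z \<in> topspace SB. c < ennreal (case z of (y, b) \<Rightarrow> \<integral>z. w n z \<partial>transition M y b)}"
      by simp
  qed
  have eq: "(\<integral>\<^sup>+z. u z \<partial>transition M y b) = (SUP n. ennreal (\<integral>z. w n z \<partial>transition M y b))"
    if yb: "y \<in> S" "b \<in> B" for y b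
  proof -
    interpret T: prob_space "transition M y b" by (rule transition_in_space[OF yb])
    have [simp]: "space (transition M y b) = S" and
      [measurable_cong, simp]: "sets (transition M y b) = sets (state_measure M)"
      by (rule transition_in_space[OF yb])+
    have wT: "w n \<in> borel_measurable (transition M y b)" for n
      using wmeas by simp
    have "(\<integral>\<^sup>+z. u z \<partial>transition M y b) = (\<integral>\<^sup>+z. (SUP n. ennreal (w n z)) \<partial>transition M y b)"
      by (intro nn_integral_cong) (simp add: wsup)
    also have "\<dots> = (SUP n. \<integral>\<^sup>+z. ennreal (w n z) \<partial>transition M y b)"
      using wT wmono by (intro nn_integral_monotone_convergence_SUP_AE AE_I2) (auto intro: ennreal_leI)
    also have "\<dots> = (SUP n. ennreal (\<integral>z. w n z \<partial>transition M y b))"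
    proof (intro SUP_cong refl nn_integral_eq_integral)
      show "integrable (transition M y b) (w n)" for n
        using wT w by (intro T.integrable_const_bound[where B=K]) auto
    qed (use w in auto)
    finally show ?thesis .
  qed
  have "lower_semicontinuous_map SB (\<lambda>z. SUP n. ennreal (case z of (y, b) \<Rightarrow> \<integral>z. w n z \<partial>transition M y b))"
    by (intro lsc_SUP lsc_n)
  then show ?thesis
    by (rule lsc_cong[THEN iffD1, rotated]) (auto simp: eq)
qed

text \<open>A step with waiting time \<open>\<theta>\<close> survives with probability \<open>exp (- \<alpha> \<theta>)\<close>, and its impulse costs at
  least \<open>\<delta> exp (- \<alpha> \<theta>)\<close>. This bound turns finite cost into finite total mass.\<close>

lemma survival_le_cost:
  obtains \<delta> where "0 < \<delta>"
    "\<And>\<Gamma> y b. \<Gamma> \<in> sets (state_measure M) \<Longrightarrow> None \<notin> \<Gamma> \<Longrightarrow> y \<in> S \<Longrightarrow> b \<in> B \<Longrightarrow>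
       ennreal \<delta> * emeasure (transition M y b) \<Gamma> \<le> cost M 0 y b"
proof -
  obtain \<delta> where \<delta>: "0 < \<delta>" "\<And>x a. x \<in> states M \<Longrightarrow> a \<in> actions M \<Longrightarrow> ennreal \<delta> \<le> impulse_cost M 0 x a"
    using costs by (auto simp: cost_conditions_def)
  have "ennreal \<delta> * emeasure (transition M y b) \<Gamma> \<le> cost M 0 y b"
    if A: "\<Gamma> \<in> sets (state_measure M)" "None \<notin> \<Gamma>" and y: "y \<in> S" and b: "b \<in> B" for \<Gamma> y b
  proof -
    have ind: "emeasure (transition M y b) \<Gamma> = (\<integral>\<^sup>+z. indicator \<Gamma> z \<partial>transition M y b)"
      using A transition_in_space[OF y b] by simp
    show ?thesis
    proof (cases y)
      case None
      then show ?thesis unfolding ind using A by (simp only: nn_integral_transition_None borel_measurable_indicator) simp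
    next
      case (Some x)
      obtain \<theta> a where ta: "b = (\<theta>, a)" "a \<in> actions M" using b by (cases b) (auto simp: action_set_def)
      have x: "x \<in> states M" using y Some by simp
      show ?thesis
      proof (cases "\<theta> = \<infinity>")
        case True
        then show ?thesis unfolding ind[unfolded Some ta] Some ta
          using A x ta by (subst nn_integral_transition_Some) auto
      next
        case False
        have "ennreal \<delta> * emeasure (transition M y b) \<Gamma> \<le> ennreal \<delta> * ennreal (exp (- discount M * enn2real \<theta>))"
          unfolding ind[unfolded Some ta] Some ta using A x ta False
          by (subst nn_integral_transition_Some) (auto intro!: mult_left_mono simp: indicator_def)
        also have "\<dots> \<le> ennreal (exp (- discount M * enn2real \<theta>)) * impulse_cost M 0 (flow M x (enn2real \<theta>)) a"
          using \<delta>(2)[of "flow M x (enn2real \<theta>)" a] x ta(2)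
          by (subst mult.commute) (auto intro!: mult_left_mono simp: flow_in_states)
        also have "\<dots> \<le> cost M 0 y b"
          unfolding Some ta using False by (simp add: add_increasing)
        finally show ?thesis .
      qed
    qed
  qed
  with \<delta>(1) show thesis by (rule that)
qed

lemma nn_integral_discount:
  "(\<integral>\<^sup>+t\<in>{0..}. ennreal (exp (- discount M * t)) \<partial>lborel) = ennreal (1 / discount M)"
proof -
  have d: "0 < discount M" using valid by (auto simp: valid_model_def)
  interpret E: prob_space "density lborel (exponential_density (discount M))"
    by (rule prob_space_exponential_density[OF d])
  have "1 = (\<integral>\<^sup>+t. ennreal (exponential_density (discount M) t) \<partial>lborel)"
    using E.emeasure_space_1 by (simp add: emeasure_density)
  also have "\<dots> = (\<integral>\<^sup>+t. ennreal (discount M) * (ennreal (exp (- discount M * t)) * indicator {0..} t) \<partial>lborel)"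
    using d by (intro nn_integral_cong) (auto simp: exponential_density_def ennreal_mult' indicator_def mult.commute)
  also have "\<dots> = ennreal (discount M) * (\<integral>\<^sup>+t\<in>{0..}. ennreal (exp (- discount M * t)) \<partial>lborel)"
    by (rule nn_integral_cmult) simp
  finally have 1: "ennreal (discount M) * (\<integral>\<^sup>+t\<in>{0..}. ennreal (exp (- discount M * t)) \<partial>lborel) = 1" ..
  have 2: "ennreal (1 / discount M) * ennreal (discount M) = 1"
    using d by (simp flip: ennreal_mult)
  have "(\<integral>\<^sup>+t\<in>{0..}. ennreal (exp (- discount M * t)) \<partial>lborel)
      = ennreal (1 / discount M) * ennreal (discount M) * (\<integral>\<^sup>+t\<in>{0..}. ennreal (exp (- discount M * t)) \<partial>lborel)"
    unfolding 2 by (simp only: mult_1_left)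
  also have "\<dots> = ennreal (1 / discount M)"
    unfolding mult.assoc 1 by simp
  finally show ?thesis .
qed

lemma cost_bounded:
  obtains K where "0 \<le> K" "\<And>j y b. j \<le> num_constraints M \<Longrightarrow> y \<in> S \<Longrightarrow> b \<in> B \<Longrightarrow> cost M j y b \<le> ennreal K"
proof -
  let ?G = "Max ((\<lambda>j. SUP x\<in>states M. gradual_cost M j x) ` {0..num_constraints M})"
  let ?I = "Max ((\<lambda>j. SUP (x, a)\<in>states M \<times> actions M. impulse_cost M j x a) ` {0..num_constraints M})"
  have "?G + ?I < \<infinity>" using costs by (auto simp: cost_conditions_def)
  then obtain k where k: "?G + ?I = ennreal k" "0 \<le> k"
    by (cases "?G + ?I") auto
  have G: "gradual_cost M j x \<le> ennreal k" if "j \<le> num_constraints M" "x \<in> states M" for j x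
  proof -
    have "gradual_cost M j x \<le> (SUP x\<in>states M. gradual_cost M j x)" using that by (intro SUP_upper)
    also have "\<dots> \<le> ?G" using that by (intro Max_ge) auto
    also have "\<dots> \<le> ennreal k" using k by (metis le_iff_add)
    finally show ?thesis .
  qed
  have I: "impulse_cost M j x a \<le> ennreal k" if "j \<le> num_constraints M" "x \<in> states M" "a \<in> actions M" for j x a
  proof -
    have "impulse_cost M j x a \<le> (SUP (x, a)\<in>states M \<times> actions M. impulse_cost M j x a)"
      using that by (intro SUP_upper2[of "(x, a)"]) auto
    also have "\<dots> \<le> ?I" using that by (intro Max_ge) auto
    also have "\<dots> \<le> ennreal k" using k by (metis le_iff_add add.commute)
    finally show ?thesis .
  qed
  have d: "0 < discount M" using valid by (auto simp: valid_model_def)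
  show thesis
  proof (rule that[of "k / discount M + k"])
    show "0 \<le> k / discount M + k" using k d by simp
    fix j y b assume jyb: "j \<le> num_constraints M" "y \<in> S" "b \<in> B"
    show "cost M j y b \<le> ennreal (k / discount M + k)"
    proof (cases y)
      case (Some x)
      obtain \<theta> a where ta: "b = (\<theta>, a)" "a \<in> actions M" using jyb by (cases b) (auto simp: action_set_def)
      have x: "x \<in> states M" using jyb Some by simp
      have "(\<integral>\<^sup>+t\<in>{t. 0 \<le> t \<and> ennreal t \<le> \<theta>}. ennreal (exp (- discount M * t)) * gradual_cost M j (flow M x t) \<partial>lborel)
        \<le> (\<integral>\<^sup>+t. ennreal k * (ennreal (exp (- discount M * t)) * indicator {0..} t) \<partial>lborel)"
        using G[OF jyb(1)] x
        by (intro nn_integral_mono)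
           (auto simp: indicator_def mult.commute intro!: mult_right_mono flow_in_states)
      also have "\<dots> = ennreal k * ennreal (1 / discount M)"
        by (subst nn_integral_cmult) (auto simp: nn_integral_discount[simplified])
      also have "\<dots> = ennreal (k / discount M)"
        using k d by (simp flip: ennreal_mult)
      finally have 1: "(\<integral>\<^sup>+t\<in>{t. 0 \<le> t \<and> ennreal t \<le> \<theta>}. ennreal (exp (- discount M * t)) * gradual_cost M j (flow M x t) \<partial>lborel)
        \<le> ennreal (k / discount M)" .
      have "ennreal (exp (- discount M * enn2real \<theta>)) * impulse_cost M j (flow M x (enn2real \<theta>)) a \<le> 1 * ennreal k"
        using I[OF jyb(1), of "flow M x (enn2real \<theta>)" a] x ta d
        by (intro mult_mono) (auto simp: flow_in_states)
      then have 2: "(if \<theta> = \<infinity> then 0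
        else ennreal (exp (- discount M * enn2real \<theta>))
             * impulse_cost M j (flow M x (enn2real \<theta>)) a) \<le> ennreal k"
        by simp
      show ?thesis unfolding Some ta cost.simps using add_mono[OF 1 2] k d by simp
    qed simp
  qed
qed

section \<open>Value iteration and the optimality equation\<close>

definition running :: "(nat \<Rightarrow> real) \<Rightarrow> 'x option \<Rightarrow> ennreal \<times> 'a \<Rightarrow> ennreal" where
  "running g y b = cost M 0 y b + (\<Sum>j=1..num_constraints M. ennreal (g j) * cost M j y b)"

lemma lsc_cost: "j \<le> num_constraints M \<Longrightarrow> lower_semicontinuous_map SB (\<lambda>(y, b). cost M j y b)"
  using semicont by (auto simp: semicontinuous_mdp_def)

lemma cost_measurable: "j \<le> num_constraints M \<Longrightarrow> (\<lambda>(y, b). cost M j y b) \<in> borel_measurable (stage_measure M)"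
  by (intro lsc_stage_measurable lsc_cost)

lemma lsc_running: "lower_semicontinuous_map SB (\<lambda>(y, b). running g y b)"
  using lsc_cost unfolding running_def case_prod_beta by (intro lsc_add lsc_sum lsc_cmult) auto

lemma running_measurable: "(\<lambda>(y, b). running g y b) \<in> borel_measurable (stage_measure M)"
  by (intro lsc_stage_measurable lsc_running)

lemma running_None[simp]: "running g None b = 0"
  by (simp add: running_def)

lemma running_bounded:
  obtains K where "0 \<le> K" "\<forall>y\<in>S. \<forall>b\<in>B. running g y b \<le> ennreal K"
proof -
  obtain K where K: "0 \<le> K" "\<And>j y b. j \<le> num_constraints M \<Longrightarrow> y \<in> S \<Longrightarrow> b \<in> B \<Longrightarrow> cost M j y b \<le> ennreal K"
    by (rule cost_bounded) blast
  show thesis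
  proof (rule that[of "K + (\<Sum>j=1..num_constraints M. max 0 (g j) * K)"])
    show "0 \<le> K + (\<Sum>j=1..num_constraints M. max 0 (g j) * K)"
      using K by (intro add_nonneg_nonneg sum_nonneg) auto
    show "\<forall>y\<in>S. \<forall>b\<in>B. running g y b \<le> ennreal (K + (\<Sum>j=1..num_constraints M. max 0 (g j) * K))"
    proof (intro ballI)
      fix y b assume yb: "y \<in> S" "b \<in> B"
      have "ennreal (g j) * cost M j y b \<le> ennreal (max 0 (g j) * K)" if "j \<in> {1..num_constraints M}" for j
      proof -
        have "ennreal (g j) * cost M j y b \<le> ennreal (max 0 (g j)) * ennreal K"
          using K(2)[of j y b] that yb by (intro mult_mono) (auto intro: ennreal_leI)
        then show ?thesis using K by (simp add: ennreal_mult)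
      qed
      then have "running g y b \<le> ennreal K + (\<Sum>j=1..num_constraints M. ennreal (max 0 (g j) * K))"
        unfolding running_def using K(2)[of 0 y b] yb by (intro add_mono sum_mono) auto
      also have "\<dots> = ennreal (K + (\<Sum>j=1..num_constraints M. max 0 (g j) * K))"
        using K by (subst ennreal_plus) (auto intro!: sum_nonneg simp: sum_ennreal)
      finally show "running g y b \<le> ennreal (K + (\<Sum>j=1..num_constraints M. max 0 (g j) * K))" .
    qed
  qed
qed

primrec value_iteration :: "(nat \<Rightarrow> real) \<Rightarrow> nat \<Rightarrow> 'x option \<Rightarrow> ennreal" where
  "value_iteration g 0 y = 0"
| "value_iteration g (Suc n) y =
     (INF b\<in>B. running g y b + (\<integral>\<^sup>+z. value_iteration g n z \<partial>transition M y b))"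

definition optimal_value :: "(nat \<Rightarrow> real) \<Rightarrow> 'x option \<Rightarrow> ennreal" where
  "optimal_value g y = (SUP n. value_iteration g n y)"

text \<open>The bound does not grow with \<open>n\<close> because waiting forever moves the process to the cemetery, where
  no further cost arises. A uniform bound is needed to apply \<open>lsc_transition\<close> at each stage.\<close>

lemma value_iteration_lsc_bounded:
  assumes K: "\<forall>y\<in>S. \<forall>b\<in>B. running g y b \<le> ennreal K" and K0: "0 \<le> K"
  shows "lower_semicontinuous_map (state_top M) (value_iteration g n) \<and> value_iteration g n None = 0 \<and>
    (\<forall>y\<in>S. value_iteration g n y \<le> ennreal K)"
proof (induction n)
  case 0
  then show ?case by (simp add: lsc_const)
next
  case (Suc n)
  then have lsc: "lower_semicontinuous_map (state_top M) (value_iteration g n)"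
    and None: "value_iteration g n None = 0"
    and le: "\<And>y. y \<in> S \<Longrightarrow> value_iteration g n y \<le> ennreal K" by auto
  have "lower_semicontinuous_map (state_top M) (value_iteration g (Suc n))"
    unfolding value_iteration.simps
    using lsc_add[OF lsc_running[of g] lsc_transition[OF lsc le K0]]
    by (intro lsc_INF_compact[OF compact_actions]) (auto simp: case_prod_beta' closedin_actions)
  moreover have "value_iteration g (Suc n) None = 0"
    using None actions_nonempty lsc_borel_measurable[OF lsc]
    by (simp add: nn_integral_transition_None del: transition.simps)
  moreover have "value_iteration g (Suc n) y \<le> ennreal K" if y: "y \<in> S" for y
  proof (cases y)
    case (Some x)
    obtain a where a: "a \<in> actions M" using valid by (auto simp: valid_model_def)
    then have b: "(\<infinity>, a) \<in> B" by (auto simp: action_set_def)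
    have "value_iteration g (Suc n) y \<le> running g y (\<infinity>, a) + (\<integral>\<^sup>+z. value_iteration g n z \<partial>transition M y (\<infinity>, a))"
      using b by (auto intro: INF_lower)
    also have "(\<integral>\<^sup>+z. value_iteration g n z \<partial>transition M y (\<infinity>, a)) = 0"
      using Some y a lsc_borel_measurable[OF lsc] None by (simp add: nn_integral_transition_Some del: transition.simps)
    finally show ?thesis using K[rule_format, OF y b] by simp
  qed (use \<open>value_iteration g (Suc n) None = 0\<close> in \<open>simp del: value_iteration.simps\<close>)
  ultimately show ?case by blast
qed

lemma lsc_value_iteration: "lower_semicontinuous_map (state_top M) (value_iteration g n)"
proof -
  obtain K where "0 \<le> K" "\<forall>y\<in>S. \<forall>b\<in>B. running g y b \<le> ennreal K"
    by (rule running_bounded) blast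
  then show ?thesis by (rule value_iteration_lsc_bounded[THEN conjunct1, rotated])
qed

lemma lsc_optimal_value: "lower_semicontinuous_map (state_top M) (optimal_value g)"
  unfolding optimal_value_def by (intro lsc_SUP lsc_value_iteration)

lemma optimal_value_measurable: "optimal_value g \<in> borel_measurable (state_measure M)"
  by (intro lsc_borel_measurable lsc_optimal_value)

lemma value_iteration_measurable: "value_iteration g n \<in> borel_measurable (state_measure M)"
  by (intro lsc_borel_measurable lsc_value_iteration)

lemma optimal_value_None: "optimal_value g None = 0"
proof -
  obtain K where "0 \<le> K" "\<forall>y\<in>S. \<forall>b\<in>B. running g y b \<le> ennreal K"
    by (rule running_bounded) blast
  then have "value_iteration g n None = 0" for n
    by (rule value_iteration_lsc_bounded[THEN conjunct2, THEN conjunct1, rotated])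
  then show ?thesis
    unfolding optimal_value_def by simp
qed

lemma optimal_value_bounded:
  obtains K where "0 \<le> K" "\<And>y. y \<in> S \<Longrightarrow> optimal_value g y \<le> ennreal K"
proof -
  obtain K where K: "0 \<le> K" "\<forall>y\<in>S. \<forall>b\<in>B. running g y b \<le> ennreal K"
    by (rule running_bounded) blast
  have "optimal_value g y \<le> ennreal K" if "y \<in> S" for y
    unfolding optimal_value_def
    using value_iteration_lsc_bounded[OF K(2,1), THEN conjunct2, THEN conjunct2, THEN bspec, OF that]
    by (intro SUP_least)
  with K(1) show thesis by (rule that)
qed

lemma value_iteration_Suc_ge: "y \<in> S \<Longrightarrow> value_iteration g n y \<le> value_iteration g (Suc n) y"
proof (induction n arbitrary: y)
  case (Suc n)
  have "(\<integral>\<^sup>+z. value_iteration g n z \<partial>transition M y b) \<le> (\<integral>\<^sup>+z. value_iteration g (Suc n) z \<partial>transition M y b)"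
    if "b \<in> B" for b
    using Suc.IH transition_in_space(3)[OF Suc.prems that] by (intro nn_integral_mono) simp
  then have "(INF b\<in>B. running g y b + (\<integral>\<^sup>+z. value_iteration g n z \<partial>transition M y b))
     \<le> (INF b\<in>B. running g y b + (\<integral>\<^sup>+z. value_iteration g (Suc n) z \<partial>transition M y b))"
    by (intro INF_mono) (auto intro: add_left_mono)
  then show ?case by simp
qed simp

lemma nn_integral_optimal_value:
  assumes yb: "y \<in> S" "b \<in> B"
  shows "(\<integral>\<^sup>+z. optimal_value g z \<partial>transition M y b) = (SUP n. \<integral>\<^sup>+z. value_iteration g n z \<partial>transition M y b)"
  unfolding optimal_value_def
  using value_iteration_measurable[of g] transition_in_space[OF yb] value_iteration_Suc_ge
  by (intro nn_integral_monotone_convergence_SUP_AE)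
     (auto simp: measurable_cong_sets[OF transition_in_space(2)[OF yb] refl] simp del: value_iteration.simps)

lemma lsc_optimality: "lower_semicontinuous_map SB (\<lambda>(y, b). running g y b + (\<integral>\<^sup>+z. optimal_value g z \<partial>transition M y b))"
proof -
  obtain K where "0 \<le> K" "\<And>y. y \<in> S \<Longrightarrow> optimal_value g y \<le> ennreal K"
    by (rule optimal_value_bounded) blast
  from lsc_add[OF lsc_running[of g] lsc_transition[OF lsc_optimal_value this(2,1)]]
  show ?thesis by (simp add: case_prod_beta')
qed

text \<open>That the limit is at least the right-hand side needs an action which is good for all iterates
  simultaneously. The actions whose \<open>n\<close>-stage value is at most the limit form a decreasing sequence of
  nonempty compact sets, so they have a common element.\<close>

lemma optimality_equation:
  assumes y: "y \<in> S"
  shows "optimal_value g y = (INF b\<in>B. running g y b + (\<integral>\<^sup>+z. optimal_value g z \<partial>transition M y b))"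
proof (rule antisym)
  have le: "value_iteration g n z \<le> optimal_value g z" for n z
    unfolding optimal_value_def by (rule SUP_upper) simp
  have "value_iteration g n y \<le> running g y b + (\<integral>\<^sup>+z. optimal_value g z \<partial>transition M y b)" if b: "b \<in> B" for n b
  proof (cases n)
    case (Suc m)
    have "value_iteration g n y \<le> running g y b + (\<integral>\<^sup>+z. value_iteration g m z \<partial>transition M y b)"
      using b Suc by (auto intro: INF_lower)
    also have "\<dots> \<le> running g y b + (\<integral>\<^sup>+z. optimal_value g z \<partial>transition M y b)"
      by (intro add_left_mono nn_integral_mono le)
    finally show ?thesis .
  qed simp
  then show "optimal_value g y \<le> (INF b\<in>B. running g y b + (\<integral>\<^sup>+z. optimal_value g z \<partial>transition M y b))"
    unfolding optimal_value_def[of g y] by (intro SUP_least INF_greatest)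
  let ?F = "\<lambda>n b. running g y b + (\<integral>\<^sup>+z. value_iteration g n z \<partial>transition M y b)"
  let ?C = "\<lambda>n. {b \<in> B. ?F n b \<le> optimal_value g y}"
  obtain K where K: "0 \<le> K" "\<forall>y\<in>S. \<forall>b\<in>B. running g y b \<le> ennreal K"
    by (rule running_bounded) blast
  have lscF: "lower_semicontinuous_map SB (\<lambda>(y, b). running g y b + (\<integral>\<^sup>+z. value_iteration g n z \<partial>transition M y b))" for n
    using lsc_add[OF lsc_running[of g] lsc_transition[OF lsc_value_iteration[of g n] _ K(1)]]
      value_iteration_lsc_bounded[of g K n, OF K(2,1)] by (auto simp: case_prod_beta')
  have "(\<Inter>n. ?C n) \<noteq> {}"
  proof (rule compact_space_imp_nest[OF compact_actions])
    fix n
    show "closedin (top_of_set B) (?C n)"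
      using lsc_section[OF lscF y] by (auto simp: lsc_closedin_le)
    obtain b where "b \<in> B" "?F n b = value_iteration g (Suc n) y"
      using lsc_INF_attained[OF compact_actions lscF closedin_actions actions_nonempty y, of n]
      unfolding value_iteration.simps by blast
    with le[of "Suc n" y] have "b \<in> ?C n" by (simp del: value_iteration.simps)
    then show "?C n \<noteq> {}" by blast
  next
    show "decseq ?C"
    proof (rule decseq_SucI, rule subsetI)
      fix n b assume b: "b \<in> ?C (Suc n)"
      have "?F n b \<le> ?F (Suc n) b"
        using value_iteration_Suc_ge transition_in_space(3)[OF y] b
        by (intro add_left_mono nn_integral_mono) (simp del: value_iteration.simps)
      also have "\<dots> \<le> optimal_value g y" using b by (simp del: value_iteration.simps)
      finally show "b \<in> ?C n" using b by (simp del: value_iteration.simps)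
    qed
  qed
  then obtain b where b: "b \<in> B" "\<And>n. ?F n b \<le> optimal_value g y" by blast
  have "running g y b + (\<integral>\<^sup>+z. optimal_value g z \<partial>transition M y b) = (SUP n. ?F n b)"
    unfolding nn_integral_optimal_value[OF y b(1)] by (simp add: ennreal_SUP_add_right)
  also have "\<dots> \<le> optimal_value g y" using b by (intro SUP_least)
  finally show "(INF b\<in>B. running g y b + (\<integral>\<^sup>+z. optimal_value g z \<partial>transition M y b)) \<le> optimal_value g y"
    using b(1) by (rule INF_lower2[rotated])
qed

text \<open>The waiting time and the distances of the impulse to the points of a countable dense set.\<close>

lemma separating_functions:
  obtains \<phi> :: "nat \<Rightarrow> ennreal \<times> 'a \<Rightarrow> ennreal" where "\<And>n. continuous_on UNIV (\<phi> n)"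
    "\<And>b b'. \<forall>n. \<phi> n b = \<phi> n b' \<Longrightarrow> b = b'"
proof -
  obtain D :: "'a set" where D: "countable D" "\<And>X. open X \<Longrightarrow> X \<noteq> {} \<Longrightarrow> \<exists>d\<in>D. d \<in> X"
    using countable_dense_exists[where 'a='a] by metis
  have "D \<noteq> {}" using D(2)[of UNIV] by auto
  then have d: "range (from_nat_into D) = D" using D by (simp add: range_from_nat_into)
  define \<phi> where "\<phi> n b = (case n of 0 \<Rightarrow> fst b | Suc m \<Rightarrow> ennreal (dist (snd b) (from_nat_into D m)))" for n and b :: "ennreal \<times> 'a"
  have "continuous_on UNIV (\<phi> n)" for n
    unfolding \<phi>_def by (cases n) (auto intro!: continuous_on_ennreal continuous_intros)
  moreover have "b = b'" if eq: "\<forall>n. \<phi> n b = \<phi> n b'" for b b'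
  proof (rule prod_eqI)
    show "fst b = fst b'" using eq[THEN spec, of 0] by (simp add: \<phi>_def)
    have dd: "dist (snd b) d = dist (snd b') d" if "d \<in> D" for d
      using that d eq[THEN spec, of "Suc m" for m] by (force simp: \<phi>_def)
    show "snd b = snd b'"
    proof (rule ccontr)
      assume "snd b \<noteq> snd b'"
      then have "0 < dist (snd b) (snd b') / 2" by simp
      then obtain d where "d \<in> D" "d \<in> ball (snd b) (dist (snd b) (snd b') / 2)"
        using D(2)[of "ball (snd b) (dist (snd b) (snd b') / 2)"] by auto
      with dd[OF this(1)] dist_triangle2[of "snd b" "snd b'" d] show False by simp
    qed
  qed
  ultimately show thesis by (rule that)
qed

text \<open>The sets of optimal actions are compact, and the set of optimal actions meets \<open>K\<close> iff the minimum over
  \<open>K\<close> does not exceed the optimal value, a comparison of two lower semicontinuous functions of the state.\<close>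

lemma optimal_selector:
  obtains f where "f \<in> state_measure M \<rightarrow>\<^sub>M action_measure M" "\<And>y. y \<in> S \<Longrightarrow> f y \<in> B"
    "\<And>y. y \<in> S \<Longrightarrow> running g y (f y) + (\<integral>\<^sup>+z. optimal_value g z \<partial>transition M y (f y)) = optimal_value g y"
proof -
  obtain \<phi> :: "nat \<Rightarrow> ennreal \<times> 'a \<Rightarrow> ennreal" where \<phi>: "\<And>n. continuous_on UNIV (\<phi> n)"
    "\<And>b b'. \<forall>n. \<phi> n b = \<phi> n b' \<Longrightarrow> b = b'" by (rule separating_functions) blast
  let ?F = "\<lambda>y b. running g y b + (\<integral>\<^sup>+z. optimal_value g z \<partial>transition M y b)"
  let ?D = "\<lambda>y. {b \<in> B. ?F y b \<le> optimal_value g y}"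
  obtain f where f: "f \<in> state_measure M \<rightarrow>\<^sub>M borel_of (top_of_set B)" "\<And>y. y \<in> space (state_measure M) \<Longrightarrow> f y \<in> ?D y"
  proof (rule measurable_selection[OF compact_actions])
    show "continuous_map (top_of_set B) euclidean (\<phi> n)" for n
      using continuous_on_subset[OF \<phi>(1)[of n], of B] by simp
    show "b = b'" if "\<And>n. \<phi> n b = \<phi> n b'" for b b' by (intro \<phi>(2) allI that)
    show "closedin (top_of_set B) (?D y)" if "y \<in> space (state_measure M)" for y
      using lsc_section[OF lsc_optimality, of y] that by (auto simp: lsc_closedin_le)
    show "?D y \<noteq> {}" if "y \<in> space (state_measure M)" for y
    proof -
      have y: "y \<in> S" using that by simp
      obtain b where "b \<in> B" "?F y b = optimal_value g y"
        using lsc_INF_attained[OF compact_actions lsc_optimality closedin_actions actions_nonempty y, of g]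
        unfolding optimality_equation[OF y, symmetric] by blast
      then have "b \<in> ?D y" by simp
      then show ?thesis by blast
    qed
    show "{y \<in> space (state_measure M). ?D y \<inter> K \<noteq> {}} \<in> sets (state_measure M)" if K: "closedin (top_of_set B) K" for K
    proof (cases "K = {}")
      case False
      have KB: "K \<subseteq> B" using closedin_subset[OF K] by simp
      have "?D y \<inter> K \<noteq> {} \<longleftrightarrow> (INF b\<in>K. ?F y b) \<le> optimal_value g y" if y: "y \<in> S" for y
        using lsc_INF_attained[OF compact_actions lsc_optimality K False y, of g] KB
        by (auto intro: INF_lower2)
      then have "{y \<in> space (state_measure M). ?D y \<inter> K \<noteq> {}}
         = {y \<in> space (state_measure M). (INF b\<in>K. ?F y b) \<le> optimal_value g y}" by auto
      also have "\<dots> \<in> sets (state_measure M)"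
        using lsc_borel_measurable[OF lsc_INF_compact[OF compact_actions lsc_optimality K, of g]]
          optimal_value_measurable[of g] by measurable
      finally show ?thesis .
    qed simp
  qed blast
  show thesis
  proof (rule that)
    show "f \<in> state_measure M \<rightarrow>\<^sub>M action_measure M"
      using f(1) by (simp only: measurable_cong_sets[OF refl sets_borel_of_top_of_set])
    show fB: "f y \<in> B" if "y \<in> S" for y using f(2)[of y] that by simp
    show "?F y (f y) = optimal_value g y" if y: "y \<in> S" for y
    proof (rule antisym)
      show "?F y (f y) \<le> optimal_value g y" using f(2)[of y] y by simp
      show "optimal_value g y \<le> ?F y (f y)"
        unfolding optimality_equation[OF y, of g] using fB[OF y] by (rule INF_lower)
    qed
  qed
qed

end

section \<open>Strategies and value iteration\<close>

context bounded_semicontinuous_model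
begin

text \<open>The law of \<open>X\<^sub>n\<close> given the history \<open>\<omega>\<close> of the pairs before it.\<close>

definition next_state_law :: "'x option \<Rightarrow> nat \<Rightarrow> (nat \<Rightarrow> 'x option \<times> ennreal \<times> 'a) \<Rightarrow> 'x option measure" where
  "next_state_law x n \<omega> =
     (if n = 0 then return (state_measure M) x else transition M (fst (\<omega> (n - 1))) (snd (\<omega> (n - 1))))"

lemma next_state_law_space:
  assumes \<omega>: "\<omega> \<in> space (Pi\<^sub>M {0..<n} (\<lambda>_. stage_measure M))"
  shows "sets (next_state_law x n \<omega>) = sets (state_measure M)" "space (next_state_law x n \<omega>) = S"
proof -
  show s: "sets (next_state_law x n \<omega>) = sets (state_measure M)"
  proof (cases n)
    case (Suc m)
    then have "fst (\<omega> m) \<in> S" "snd (\<omega> m) \<in> B"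
      using \<omega> by (auto simp: space_PiM PiE_iff space_pair_measure mem_Times_iff)
    then show ?thesis using Suc transition_in_space(2) by (simp add: next_state_law_def)
  qed (simp add: next_state_law_def)
  from sets_eq_imp_space_eq[OF s] show "space (next_state_law x n \<omega>) = S" by simp
qed

context
  fixes \<pi> and x
  assumes \<pi>: "\<pi> \<in> strategies M" and x: "x \<in> S"
begin

lemma sets_strategic_measure[measurable_cong, simp]:
  "sets (strategic_measure M \<pi> x) = sets (Pi\<^sub>M UNIV (\<lambda>_. stage_measure M))"
proof -
  interpret Ionescu_Tulcea "stage_kernel M \<pi> x" "\<lambda>_. stage_measure M"
    by (rule Ionescu_Tulcea_stage_kernel[OF valid \<pi> x])
  show ?thesis unfolding strategic_measure_def by simp
qed

lemma measurable_coordinate: "(\<lambda>\<omega>. \<omega> n) \<in> strategic_measure M \<pi> x \<rightarrow>\<^sub>M stage_measure M"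
  by (simp add: measurable_cong_sets[OF sets_strategic_measure refl] measurable_component_singleton)

lemma coordinate_in_space:
  assumes "\<omega> \<in> space (strategic_measure M \<pi> x)"
  shows "fst (\<omega> n) \<in> S" "snd (\<omega> n) \<in> B"
  using measurable_space[OF measurable_coordinate assms, of n] by (auto simp: space_pair_measure)

text \<open>The Markov-type disintegration of the strategic measure: its marginal on the first \<open>n + 1\<close> pairs is
  the marginal on the first \<open>n\<close> pairs followed by the kernel for the next pair.\<close>

lemma nn_integral_coordinate:
  fixes u :: "'x option \<times> ennreal \<times> 'a \<Rightarrow> ennreal"
  assumes u[measurable]: "u \<in> borel_measurable (stage_measure M)"
  shows "(\<integral>\<^sup>+\<omega>. u (\<omega> n) \<partial>strategic_measure M \<pi> x) =
    (\<integral>\<^sup>+\<omega>. (\<integral>\<^sup>+z. u z \<partial>stage_kernel M \<pi> x n (restrict \<omega> {0..<n})) \<partial>strategic_measure M \<pi> x)"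
proof -
  interpret IT: Ionescu_Tulcea "stage_kernel M \<pi> x" "\<lambda>_. stage_measure M"
    by (rule Ionescu_Tulcea_stage_kernel[OF valid \<pi> x])
  let ?H = "\<lambda>n :: nat. Pi\<^sub>M {0..<n} (\<lambda>_. stage_measure M)"
  let ?P = "strategic_measure M \<pi> x"
  let ?C = "\<lambda>n. IT.C 0 n (\<lambda>_. undefined)"
  have u0: "(\<lambda>_. undefined) \<in> space (?H 0)" by (auto simp: space_PiM PiE_iff extensional_def)
  have upto: "IT.up_to {0..<m} = m" for m
  proof (rule antisym)
    show "m \<le> IT.up_to {0..<m}"
    proof (rule ccontr)
      assume "\<not> m \<le> IT.up_to {0..<m}"
      then have "IT.up_to {0..<m} \<in> {0..<m}" by simp
      from IT.up_to_less[OF finite_atLeastLessThan this] show False by simp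
    qed
  qed (simp add: IT.up_to_iff)
  have marg: "distr ?P (?H m) (\<lambda>\<omega>. restrict \<omega> {0..<m}) = ?C m" for m
  proof -
    have "distr ?P (?H m) (\<lambda>\<omega>. restrict \<omega> {0..<m}) = IT.CI {0..<m}"
      unfolding strategic_measure_def by (rule IT.distr_lim) simp
    also have "\<dots> = ?C m"
      unfolding IT.CI_def upto using IT.distr_C[OF order_refl u0, of m] by simp
    finally show ?thesis .
  qed
  have restr: "(\<lambda>\<omega>. restrict \<omega> {0..<m}) \<in> ?P \<rightarrow>\<^sub>M ?H m" for m
    by (auto intro!: measurable_restrict measurable_coordinate)
  have m1: "(\<lambda>\<omega>. u (\<omega> n)) \<in> borel_measurable (?H (Suc n))"
    by (rule measurable_compose[OF _ u]) (auto intro!: measurable_component_singleton)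
  have m2: "(\<lambda>\<omega>. \<integral>\<^sup>+z. u z \<partial>stage_kernel M \<pi> x n \<omega>) \<in> borel_measurable (?H n)"
    by (rule measurable_compose[OF IT.P nn_integral_measurable_subprob_algebra[OF u]])
  have spC: "space (?C n) = space (?H n)" using IT.space_C[OF u0, of n] by simp
  have "(\<integral>\<^sup>+\<omega>. u (\<omega> n) \<partial>?P) = (\<integral>\<^sup>+\<omega>. u (\<omega> n) \<partial>?C (Suc n))"
    unfolding marg[symmetric] by (subst nn_integral_distr[OF restr]) (simp_all add: m1)
  also have "\<dots> = (\<integral>\<^sup>+\<omega>. \<integral>\<^sup>+\<omega>'. u (\<omega>' n) \<partial>IT.eP n \<omega> \<partial>?C n)"
  proof -
    have "IT.eP n \<in> ?C n \<rightarrow>\<^sub>M subprob_algebra (?H (Suc n))"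
      using IT.measurable_eP[of n] IT.sets_C[OF u0, of n] by (simp cong: measurable_cong_sets)
    from nn_integral_bind[OF m1 this] show ?thesis by simp
  qed
  also have "\<dots> = (\<integral>\<^sup>+\<omega>. \<integral>\<^sup>+z. u z \<partial>stage_kernel M \<pi> x n \<omega> \<partial>?C n)"
    by (intro nn_integral_cong) (simp add: spC IT.nn_integral_eP m1)
  also have "\<dots> = (\<integral>\<^sup>+\<omega>. (\<integral>\<^sup>+z. u z \<partial>stage_kernel M \<pi> x n (restrict \<omega> {0..<n})) \<partial>?P)"
    unfolding marg[symmetric] by (subst nn_integral_distr[OF restr]) (simp_all add: m2)
  finally show ?thesis .
qed

lemma nn_integral_stage_kernel:
  fixes u :: "'x option \<times> ennreal \<times> 'a \<Rightarrow> ennreal"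
  assumes u[measurable]: "u \<in> borel_measurable (stage_measure M)"
    and \<omega>: "\<omega> \<in> space (Pi\<^sub>M {0..<n} (\<lambda>_. stage_measure M))"
  shows "(\<integral>\<^sup>+z. u z \<partial>stage_kernel M \<pi> x n \<omega>) =
    (\<integral>\<^sup>+y. \<integral>\<^sup>+b. u (y, b) \<partial>\<pi> n (\<omega>, y) \<partial>next_state_law x n \<omega>)"
proof -
  let ?H = "Pi\<^sub>M {0..<n} (\<lambda>_. stage_measure M)"
  let ?T = "next_state_law x n \<omega>"
  have "\<pi> n \<in> ?H \<Otimes>\<^sub>M state_measure M \<rightarrow>\<^sub>M prob_algebra (action_measure M)"
    using \<pi> by (auto simp: strategies_def)
  from measurable_compose[OF measurable_Pair1'[OF \<omega>] this]
  have p[measurable]: "(\<lambda>y. \<pi> n (\<omega>, y)) \<in> state_measure M \<rightarrow>\<^sub>M prob_algebra (action_measure M)" .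
  have ret: "(\<lambda>(y, b). return (stage_measure M) (y, b)) \<in> state_measure M \<Otimes>\<^sub>M action_measure M \<rightarrow>\<^sub>M prob_algebra (stage_measure M)"
    unfolding case_prod_beta by (rule measurable_compose[OF _ measurable_return_prob_space]) simp
  note sT = next_state_law_space(1)[OF \<omega>, of x] and spT = next_state_law_space(2)[OF \<omega>, of x]
  have k: "(\<lambda>y. \<pi> n (\<omega>, y) \<bind> (\<lambda>b. return (stage_measure M) (y, b))) \<in> ?T \<rightarrow>\<^sub>M subprob_algebra (stage_measure M)"
    using measurable_prob_algebraD[OF measurable_bind_prob_space2[OF p ret]]
    by (simp only: measurable_cong_sets[OF sT refl])
  have "(\<integral>\<^sup>+z. u z \<partial>stage_kernel M \<pi> x n \<omega>) =
      (\<integral>\<^sup>+y. \<integral>\<^sup>+z. u z \<partial>(\<pi> n (\<omega>, y) \<bind> (\<lambda>b. return (stage_measure M) (y, b))) \<partial>?T)"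
    unfolding stage_kernel_def next_state_law_def[symmetric] by (rule nn_integral_bind[OF u k])
  also have "\<dots> = (\<integral>\<^sup>+y. \<integral>\<^sup>+b. u (y, b) \<partial>\<pi> n (\<omega>, y) \<partial>?T)"
  proof (rule nn_integral_cong)
    fix y assume "y \<in> space ?T"
    then have y: "y \<in> space (state_measure M)" using spT by simp
    have sp: "sets (\<pi> n (\<omega>, y)) = sets (action_measure M)"
      using measurable_space[OF p y] by (simp add: space_prob_algebra)
    have "(\<lambda>b. return (stage_measure M) (y, b)) \<in> \<pi> n (\<omega>, y) \<rightarrow>\<^sub>M subprob_algebra (stage_measure M)"
      using measurable_compose[OF measurable_Pair1'[OF y] return_measurable] by (simp only: measurable_cong_sets[OF sp refl])
    from nn_integral_bind[OF u this]
    have "(\<integral>\<^sup>+z. u z \<partial>(\<pi> n (\<omega>, y) \<bind> (\<lambda>b. return (stage_measure M) (y, b)))) =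
      (\<integral>\<^sup>+b. \<integral>\<^sup>+z. u z \<partial>return (stage_measure M) (y, b) \<partial>\<pi> n (\<omega>, y))" .
    also have "\<dots> = (\<integral>\<^sup>+b. u (y, b) \<partial>\<pi> n (\<omega>, y))"
      using y sets_eq_imp_space_eq[OF sp] u
      by (intro nn_integral_cong nn_integral_return) (auto simp: space_pair_measure)
    finally show "(\<integral>\<^sup>+z. u z \<partial>(\<pi> n (\<omega>, y) \<bind> (\<lambda>b. return (stage_measure M) (y, b)))) = (\<integral>\<^sup>+b. u (y, b) \<partial>\<pi> n (\<omega>, y))" .
  qed
  finally show ?thesis .
qed

lemma policy_prob_space:
  assumes \<omega>: "\<omega> \<in> space (Pi\<^sub>M {0..<n} (\<lambda>_. stage_measure M))" and y: "y \<in> S"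
  shows "prob_space (\<pi> n (\<omega>, y))"
proof -
  have "\<pi> n \<in> Pi\<^sub>M {0..<n} (\<lambda>_. stage_measure M) \<Otimes>\<^sub>M state_measure M \<rightarrow>\<^sub>M prob_algebra (action_measure M)"
    using \<pi> by (auto simp: strategies_def)
  from measurable_space[OF this, of "(\<omega>, y)"] \<omega> y show ?thesis
    by (auto simp: space_pair_measure space_prob_algebra)
qed

lemma restrict_in_space:
  "\<omega> \<in> space (strategic_measure M \<pi> x) \<Longrightarrow> restrict \<omega> {0..<n} \<in> space (Pi\<^sub>M {0..<n} (\<lambda>_. stage_measure M))"
  using coordinate_in_space by (auto simp: space_PiM space_pair_measure mem_Times_iff)

lemma strategic_prob_space: "prob_space (strategic_measure M \<pi> x)"
proof -
  interpret IT: Ionescu_Tulcea "stage_kernel M \<pi> x" "\<lambda>_. stage_measure M"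
    by (rule Ionescu_Tulcea_stage_kernel[OF valid \<pi> x])
  have "prob_space (distr (strategic_measure M \<pi> x) (Pi\<^sub>M {} (\<lambda>_. stage_measure M)) (\<lambda>\<omega>. restrict \<omega> {}))"
    unfolding strategic_measure_def IT.distr_lim[OF finite.emptyI] by (rule IT.PF.prob_space_P) auto
  then show ?thesis
    by (rule prob_space_distrD[rotated]) (auto intro!: measurable_restrict)
qed

lemma nn_integral_stage_kernel_state:
  assumes v[measurable]: "v \<in> borel_measurable (state_measure M)"
    and \<omega>: "\<omega> \<in> space (Pi\<^sub>M {0..<n} (\<lambda>_. stage_measure M))"
  shows "(\<integral>\<^sup>+z. v (fst z) \<partial>stage_kernel M \<pi> x n \<omega>) = (\<integral>\<^sup>+y. v y \<partial>next_state_law x n \<omega>)"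
proof -
  have "(\<integral>\<^sup>+z. v (fst z) \<partial>stage_kernel M \<pi> x n \<omega>) = (\<integral>\<^sup>+y. \<integral>\<^sup>+b. v y \<partial>\<pi> n (\<omega>, y) \<partial>next_state_law x n \<omega>)"
    by (subst nn_integral_stage_kernel[OF _ \<omega>]) simp_all
  also have "\<dots> = (\<integral>\<^sup>+y. v y \<partial>next_state_law x n \<omega>)"
  proof (rule nn_integral_cong)
    fix y assume "y \<in> space (next_state_law x n \<omega>)"
    then have y: "y \<in> S" by (simp add: next_state_law_space(2)[OF \<omega>])
    interpret p: prob_space "\<pi> n (\<omega>, y)" by (rule policy_prob_space[OF \<omega> y])
    show "(\<integral>\<^sup>+b. v y \<partial>\<pi> n (\<omega>, y)) = v y"
      using p.emeasure_space_1 by simp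
  qed
  finally show ?thesis .
qed

lemma nn_integral_state:
  assumes v[measurable]: "v \<in> borel_measurable (state_measure M)"
  shows "(\<integral>\<^sup>+\<omega>. v (fst (\<omega> n)) \<partial>strategic_measure M \<pi> x) =
    (\<integral>\<^sup>+\<omega>. \<integral>\<^sup>+y. v y \<partial>next_state_law x n (restrict \<omega> {0..<n}) \<partial>strategic_measure M \<pi> x)"
proof -
  have "(\<lambda>z. v (fst z)) \<in> borel_measurable (stage_measure M)" by measurable
  from nn_integral_coordinate[OF this] show ?thesis
    by (rule trans) (intro nn_integral_cong nn_integral_stage_kernel_state v restrict_in_space)
qed

lemma nn_integral_state_0:
  assumes v: "v \<in> borel_measurable (state_measure M)"
  shows "(\<integral>\<^sup>+\<omega>. v (fst (\<omega> 0)) \<partial>strategic_measure M \<pi> x) = v x"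
proof -
  interpret P: prob_space "strategic_measure M \<pi> x" by (rule strategic_prob_space)
  show ?thesis
    using x by (simp add: nn_integral_state[OF v, of 0] next_state_law_def nn_integral_return v P.emeasure_space_1)
qed

text \<open>Integrands that depend on the state alone do not see the action kernel. So the identity
  holds for every strategy, and the lower bound on the performance of all strategies rests on it.\<close>

lemma nn_integral_state_Suc:
  assumes v: "v \<in> borel_measurable (state_measure M)"
  shows "(\<integral>\<^sup>+\<omega>. v (fst (\<omega> (Suc n))) \<partial>strategic_measure M \<pi> x) =
    (\<integral>\<^sup>+\<omega>. \<integral>\<^sup>+y. v y \<partial>transition M (fst (\<omega> n)) (snd (\<omega> n)) \<partial>strategic_measure M \<pi> x)"
  by (simp add: nn_integral_state[OF v] next_state_law_def)

lemma performance_eq_suminf: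
  assumes C[measurable]: "(\<lambda>(y, b). C y b) \<in> borel_measurable (stage_measure M)"
  shows "performance M x \<pi> C = (\<Sum>i. \<integral>\<^sup>+\<omega>. C (fst (\<omega> i)) (snd (\<omega> i)) \<partial>strategic_measure M \<pi> x)"
  unfolding performance_def
  using measurable_compose[OF measurable_coordinate C] by (subst nn_integral_suminf) (auto simp: case_prod_beta)

text \<open>Follow the strategy for \<open>k\<close> stages and charge the optimal \<open>(n - k)\<close>-stage cost afterwards. This
  quantity is nondecreasing in \<open>k\<close>, starts at the \<open>n\<close>-th iterate, and ends at the expected
  cost of the first \<open>n\<close> stages.\<close>

lemma value_iteration_le_performance: "value_iteration g n x \<le> performance M x \<pi> (running g)"
proof -
  let ?P = "strategic_measure M \<pi> x"
  let ?c = "\<lambda>i. \<integral>\<^sup>+\<omega>. running g (fst (\<omega> i)) (snd (\<omega> i)) \<partial>?P"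
  have rm: "(\<lambda>\<omega>. running g (fst (\<omega> i)) (snd (\<omega> i))) \<in> borel_measurable ?P" for i
    using measurable_compose[OF measurable_coordinate running_measurable] by (simp add: case_prod_beta)
  have "value_iteration g n x \<le> (\<Sum>i<k. ?c i) + (\<integral>\<^sup>+\<omega>. value_iteration g (n - k) (fst (\<omega> k)) \<partial>?P)" if "k \<le> n" for k
    using that
  proof (induction k)
    case 0
    then show ?case using nn_integral_state_0[OF value_iteration_measurable[of g n]] by simp
  next
    case (Suc k)
    let ?V = "value_iteration g (n - Suc k)"
    have nk: "n - k = Suc (n - Suc k)" using Suc.prems by simp
    have tm: "(\<lambda>\<omega>. \<integral>\<^sup>+y. ?V y \<partial>transition M (fst (\<omega> k)) (snd (\<omega> k))) \<in> borel_measurable ?P"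
      using measurable_compose[OF measurable_compose[OF measurable_coordinate measurable_prob_algebraD[OF transition_measurable]]
          nn_integral_measurable_subprob_algebra[OF value_iteration_measurable]]
      by (simp add: case_prod_beta)
    have "(\<integral>\<^sup>+\<omega>. value_iteration g (n - k) (fst (\<omega> k)) \<partial>?P)
      \<le> (\<integral>\<^sup>+\<omega>. running g (fst (\<omega> k)) (snd (\<omega> k)) + (\<integral>\<^sup>+y. ?V y \<partial>transition M (fst (\<omega> k)) (snd (\<omega> k))) \<partial>?P)"
      unfolding nk value_iteration.simps
      by (intro nn_integral_mono INF_lower coordinate_in_space)
    also have "\<dots> = ?c k + (\<integral>\<^sup>+\<omega>. ?V (fst (\<omega> (Suc k))) \<partial>?P)"
      by (subst nn_integral_add[OF rm tm]) (simp only: nn_integral_state_Suc[OF value_iteration_measurable])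
    finally have "(\<Sum>i<k. ?c i) + (\<integral>\<^sup>+\<omega>. value_iteration g (n - k) (fst (\<omega> k)) \<partial>?P)
       \<le> (\<Sum>i<k. ?c i) + (?c k + (\<integral>\<^sup>+\<omega>. ?V (fst (\<omega> (Suc k))) \<partial>?P))" by (rule add_left_mono)
    from order_trans[OF Suc.IH this] Suc.prems show ?case by (simp add: add.assoc)
  qed
  from this[of n] have "value_iteration g n x \<le> (\<Sum>i<n. ?c i)" by simp
  also have "\<dots> \<le> (\<Sum>i. ?c i)" by (intro sum_le_suminf) auto
  finally show ?thesis by (simp only: performance_eq_suminf[OF running_measurable])
qed

lemma performance_running:
  "performance M x \<pi> (cost M 0) + (\<Sum>j=1..num_constraints M. ennreal (g j) * performance M x \<pi> (cost M j))
   = performance M x \<pi> (running g)"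
proof -
  let ?P = "strategic_measure M \<pi> x"
  let ?c = "\<lambda>j i. \<integral>\<^sup>+\<omega>. cost M j (fst (\<omega> i)) (snd (\<omega> i)) \<partial>?P"
  have cm[measurable]: "(\<lambda>\<omega>. cost M j (fst (\<omega> i)) (snd (\<omega> i))) \<in> borel_measurable ?P" if "j \<le> num_constraints M" for i j
    using measurable_compose[OF measurable_coordinate cost_measurable[OF that]] by (simp add: case_prod_beta)
  have "(\<integral>\<^sup>+\<omega>. running g (fst (\<omega> i)) (snd (\<omega> i)) \<partial>?P) = ?c 0 i + (\<Sum>j=1..num_constraints M. ennreal (g j) * ?c j i)" for i
  proof -
    have "(\<integral>\<^sup>+\<omega>. (\<Sum>j=1..num_constraints M. ennreal (g j) * cost M j (fst (\<omega> i)) (snd (\<omega> i))) \<partial>?P)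
        = (\<Sum>j=1..num_constraints M. ennreal (g j) * ?c j i)"
      by (subst nn_integral_sum) (auto simp: nn_integral_cmult cm intro!: cm borel_measurable_times)
    then show ?thesis
      unfolding running_def by (subst nn_integral_add) (auto intro!: cm borel_measurable_sum borel_measurable_times)
  qed
  then have "performance M x \<pi> (running g) = (\<Sum>i. ?c 0 i + (\<Sum>j=1..num_constraints M. ennreal (g j) * ?c j i))"
    by (simp add: performance_eq_suminf[OF running_measurable])
  also have "\<dots> = (\<Sum>i. ?c 0 i) + (\<Sum>j=1..num_constraints M. ennreal (g j) * (\<Sum>i. ?c j i))"
    by (subst suminf_add[symmetric]) (auto simp: suminf_sum)
  also have "\<dots> = performance M x \<pi> (cost M 0) + (\<Sum>j=1..num_constraints M. ennreal (g j) * performance M x \<pi> (cost M j))"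
    by (simp add: performance_eq_suminf cost_measurable)
  finally show ?thesis ..
qed

end

definition stationary_strategy :: "('x option \<Rightarrow> ennreal \<times> 'a) \<Rightarrow> ('x, 'a) strategy" where
  "stationary_strategy f n = (\<lambda>(\<omega>, y). return (action_measure M) (f y))"

lemma stationary_in_strategies:
  "f \<in> state_measure M \<rightarrow>\<^sub>M action_measure M \<Longrightarrow> stationary_strategy f \<in> strategies M"
  unfolding strategies_def stationary_strategy_def case_prod_beta
  by (auto intro!: measurable_compose[OF _ measurable_return_prob_space] measurable_compose[OF measurable_snd])

text \<open>Under a deterministic policy each pair is almost surely on the graph of \<open>f\<close>.\<close>

lemma nn_integral_stationary:
  fixes u :: "'x option \<times> ennreal \<times> 'a \<Rightarrow> ennreal"
  assumes f[measurable]: "f \<in> state_measure M \<rightarrow>\<^sub>M action_measure M" and x: "x \<in> S"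
    and u[measurable]: "u \<in> borel_measurable (stage_measure M)"
  shows "(\<integral>\<^sup>+\<omega>. u (\<omega> n) \<partial>strategic_measure M (stationary_strategy f) x) =
    (\<integral>\<^sup>+\<omega>. u (fst (\<omega> n), f (fst (\<omega> n))) \<partial>strategic_measure M (stationary_strategy f) x)"
proof -
  let ?\<pi> = "stationary_strategy f"
  note \<pi> = stationary_in_strategies[OF f]
  let ?u = "\<lambda>z. u (fst z, f (fst z))"
  have u'[measurable]: "?u \<in> borel_measurable (stage_measure M)" by measurable
  have k: "(\<integral>\<^sup>+z. u z \<partial>stage_kernel M ?\<pi> x n \<omega>) = (\<integral>\<^sup>+z. ?u z \<partial>stage_kernel M ?\<pi> x n \<omega>)"
    if \<omega>: "\<omega> \<in> space (Pi\<^sub>M {0..<n} (\<lambda>_. stage_measure M))" for \<omega>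
  proof -
    show ?thesis
      unfolding nn_integral_stage_kernel[OF \<pi> x u \<omega>] nn_integral_stage_kernel[OF \<pi> x u' \<omega>]
    proof (rule nn_integral_cong)
      fix y assume "y \<in> space (next_state_law x n \<omega>)"
      then have y: "y \<in> space (state_measure M)" by (simp add: next_state_law_space(2)[OF \<omega>])
      have fy: "f y \<in> space (action_measure M)" by (rule measurable_space[OF f y])
      have "(\<lambda>b. u (y, b)) \<in> borel_measurable (action_measure M)"
        by (rule measurable_compose[OF measurable_Pair1'[OF y] u])
      then show "(\<integral>\<^sup>+b. u (y, b) \<partial>?\<pi> n (\<omega>, y)) = (\<integral>\<^sup>+b. ?u (y, b) \<partial>?\<pi> n (\<omega>, y))"
        by (simp only: stationary_strategy_def prod.case fst_conv snd_conv nn_integral_return[OF fy] borel_measurable_const)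
    qed
  qed
  show ?thesis
    unfolding nn_integral_coordinate[OF \<pi> x u] nn_integral_coordinate[OF \<pi> x u']
    by (intro nn_integral_cong k restrict_in_space[OF \<pi> x])
qed

text \<open>With equality in the optimality equation the cost of \<open>n\<close> stages plus the expected optimal value
  afterwards stays constant in \<open>n\<close>; dropping the nonnegative remainder bounds the total cost.\<close>

lemma performance_optimal_selector:
  assumes f: "f \<in> state_measure M \<rightarrow>\<^sub>M action_measure M"
    and opt: "\<And>y. y \<in> S \<Longrightarrow> running g y (f y) + (\<integral>\<^sup>+z. optimal_value g z \<partial>transition M y (f y)) = optimal_value g y"
    and x: "x \<in> S"
  shows "performance M x (stationary_strategy f) (running g) \<le> optimal_value g x"
proof -
  let ?\<pi> = "stationary_strategy f"
  note \<pi> = stationary_in_strategies[OF f]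
  let ?P = "strategic_measure M ?\<pi> x"
  let ?c = "\<lambda>i. \<integral>\<^sup>+\<omega>. running g (fst (\<omega> i)) (snd (\<omega> i)) \<partial>?P"
  let ?F = "\<lambda>z. running g (fst z) (snd z) + (\<integral>\<^sup>+y. optimal_value g y \<partial>transition M (fst z) (snd z))"
  have rm: "(\<lambda>\<omega>. running g (fst (\<omega> i)) (snd (\<omega> i))) \<in> borel_measurable ?P" for i
    using measurable_compose[OF measurable_coordinate[OF \<pi> x] running_measurable] by (simp add: case_prod_beta)
  have tm: "(\<lambda>\<omega>. \<integral>\<^sup>+y. optimal_value g y \<partial>transition M (fst (\<omega> k)) (snd (\<omega> k))) \<in> borel_measurable ?P" for k
    using measurable_compose[OF measurable_compose[OF measurable_coordinate[OF \<pi> x] measurable_prob_algebraD[OF transition_measurable]]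
        nn_integral_measurable_subprob_algebra[OF optimal_value_measurable]]
    by (simp add: case_prod_beta)
  have Fm: "?F \<in> borel_measurable (stage_measure M)"
    using lsc_stage_measurable[OF lsc_optimality] by (simp add: case_prod_beta')
  have "(\<Sum>i<n. ?c i) + (\<integral>\<^sup>+\<omega>. optimal_value g (fst (\<omega> n)) \<partial>?P) = optimal_value g x" for n
  proof (induction n)
    case 0
    then show ?case using nn_integral_state_0[OF \<pi> x optimal_value_measurable] by simp
  next
    case (Suc n)
    have "?c n + (\<integral>\<^sup>+\<omega>. optimal_value g (fst (\<omega> (Suc n))) \<partial>?P) = (\<integral>\<^sup>+\<omega>. ?F (\<omega> n) \<partial>?P)"
      unfolding nn_integral_state_Suc[OF \<pi> x optimal_value_measurable] nn_integral_add[OF rm tm] ..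
    also have "\<dots> = (\<integral>\<^sup>+\<omega>. ?F (fst (\<omega> n), f (fst (\<omega> n))) \<partial>?P)"
      by (rule nn_integral_stationary[OF f x Fm])
    also have "\<dots> = (\<integral>\<^sup>+\<omega>. optimal_value g (fst (\<omega> n)) \<partial>?P)"
      using coordinate_in_space(1)[OF \<pi> x] by (intro nn_integral_cong) (simp add: opt)
    finally show ?case using Suc by (simp add: add.assoc)
  qed
  note partial = this
  have "(\<Sum>i<n. ?c i) \<le> optimal_value g x" for n
    unfolding partial[of n, symmetric] by (rule add_increasing2) simp_all
  then have "(\<Sum>i. ?c i) \<le> optimal_value g x"
    by (intro suminf_le_const summableI)
  then show ?thesis by (simp only: performance_eq_suminf[OF \<pi> x running_measurable])
qed

lemma INF_performance:
  assumes x: "x \<in> S"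
  shows "(INF \<pi>\<in>strategies M. performance M x \<pi> (running g)) = optimal_value g x"
proof (rule antisym)
  obtain f where f: "f \<in> state_measure M \<rightarrow>\<^sub>M action_measure M" "\<And>y. y \<in> S \<Longrightarrow> f y \<in> B"
    "\<And>y. y \<in> S \<Longrightarrow> running g y (f y) + (\<integral>\<^sup>+z. optimal_value g z \<partial>transition M y (f y)) = optimal_value g y"
    by (rule optimal_selector) blast
  show "(INF \<pi>\<in>strategies M. performance M x \<pi> (running g)) \<le> optimal_value g x"
    by (intro INF_lower2[OF stationary_in_strategies[OF f(1)]] performance_optimal_selector[OF f(1) _ x] f(3))
  show "optimal_value g x \<le> (INF \<pi>\<in>strategies M. performance M x \<pi> (running g))"
    unfolding optimal_value_def by (intro INF_greatest SUP_least value_iteration_le_performance x)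
qed

lemma bellman_eq: "x \<in> S \<Longrightarrow> bellman M g x = optimal_value g x"
  unfolding bellman_def INF_performance[symmetric] by (intro INF_cong refl performance_running)

lemma total_cost_eq: "total_cost M = running (\<lambda>_. 1)"
proof (intro ext)
  fix y b
  show "total_cost M y b = running (\<lambda>_. 1) y b"
    unfolding total_cost_def running_def
    by (subst sum.atMost_shift) (simp add: sum.atLeast1_atMost_eq)
qed

lemma pos_states_eq: "pos_states M = {x \<in> S. 0 < optimal_value (\<lambda>_. 1) x}"
  by (auto simp: pos_states_def total_cost_eq INF_performance)

end

section \<open>Restriction to the states of positive cost\<close>

context bounded_semicontinuous_model
begin

abbreviation "V \<equiv> pos_states M"
abbreviation "PM \<equiv> pos_measure M \<Otimes>\<^sub>M action_measure M"

lemma V_subset: "V \<subseteq> S" and None_notin_V: "None \<notin> V"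
  by (auto simp: pos_states_eq optimal_value_None)

lemma V_sets: "V \<in> sets (state_measure M)"
proof -
  have "openin (state_top M) V"
    using lsc_optimal_value unfolding pos_states_eq lower_semicontinuous_map_def by blast
  then show ?thesis by (rule openin_in_borel_of)
qed

lemma space_pos_measure[simp]: "space (pos_measure M) = V"
  using V_subset by (auto simp: space_restrict_space)

text \<open>Outside \<open>V\<close> the optimal policy for the total cost pays nothing and almost surely remains
  outside \<open>V\<close>. All individual costs then vanish along it, so it is free for every weight vector
  \<open>g\<close>. Consequently leaving \<open>V\<close> may be treated as killing.\<close>

lemma optimal_value_off_V:
  assumes y: "y \<in> S" "y \<notin> V"
  shows "optimal_value g y = 0"
proof -
  obtain f where f: "f \<in> state_measure M \<rightarrow>\<^sub>M action_measure M" "\<And>y. y \<in> S \<Longrightarrow> f y \<in> B"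
    "\<And>y. y \<in> S \<Longrightarrow> running (\<lambda>_. 1) y (f y) + (\<integral>\<^sup>+z. optimal_value (\<lambda>_. 1) z \<partial>transition M y (f y)) = optimal_value (\<lambda>_. 1) y"
    by (rule optimal_selector) blast
  have "value_iteration g n y = 0" if "y \<in> S" "optimal_value (\<lambda>_. 1) y = 0" for n y
    using that
  proof (induction n arbitrary: y)
    case (Suc n)
    note fy = f(2)[OF Suc.prems(1)]
    have 0: "running (\<lambda>_. 1) y (f y) = 0" "(\<integral>\<^sup>+z. optimal_value (\<lambda>_. 1) z \<partial>transition M y (f y)) = 0"
      using f(3)[OF Suc.prems(1)] Suc.prems(2) by auto
    have "running g y (f y) = 0"
      using 0(1) by (simp add: running_def)
    moreover have "(\<integral>\<^sup>+z. value_iteration g n z \<partial>transition M y (f y)) = 0"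
    proof -
      note T = transition_in_space[OF Suc.prems(1) fy]
      have "AE z in transition M y (f y). optimal_value (\<lambda>_. 1) z = 0"
        using 0(2) optimal_value_measurable
        by (subst (asm) nn_integral_0_iff_AE) (simp_all add: measurable_cong_sets[OF T(2) refl])
      then have "AE z in transition M y (f y). value_iteration g n z = 0"
        using AE_space by eventually_elim (use Suc.IH T(3) in simp)
      then show ?thesis
        using value_iteration_measurable
        by (subst nn_integral_0_iff_AE) (simp_all add: measurable_cong_sets[OF T(2) refl])
    qed
    moreover have "value_iteration g (Suc n) y \<le> running g y (f y) + (\<integral>\<^sup>+z. value_iteration g n z \<partial>transition M y (f y))"
      using fy by (auto intro: INF_lower)
    ultimately show ?case by simp
  qed simp
  then show ?thesis
    using y by (simp add: optimal_value_def[of g] pos_states_eq)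
qed

text \<open>The kernel killed on leaving \<open>V\<close>; it is the transition kernel of the linear program.\<close>

definition killed :: "'x option \<Rightarrow> ennreal \<times> 'a \<Rightarrow> 'x option measure" where
  "killed y b = restrict_space (transition M y b) V"

lemma space_PM: "space PM = V \<times> B"
  by (simp add: space_pair_measure)

lemma measurable_PM:
  assumes "f \<in> stage_measure M \<rightarrow>\<^sub>M N"
  shows "f \<in> PM \<rightarrow>\<^sub>M N"
proof -
  have "(\<lambda>z. (fst z, snd z)) \<in> PM \<rightarrow>\<^sub>M stage_measure M"
    by (intro measurable_Pair measurable_snd measurable_compose[OF measurable_fst] measurable_restrict_space1 measurable_ident_sets refl)
  from measurable_compose[OF this assms] show ?thesis by simp
qed

text \<open>Real-valued costs, linked to the extended ones by \<open>real_cost_eq\<close>. They make the slack of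
  the linear program an ordinary integrable function.\<close>

definition real_cost :: "nat \<Rightarrow> 'x option \<times> ennreal \<times> 'a \<Rightarrow> real" where
  "real_cost j z = enn2real (cost M j (fst z) (snd z))"

lemma real_cost_nonneg[simp]: "0 \<le> real_cost j z"
  by (simp add: real_cost_def)

lemma real_cost_eq:
  assumes "j \<le> num_constraints M" "fst z \<in> S" "snd z \<in> B"
  shows "cost M j (fst z) (snd z) = ennreal (real_cost j z)"
proof -
  obtain K where "\<And>j y b. j \<le> num_constraints M \<Longrightarrow> y \<in> S \<Longrightarrow> b \<in> B \<Longrightarrow> cost M j y b \<le> ennreal K"
    by (rule cost_bounded) blast
  from le_less_trans[OF this[OF assms] ennreal_less_top] show ?thesis
    by (simp add: real_cost_def)
qed

lemma real_cost_measurable[measurable]: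
  assumes "j \<le> num_constraints M"
  shows "real_cost j \<in> borel_measurable PM"
proof -
  have "(\<lambda>z. cost M j (fst z) (snd z)) \<in> borel_measurable PM"
    using measurable_PM[OF cost_measurable[OF assms]] by (simp add: case_prod_beta')
  then show ?thesis
    unfolding real_cost_def[abs_def] by (rule measurable_compose) simp
qed

lemma real_cost_bounded:
  obtains K where "\<And>j z. j \<le> num_constraints M \<Longrightarrow> z \<in> V \<times> B \<Longrightarrow> real_cost j z \<le> K"
proof -
  obtain K where K: "0 \<le> K" "\<And>j y b. j \<le> num_constraints M \<Longrightarrow> y \<in> S \<Longrightarrow> b \<in> B \<Longrightarrow> cost M j y b \<le> ennreal K"
    by (rule cost_bounded) blast
  have "real_cost j z \<le> K" if "j \<le> num_constraints M" "z \<in> V \<times> B" for j z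
    using K(2)[OF that(1), of "fst z" "snd z"] that V_subset real_cost_eq[OF that(1), of z] K(1) by auto
  then show thesis by (rule that)
qed

lemma finite_measuresD:
  assumes "\<mu> \<in> finite_measures M"
  shows "sets \<mu> = sets PM" "space \<mu> = V \<times> B" "finite_measure \<mu>"
  using assms sets_eq_imp_space_eq[of \<mu> PM] by (auto simp: finite_measures_def space_PM)

lemma integrable_bounded_PM:
  fixes h :: "_ \<Rightarrow> real"
  assumes \<mu>: "\<mu> \<in> finite_measures M" and h: "h \<in> borel_measurable PM" and K: "\<And>z. z \<in> V \<times> B \<Longrightarrow> \<bar>h z\<bar> \<le> K"
  shows "integrable \<mu> h"
proof -
  interpret finite_measure \<mu> by (rule finite_measuresD[OF \<mu>])
  show ?thesis
    using h K by (intro integrable_const_bound[where B=K] AE_I2)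
      (auto simp: finite_measuresD[OF \<mu>] measurable_cong_sets[OF finite_measuresD(1)[OF \<mu>] refl])
qed

lemma integrable_real_cost:
  assumes "\<mu> \<in> finite_measures M" "j \<le> num_constraints M"
  shows "integrable \<mu> (real_cost j)"
proof -
  obtain K where "\<And>j z. j \<le> num_constraints M \<Longrightarrow> z \<in> V \<times> B \<Longrightarrow> real_cost j z \<le> K"
    by (rule real_cost_bounded) blast
  from this[OF assms(2)] show ?thesis
    by (intro integrable_bounded_PM[OF assms(1), where K=K] real_cost_measurable assms) auto
qed

lemma cost_integral_eq:
  assumes \<mu>: "\<mu> \<in> finite_measures M" and j: "j \<le> num_constraints M"
  shows "cost_integral M j \<mu> = ennreal (\<integral>z. real_cost j z \<partial>\<mu>)"
proof -
  have "cost_integral M j \<mu> = (\<integral>\<^sup>+z. ennreal (real_cost j z) \<partial>\<mu>)"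
    unfolding cost_integral_def using V_subset finite_measuresD(2)[OF \<mu>] real_cost_eq[OF j]
    by (intro nn_integral_cong) auto
  then show ?thesis
    using integrable_real_cost[OF \<mu> j] by (simp add: nn_integral_eq_integral)
qed

definition expected :: "('x option \<Rightarrow> real) \<Rightarrow> 'x option \<times> ennreal \<times> 'a \<Rightarrow> real" where
  "expected W z = (\<integral>y. W y \<partial>killed (fst z) (snd z))"

definition real_running :: "(nat \<Rightarrow> real) \<Rightarrow> 'x option \<times> ennreal \<times> 'a \<Rightarrow> real" where
  "real_running g z = real_cost 0 z + (\<Sum>j=1..num_constraints M. g j * real_cost j z)"

lemma test_functionsD:
  assumes "W \<in> test_functions M"
  shows "W \<in> borel_measurable (pos_measure M)"
  using assms by (simp add: test_functions_def)

lemma test_functions_bound: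
  assumes "W \<in> test_functions M"
  obtains K where "0 \<le> K" "\<And>y. y \<in> V \<Longrightarrow> \<bar>W y\<bar> \<le> K"
proof -
  have "bounded (W ` V)" using assms by (simp add: test_functions_def)
  then obtain K where "\<forall>y\<in>V. \<bar>W y\<bar> \<le> K" by (auto simp: bounded_iff)
  then show thesis by (intro that[of "max 0 K"]) (auto simp: max_def)
qed

lemma emeasure_killed:
  assumes "y \<in> S" "b \<in> B" "\<Gamma> \<in> sets (pos_measure M)"
  shows "emeasure (killed y b) \<Gamma> = emeasure (transition M y b) \<Gamma>"
proof -
  note T = transition_in_space[OF assms(1,2)]
  have "\<Gamma> \<subseteq> V" using sets.sets_into_space[OF assms(3)] by simp
  then show ?thesis
    unfolding killed_def using V_sets V_subset T by (subst emeasure_restrict_space) (auto simp: Int_absorb2)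
qed

lemma nn_integral_killed_optimal_value:
  assumes "y \<in> S" "b \<in> B"
  shows "(\<integral>\<^sup>+z. optimal_value g z \<partial>killed y b) = (\<integral>\<^sup>+z. optimal_value g z \<partial>transition M y b)"
proof -
  note T = transition_in_space[OF assms]
  have "V \<inter> space (transition M y b) \<in> sets (transition M y b)"
    using V_sets V_subset T by (simp add: Int_absorb2)
  then show ?thesis
    unfolding killed_def using T(3) optimal_value_off_V[of _ g]
    by (subst nn_integral_restrict_space) (auto intro!: nn_integral_cong simp: indicator_def)
qed

lemma lp_feasible_iff:
  assumes W: "W \<in> test_functions M"
  shows "W \<in> lp_feasible M g \<longleftrightarrow> (\<forall>z\<in>V \<times> B. 0 \<le> real_running g z + expected W z - W (fst z))"
proof -
  have "enn2ereal (cost M 0 x b) + (\<Sum>j=1..num_constraints M. ereal (g j) * enn2ereal (cost M j x b))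
        + ereal (LINT y:V|transition M x b. W y) - ereal (W x)
      = ereal (real_running g (x, b) + expected W (x, b) - W x)" if x: "x \<in> V" and b: "b \<in> B" for x b
  proof -
    have xS: "x \<in> S" using x V_subset by auto
    note T = transition_in_space[OF xS b]
    have "V \<inter> space (transition M x b) \<in> sets (transition M x b)"
      using V_sets V_subset T by (simp add: Int_absorb2)
    then have "(LINT y:V|transition M x b. W y) = expected W (x, b)"
      by (simp add: expected_def killed_def integral_restrict_space set_lebesgue_integral_def)
    moreover have "enn2ereal (cost M j x b) = ereal (real_cost j (x, b))" if "j \<le> num_constraints M" for j
      using real_cost_eq[OF that, of "(x, b)"] xS b by simp
    ultimately show ?thesis by (simp add: real_running_def)
  qed
  then show ?thesis
    using W by (auto simp: lp_feasible_def)
qed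

context
  fixes x0
  assumes x0: "x0 \<in> V"
begin

lemma killed_measurable: "(\<lambda>(y, b). killed y b) \<in> stage_measure M \<rightarrow>\<^sub>M subprob_algebra (pos_measure M)"
proof -
  have "V \<noteq> {}" using x0 by auto
  from restrict_space_measurable[OF this V_sets measurable_prob_algebraD[OF transition_measurable]]
  show ?thesis by (simp add: killed_def case_prod_beta')
qed

lemma killed_in_space:
  assumes "y \<in> S" "b \<in> B"
  shows "sets (killed y b) = sets (pos_measure M)" "space (killed y b) = V" "subprob_space (killed y b)"
proof -
  have "(y, b) \<in> space (stage_measure M)" using assms by (auto simp: space_pair_measure)
  from measurable_space[OF killed_measurable this]
  show *: "sets (killed y b) = sets (pos_measure M)" "subprob_space (killed y b)"
    by (auto simp: space_subprob_algebra)
  from sets_eq_imp_space_eq[OF *(1)] show "space (killed y b) = V" by simp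
qed

lemma expected_measurable:
  assumes W: "W \<in> test_functions M"
  shows "expected W \<in> borel_measurable PM"
proof -
  have "(\<lambda>z. integral\<^sup>L (case z of (y, b) \<Rightarrow> killed y b) W) \<in> borel_measurable PM"
    by (rule measurable_compose[OF measurable_PM[OF killed_measurable] integral_measurable_subprob_algebra])
       (rule test_functionsD[OF W])
  then show ?thesis by (simp add: expected_def[abs_def] case_prod_beta')
qed

lemma expected_bounded:
  assumes W: "W \<in> test_functions M" and K: "0 \<le> K" "\<And>y. y \<in> V \<Longrightarrow> \<bar>W y\<bar> \<le> K" and z: "z \<in> V \<times> B"
  shows "\<bar>expected W z\<bar> \<le> K"
proof -
  have yb: "fst z \<in> S" "snd z \<in> B" using z V_subset by auto
  note k = killed_in_space[OF yb]
  interpret subprob_space "killed (fst z) (snd z)" by (rule k)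
  have m: "W \<in> borel_measurable (killed (fst z) (snd z))"
    using test_functionsD[OF W] by (simp add: measurable_cong_sets[OF k(1) refl])
  have "integrable (killed (fst z) (snd z)) W"
    using m K k(2) by (intro integrable_const_bound[where B=K] AE_I2) auto
  then have "\<bar>expected W z\<bar> \<le> (\<integral>y. K \<partial>killed (fst z) (snd z))"
    unfolding expected_def using K k(2)
    by (intro order_trans[OF integral_abs_bound integral_mono]) auto
  also have "\<dots> \<le> K"
    using K(1) subprob_emeasure_le_1 by (simp add: mult_left_le_one_le subprob_measure_le_1)
  finally show ?thesis .
qed

section \<open>The Lagrangian as an integral of the slack\<close>

text \<open>The costs are bounded and \<open>\<mu>\<close> is finite, so the extended-real sum is a sum of real integrals, and
  integrating \<open>W\<close> against the kernel first collects them in one integral over \<open>\<mu>\<close>. The integrability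
  statements are recorded for the cancellation on \<open>\<D>\<close>.\<close>

lemma lagrangian2_eq:
  assumes \<mu>: "\<mu> \<in> finite_measures M" and W: "W \<in> test_functions M"
  shows "lagrangian2 M x0 \<mu> W g = ereal (W x0 - (\<Sum>j=1..num_constraints M. g j * constraint_bound M j)
     + (\<integral>z. real_running g z + expected W z - W (fst z) \<partial>\<mu>))"
    "(\<integral>x. W x \<partial>next_state_measure M \<mu>) = (\<integral>z. expected W z \<partial>\<mu>)"
    "integrable (next_state_measure M \<mu>) W"
    "integrable \<mu> (expected W)" "integrable \<mu> (\<lambda>z. W (fst z))"
proof -
  note m = finite_measuresD[OF \<mu>]
  interpret finite_measure \<mu> by (rule m)
  obtain K where K: "0 \<le> K" "\<And>y. y \<in> V \<Longrightarrow> \<bar>W y\<bar> \<le> K" by (rule test_functions_bound[OF W]) blast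
  have km: "(\<lambda>(y, b). killed y b) \<in> \<mu> \<rightarrow>\<^sub>M subprob_algebra (pos_measure M)"
    using measurable_PM[OF killed_measurable] by (simp add: measurable_cong_sets[OF m(1) refl])
  have ns: "next_state_measure M \<mu> = \<mu> \<bind> (\<lambda>(y, b). killed y b)"
    by (simp add: next_state_measure_def killed_def)
  have le1: "AE z in \<mu>. emeasure ((\<lambda>(y, b). killed y b) z) (space ((\<lambda>(y, b). killed y b) z)) \<le> ennreal 1"
  proof (rule AE_I2)
    fix z assume "z \<in> space \<mu>"
    then have "subprob_space ((\<lambda>(y, b). killed y b) z)"
      using measurable_space[OF km, of z] by (simp add: space_subprob_algebra)
    from subprob_space.emeasure_space_le_1[OF this]
    show "emeasure ((\<lambda>(y, b). killed y b) z) (space ((\<lambda>(y, b). killed y b) z)) \<le> ennreal 1" by simp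
  qed
  have Kspace: "\<And>y. y \<in> space (pos_measure M) \<Longrightarrow> \<bar>W y\<bar> \<le> K" using K by simp
  show nxt: "(\<integral>x. W x \<partial>next_state_measure M \<mu>) = (\<integral>z. expected W z \<partial>\<mu>)"
    using integral_bind[OF test_functionsD[OF W] Kspace km m(3) le1] unfolding ns
    by (simp add: expected_def case_prod_beta')
  show "integrable (next_state_measure M \<mu>) W"
    unfolding ns by (rule integrable_bind[OF test_functionsD[OF W] Kspace km m(3) le1])
  have fm: "fst \<in> \<mu> \<rightarrow>\<^sub>M pos_measure M" by (simp add: measurable_cong_sets[OF m(1) refl])
  show iE: "integrable \<mu> (expected W)"
    by (rule integrable_bounded_PM[OF \<mu> expected_measurable[OF W] expected_bounded[OF W K]])
  show iW: "integrable \<mu> (\<lambda>z. W (fst z))"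
    by (rule integrable_bounded_PM[OF \<mu> measurable_compose[OF measurable_fst test_functionsD[OF W]], where K=K])
       (use K in auto)
  have marg: "(\<integral>x. W x \<partial>distr \<mu> (pos_measure M) fst) = (\<integral>z. W (fst z) \<partial>\<mu>)"
    by (rule integral_distr[OF fm test_functionsD[OF W]])
  have ret: "(\<integral>x. W x \<partial>return (pos_measure M) x0) = W x0"
    using x0 test_functionsD[OF W] by (intro integral_return) auto
  have ic: "integrable \<mu> (real_cost j)" if "j \<le> num_constraints M" for j by (rule integrable_real_cost[OF \<mu> that])
  have ir: "integrable \<mu> (real_running g)"
    unfolding real_running_def[abs_def] using ic by (intro Bochner_Integration.integrable_add Bochner_Integration.integrable_sum integrable_mult_right) auto
  have run: "(\<integral>z. real_running g z \<partial>\<mu>) = (\<integral>z. real_cost 0 z \<partial>\<mu>) + (\<Sum>j=1..num_constraints M. g j * (\<integral>z. real_cost j z \<partial>\<mu>))"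
    unfolding real_running_def using ic
    by (subst Bochner_Integration.integral_add) (auto intro!: Bochner_Integration.integrable_sum simp: Bochner_Integration.integral_sum)
  have "lagrangian2 M x0 \<mu> W g = ereal (\<integral>z. real_cost 0 z \<partial>\<mu>)
     + ereal (W x0 + (\<integral>z. expected W z \<partial>\<mu>) - (\<integral>z. W (fst z) \<partial>\<mu>))
     + (\<Sum>j=1..num_constraints M. ereal (g j * ((\<integral>z. real_cost j z \<partial>\<mu>) - constraint_bound M j)))"
    unfolding lagrangian2_def nxt marg ret
    by (intro arg_cong2[where f="(+)"] sum.cong refl) (simp_all add: cost_integral_eq[OF \<mu>] integral_nonneg_AE)
  also have "\<dots> = ereal (W x0 - (\<Sum>j=1..num_constraints M. g j * constraint_bound M j)
     + ((\<integral>z. real_running g z \<partial>\<mu>) + (\<integral>z. expected W z \<partial>\<mu>) - (\<integral>z. W (fst z) \<partial>\<mu>)))"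
    unfolding run by (simp add: sum_subtractf algebra_simps)
  also have "(\<integral>z. real_running g z \<partial>\<mu>) + (\<integral>z. expected W z \<partial>\<mu>) - (\<integral>z. W (fst z) \<partial>\<mu>)
     = (\<integral>z. real_running g z + expected W z - W (fst z) \<partial>\<mu>)"
    using ir iE iW by simp
  finally show "lagrangian2 M x0 \<mu> W g = ereal (W x0 - (\<Sum>j=1..num_constraints M. g j * constraint_bound M j)
     + (\<integral>z. real_running g z + expected W z - W (fst z) \<partial>\<mu>))" .
qed

text \<open>For feasible \<open>W\<close> the slack is nonnegative, and the integral in \<open>lagrangian2_eq\<close> with it.\<close>

lemma lagrangian2_ge:
  assumes W: "W \<in> lp_feasible M g" and \<mu>: "\<mu> \<in> finite_measures M"
  shows "ereal (W x0 - (\<Sum>j=1..num_constraints M. g j * constraint_bound M j)) \<le> lagrangian2 M x0 \<mu> W g"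
proof -
  have Wt: "W \<in> test_functions M" using W by (simp add: lp_feasible_def)
  have "0 \<le> (\<integral>z. real_running g z + expected W z - W (fst z) \<partial>\<mu>)"
    using W lp_feasible_iff[OF Wt, of g] finite_measuresD(2)[OF \<mu>] by (intro integral_nonneg_AE AE_I2) auto
  then show ?thesis by (simp add: lagrangian2_eq(1)[OF \<mu> Wt])
qed

end

end

section \<open>Occupation measures\<close>

context bounded_semicontinuous_model
begin

lemma transition_emeasure_measurable:
  assumes "\<Gamma> \<in> sets (pos_measure M)"
  shows "(\<lambda>z. emeasure (transition M (fst z) (snd z)) \<Gamma>) \<in> borel_measurable PM"
proof -
  have "\<Gamma> \<in> sets (state_measure M)" using assms V_sets V_subset by (simp add: sets_restrict_space_iff Int_absorb2)
  from measurable_PM[OF measurable_compose[OF measurable_prob_algebraD[OF transition_measurable] measurable_emeasure_subprob_algebra[OF this]]]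
  show ?thesis by (simp add: case_prod_beta')
qed

lemma V_in_pos: "V \<in> sets (pos_measure M)"
  using sets.top[of "pos_measure M"] by simp

lemma lagrangian1_eq:
  assumes \<mu>: "\<mu> \<in> finite_measures M"
  shows "lagrangian1 M \<mu> g = ereal ((\<integral>z. real_cost 0 z \<partial>\<mu>)
     + (\<Sum>j=1..num_constraints M. g j * ((\<integral>z. real_cost j z \<partial>\<mu>) - constraint_bound M j)))"
proof -
  have "lagrangian1 M \<mu> g = ereal (\<integral>z. real_cost 0 z \<partial>\<mu>)
     + (\<Sum>j=1..num_constraints M. ereal (g j * ((\<integral>z. real_cost j z \<partial>\<mu>) - constraint_bound M j)))"
    unfolding lagrangian1_def
    by (intro arg_cong2[where f="(+)"] sum.cong refl) (simp_all add: cost_integral_eq[OF \<mu>] integral_nonneg_AE)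
  then show ?thesis by simp
qed

context
  fixes g :: "nat \<Rightarrow> real"
  assumes g: "\<forall>j\<in>{1..num_constraints M}. 0 \<le> g j"
begin

lemma real_running_nonneg: "0 \<le> real_running g z"
  unfolding real_running_def using g by (intro add_nonneg_nonneg sum_nonneg mult_nonneg_nonneg) auto

lemma running_eq_real:
  assumes "y \<in> S" "b \<in> B"
  shows "running g y b = ennreal (real_running g (y, b))"
proof -
  have "running g y b = ennreal (real_cost 0 (y, b)) + (\<Sum>j=1..num_constraints M. ennreal (g j * real_cost j (y, b)))"
    unfolding running_def using assms g real_cost_eq[of _ "(y, b)"]
    by (intro arg_cong2[where f="(+)"] sum.cong refl) (auto simp: ennreal_mult)
  also have "\<dots> = ennreal (real_running g (y, b))"
  proof -
    have "(\<Sum>j=1..num_constraints M. ennreal (g j * real_cost j (y, b))) = ennreal (\<Sum>j=1..num_constraints M. g j * real_cost j (y, b))"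
      by (intro sum_ennreal mult_nonneg_nonneg real_cost_nonneg g[rule_format])
    moreover have "0 \<le> (\<Sum>j=1..num_constraints M. g j * real_cost j (y, b))"
      by (intro sum_nonneg mult_nonneg_nonneg real_cost_nonneg g[rule_format])
    ultimately show ?thesis by (simp add: real_running_def ennreal_plus)
  qed
  finally show ?thesis .
qed

end

context
  fixes x0
  assumes x0: "x0 \<in> V"
begin

text \<open>Apply the balance equation to \<open>V\<close> itself: the mass is \<open>1\<close> plus the expected number of surviving
  steps, and the latter is at most the total cost divided by \<open>\<delta>\<close>.\<close>

lemma occupation_finite:
  assumes \<mu>: "\<mu> \<in> occupation_measures M x0"
  shows "\<mu> \<in> finite_measures M"
proof -
  have s: "sets \<mu> = sets PM"
    and bal: "emeasure \<mu> (V \<times> B) = indicator V x0 + (\<integral>\<^sup>+(y, b). emeasure (transition M y b) V \<partial>\<mu>)"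
    and c: "(\<integral>\<^sup>+(y, b). total_cost M y b \<partial>\<mu>) < \<infinity>"
    using \<mu> V_in_pos by (auto simp: occupation_measures_def)
  have sp: "space \<mu> = V \<times> B" using sets_eq_imp_space_eq[OF s] by (simp add: space_PM)
  obtain \<delta> where \<delta>: "0 < \<delta>" "\<And>y b. y \<in> S \<Longrightarrow> b \<in> B \<Longrightarrow> ennreal \<delta> * emeasure (transition M y b) V \<le> cost M 0 y b"
    using survival_le_cost V_sets None_notin_V by metis
  have m: "(\<lambda>z. emeasure (transition M (fst z) (snd z)) V) \<in> borel_measurable \<mu>"
    using transition_emeasure_measurable[OF V_in_pos] by (simp add: measurable_cong_sets[OF s refl])
  let ?I = "\<integral>\<^sup>+z. emeasure (transition M (fst z) (snd z)) V \<partial>\<mu>"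
  have "ennreal \<delta> * ?I = (\<integral>\<^sup>+z. ennreal \<delta> * emeasure (transition M (fst z) (snd z)) V \<partial>\<mu>)"
    by (rule nn_integral_cmult[OF m, symmetric])
  also have "\<dots> \<le> (\<integral>\<^sup>+(y, b). total_cost M y b \<partial>\<mu>)"
  proof (rule nn_integral_mono)
    fix z assume "z \<in> space \<mu>"
    then have z: "fst z \<in> S" "snd z \<in> B" using V_subset sp by auto
    have "cost M 0 (fst z) (snd z) \<le> total_cost M (fst z) (snd z)"
      unfolding total_cost_def by (rule member_le_sum) auto
    then show "ennreal \<delta> * emeasure (transition M (fst z) (snd z)) V \<le> (case z of (y, b) \<Rightarrow> total_cost M y b)"
      using \<delta>(2)[OF z] by (simp add: case_prod_beta)
  qed
  also note c
  finally have "?I < top" using \<delta>(1) by (auto simp: ennreal_mult_less_top)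
  then have "emeasure \<mu> (space \<mu>) < top"
    unfolding sp bal by (simp add: case_prod_beta' indicator_def)
  then show ?thesis using s by (auto simp: finite_measures_def less_top[symmetric] intro: finite_measureI)
qed

text \<open>Since the costs are bounded, finiteness of the measure also yields finiteness of its cost.\<close>

lemma occupation_iff:
  "\<mu> \<in> occupation_measures M x0 \<longleftrightarrow> \<mu> \<in> finite_measures M \<and>
     (\<forall>\<Gamma>\<in>sets (pos_measure M). emeasure \<mu> (\<Gamma> \<times> B)
            = indicator \<Gamma> x0 + (\<integral>\<^sup>+(y, b). emeasure (transition M y b) \<Gamma> \<partial>\<mu>))"
proof
  assume "\<mu> \<in> occupation_measures M x0"
  with occupation_finite[OF this] show "\<mu> \<in> finite_measures M \<and>
     (\<forall>\<Gamma>\<in>sets (pos_measure M). emeasure \<mu> (\<Gamma> \<times> B)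
            = indicator \<Gamma> x0 + (\<integral>\<^sup>+(y, b). emeasure (transition M y b) \<Gamma> \<partial>\<mu>))"
    by (auto simp: occupation_measures_def)
next
  assume R: "\<mu> \<in> finite_measures M \<and>
     (\<forall>\<Gamma>\<in>sets (pos_measure M). emeasure \<mu> (\<Gamma> \<times> B)
            = indicator \<Gamma> x0 + (\<integral>\<^sup>+(y, b). emeasure (transition M y b) \<Gamma> \<partial>\<mu>))"
  then have \<mu>: "\<mu> \<in> finite_measures M" by simp
  note m = finite_measuresD[OF \<mu>]
  interpret finite_measure \<mu> by (rule m)
  have "finite_measure (distr \<mu> (pos_measure M) fst)"
    by (rule finite_measure_distr) (simp add: measurable_cong_sets[OF m(1) refl])
  then have sf: "sigma_finite_measure (distr \<mu> (pos_measure M) fst)"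
    by (rule finite_measure.axioms(1))
  obtain K where K: "0 \<le> K" "\<forall>y\<in>S. \<forall>b\<in>B. running (\<lambda>_. 1) y b \<le> ennreal K"
    by (rule running_bounded) blast
  have "(\<integral>\<^sup>+(y, b). total_cost M y b \<partial>\<mu>) \<le> (\<integral>\<^sup>+z. ennreal K \<partial>\<mu>)"
    unfolding total_cost_eq using K(2) V_subset m(2) by (intro nn_integral_mono) auto
  also have "\<dots> < \<infinity>"
  proof -
    have "emeasure \<mu> (space \<mu>) < top" by (metis emeasure_finite infinity_ennreal_def less_top)
    then show ?thesis by (simp add: ennreal_mult_less_top)
  qed
  finally show "\<mu> \<in> occupation_measures M x0"
    using R sf m(1) by (auto simp: occupation_measures_def)
qed

text \<open>The balance equation as an identity between measures, in the form that cancels the bracket in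
  \<open>L\<^sub>2\<close>.\<close>

lemma marginal_balance:
  assumes \<mu>: "\<mu> \<in> occupation_measures M x0"
  shows "distr \<mu> (pos_measure M) fst = add_measure (return (pos_measure M) x0) (next_state_measure M \<mu>)"
    "sets (next_state_measure M \<mu>) = sets (return (pos_measure M) x0)"
proof -
  have fin: "\<mu> \<in> finite_measures M" by (rule occupation_finite[OF \<mu>])
  note m = finite_measuresD[OF fin]
  have sp: "space \<mu> \<noteq> {}" using x0 m(2) actions_nonempty by auto
  have ns: "next_state_measure M \<mu> = \<mu> \<bind> (\<lambda>(y, b). killed y b)"
    by (simp add: next_state_measure_def killed_def)
  have km: "(\<lambda>(y, b). killed y b) \<in> \<mu> \<rightarrow>\<^sub>M subprob_algebra (pos_measure M)"
    using measurable_PM[OF killed_measurable[OF x0]] by (simp add: measurable_cong_sets[OF m(1) refl])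
  show s: "sets (next_state_measure M \<mu>) = sets (return (pos_measure M) x0)"
    unfolding ns by (simp add: sets_bind_measurable[OF km sp])
  show "distr \<mu> (pos_measure M) fst = add_measure (return (pos_measure M) x0) (next_state_measure M \<mu>)"
  proof (rule measure_eqI)
    fix \<Gamma> assume "\<Gamma> \<in> sets (distr \<mu> (pos_measure M) fst)"
    then have G: "\<Gamma> \<in> sets (pos_measure M)" by simp
    have GV: "\<Gamma> \<subseteq> V" using sets.sets_into_space[OF G] by simp
    have "emeasure (distr \<mu> (pos_measure M) fst) \<Gamma> = emeasure \<mu> (fst -` \<Gamma> \<inter> space \<mu>)"
      using G by (intro emeasure_distr) (simp_all add: measurable_cong_sets[OF m(1) refl])
    also have "fst -` \<Gamma> \<inter> space \<mu> = \<Gamma> \<times> B" using GV m(2) by auto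
    also have "emeasure \<mu> (\<Gamma> \<times> B) = indicator \<Gamma> x0 + (\<integral>\<^sup>+(y, b). emeasure (transition M y b) \<Gamma> \<partial>\<mu>)"
      using \<mu> G by (simp add: occupation_iff)
    also have "(\<integral>\<^sup>+(y, b). emeasure (transition M y b) \<Gamma> \<partial>\<mu>) = emeasure (next_state_measure M \<mu>) \<Gamma>"
      unfolding ns emeasure_bind[OF sp km G] using m(2) V_subset
      by (intro nn_integral_cong) (auto simp: emeasure_killed[OF _ _ G])
    finally show "emeasure (distr \<mu> (pos_measure M) fst) \<Gamma>
        = emeasure (add_measure (return (pos_measure M) x0) (next_state_measure M \<mu>)) \<Gamma>"
      using G s by (simp add: emeasure_add_measure)
  qed simp
qed

lemma lagrangian2_occupation:
  assumes \<mu>: "\<mu> \<in> occupation_measures M x0" and W: "W \<in> test_functions M"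
  shows "lagrangian2 M x0 \<mu> W g = lagrangian1 M \<mu> g"
proof -
  note fin = occupation_finite[OF \<mu>]
  have ir: "integrable (return (pos_measure M) x0) W"
  proof -
    obtain K where K: "0 \<le> K" "\<And>y. y \<in> V \<Longrightarrow> \<bar>W y\<bar> \<le> K" by (rule test_functions_bound[OF W]) blast
    interpret prob_space "return (pos_measure M) x0" using x0 by (intro prob_space_return) simp
    show ?thesis
      using K test_functionsD[OF W] by (intro integrable_const_bound[where B=K] AE_I2) auto
  qed
  have "(\<integral>x. W x \<partial>distr \<mu> (pos_measure M) fst)
      = (\<integral>x. W x \<partial>return (pos_measure M) x0) + (\<integral>x. W x \<partial>next_state_measure M \<mu>)"
    unfolding marginal_balance(1)[OF \<mu>]
    by (rule integral_add_measure[OF marginal_balance(2)[OF \<mu>] ir lagrangian2_eq(3)[OF x0 fin W]])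
  then show ?thesis
    by (simp add: lagrangian2_def lagrangian1_def zero_ereal_def[symmetric])
qed

context
  fixes g :: "nat \<Rightarrow> real"
  assumes g: "\<forall>j\<in>{1..num_constraints M}. 0 \<le> g j"
begin

text \<open>The optimality equation gives the inequality for the unrestricted kernel; since the value vanishes
  off \<open>V\<close>, the killed kernel gives the same integral.\<close>

lemma optimal_value_feasible: "(\<lambda>y. enn2real (optimal_value g y)) \<in> lp_feasible M g"
proof -
  let ?W = "\<lambda>y. enn2real (optimal_value g y)"
  obtain K where K: "0 \<le> K" "\<And>y. y \<in> S \<Longrightarrow> optimal_value g y \<le> ennreal K"
    by (rule optimal_value_bounded) blast
  have fin: "ennreal (?W y) = optimal_value g y" if "y \<in> S" for y
    using le_less_trans[OF K(2)[OF that] ennreal_less_top] by simp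
  have WK: "?W y \<le> K" if "y \<in> S" for y
    using K(2)[OF that] K(1) by (rule enn2real_leI[rotated])
  have meas: "?W \<in> borel_measurable (pos_measure M)"
    using optimal_value_measurable[of g] by (intro measurable_compose[OF measurable_restrict_space1]) auto
  have W: "?W \<in> test_functions M"
    unfolding test_functions_def using meas WK V_subset by (auto intro!: boundedI[of _ K])
  have "0 \<le> real_running g z + expected ?W z - ?W (fst z)" if z: "z \<in> V \<times> B" for z
  proof -
    have yb: "fst z \<in> S" "snd z \<in> B" using z V_subset by auto
    note k = killed_in_space[OF x0 yb]
    interpret subprob_space "killed (fst z) (snd z)" by (rule k)
    have m: "?W \<in> borel_measurable (killed (fst z) (snd z))"
      using meas by (simp add: measurable_cong_sets[OF k(1) refl])
    have int: "integrable (killed (fst z) (snd z)) ?W"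
      using m WK k(2) V_subset by (intro integrable_const_bound[where B=K] AE_I2) auto
    have "(\<integral>\<^sup>+y. optimal_value g y \<partial>killed (fst z) (snd z)) = (\<integral>\<^sup>+y. ennreal (?W y) \<partial>killed (fst z) (snd z))"
      using fin k(2) V_subset by (intro nn_integral_cong) (auto simp: subset_iff)
    also have "\<dots> = ennreal (expected ?W z)"
      unfolding expected_def using int by (intro nn_integral_eq_integral) auto
    finally have E: "(\<integral>\<^sup>+y. optimal_value g y \<partial>transition M (fst z) (snd z)) = ennreal (expected ?W z)"
      by (simp add: nn_integral_killed_optimal_value[OF yb])
    have E0: "0 \<le> expected ?W z" unfolding expected_def by (rule integral_nonneg_AE) simp
    have "optimal_value g (fst z) \<le> running g (fst z) (snd z) + (\<integral>\<^sup>+y. optimal_value g y \<partial>transition M (fst z) (snd z))"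
      unfolding optimality_equation[OF yb(1), of g] using yb(2) by (rule INF_lower)
    then have "ennreal (?W (fst z)) \<le> ennreal (real_running g z + expected ?W z)"
      unfolding fin[OF yb(1)] E running_eq_real[OF g yb] prod.collapse ennreal_plus[OF real_running_nonneg[OF g] E0] .
    then have "?W (fst z) \<le> real_running g z + expected ?W z"
      using E0 real_running_nonneg[OF g, of z] by (subst (asm) ennreal_le_iff) auto
    then show ?thesis by simp
  qed
  then show ?thesis unfolding lp_feasible_iff[OF W] by blast
qed

text \<open>Start in \<open>x\<^sub>0\<close>, follow the optimal policy, kill the chain when it leaves \<open>V\<close>, and add up the laws \<open>N n\<close> of the
  state at all times. As for stationary policies, cost so far plus expected remaining value is
  constant, so the sum costs at most the optimal value; finiteness follows from the cost as in
  \<open>occupation_finite\<close>, and shifting the time index gives the balance equation.\<close>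

lemma optimal_occupation_measure:
  obtains \<mu> where "\<mu> \<in> occupation_measures M x0"
    "lagrangian1 M \<mu> g \<le> ereal (enn2real (optimal_value g x0) - (\<Sum>j=1..num_constraints M. g j * constraint_bound M j))"
proof -
  obtain f where f: "f \<in> state_measure M \<rightarrow>\<^sub>M action_measure M" "\<And>y. y \<in> S \<Longrightarrow> f y \<in> B"
    "\<And>y. y \<in> S \<Longrightarrow> running g y (f y) + (\<integral>\<^sup>+z. optimal_value g z \<partial>transition M y (f y)) = optimal_value g y"
    by (rule optimal_selector) blast
  have VS: "y \<in> S" if "y \<in> V" for y using that V_subset by auto
  have fV: "f \<in> pos_measure M \<rightarrow>\<^sub>M action_measure M" using f(1) by (rule measurable_restrict_space1)
  have pair: "(\<lambda>y. (y, f y)) \<in> pos_measure M \<rightarrow>\<^sub>M PM" using fV by simp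
  define q where "q y = killed y (f y)" for y
  have q[measurable]: "q \<in> pos_measure M \<rightarrow>\<^sub>M subprob_algebra (pos_measure M)"
    using measurable_compose[OF pair measurable_PM[OF killed_measurable[OF x0]]] by (simp add: q_def[abs_def])
  define N where "N = rec_nat (return (pos_measure M) x0) (\<lambda>_ \<nu>. \<nu> \<bind> q)"
  have N0: "N 0 = return (pos_measure M) x0" and NS: "N (Suc n) = N n \<bind> q" for n
    by (simp_all add: N_def)
  have N: "N n \<in> space (subprob_algebra (pos_measure M))" for n
  proof (induction n)
    case 0
    then show ?case using x0 unfolding N0
      by (auto simp: space_subprob_algebra intro!: prob_space_imp_subprob_space prob_space_return)
  next
    case (Suc n)
    then have n: "subprob_space (N n)" "sets (N n) = sets (pos_measure M)" by (auto simp: space_subprob_algebra)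
    show ?case unfolding NS
      by (rule subprob_space.bind_in_space[OF n(1)]) (simp add: measurable_cong_sets[OF n(2) refl] q)
  qed
  have Ns: "sets (N n) = sets (pos_measure M)" for n using N[of n] by (simp add: space_subprob_algebra)
  have Nsp: "space (N n) = V" for n using sets_eq_imp_space_eq[OF Ns[of n]] by simp
  have qN: "q \<in> N n \<rightarrow>\<^sub>M subprob_algebra (pos_measure M)" for n using q by (simp add: measurable_cong_sets[OF Ns refl])
  \<comment> \<open>Binding over the counting measure on the natural numbers sums the laws.\<close>
  define \<nu> where "\<nu> = count_space UNIV \<bind> N"
  have Nm: "N \<in> count_space UNIV \<rightarrow>\<^sub>M subprob_algebra (pos_measure M)" using N by auto
  have \<nu>s: "sets \<nu> = sets (pos_measure M)" unfolding \<nu>_def by (rule sets_bind_measurable[OF Nm]) simp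
  have \<nu>int: "(\<integral>\<^sup>+y. u y \<partial>\<nu>) = (\<Sum>n. \<integral>\<^sup>+y. u y \<partial>N n)" if "u \<in> borel_measurable (pos_measure M)" for u
    unfolding \<nu>_def nn_integral_bind[OF that Nm] by (rule nn_integral_count_space_nat)
  define \<mu> where "\<mu> = distr \<nu> PM (\<lambda>y. (y, f y))"
  have pair\<nu>: "(\<lambda>y. (y, f y)) \<in> \<nu> \<rightarrow>\<^sub>M PM" using pair by (simp add: measurable_cong_sets[OF \<nu>s refl])
  have \<mu>s: "sets \<mu> = sets PM" by (simp add: \<mu>_def)
  have \<mu>int: "(\<integral>\<^sup>+z. h z \<partial>\<mu>) = (\<Sum>n. \<integral>\<^sup>+y. h (y, f y) \<partial>N n)" if h: "h \<in> borel_measurable PM" for h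
    unfolding \<mu>_def using h \<nu>int[OF measurable_compose[OF pair h]] by (subst nn_integral_distr[OF pair\<nu>]) simp_all

  have rm: "(\<lambda>z. running g (fst z) (snd z)) \<in> borel_measurable PM"
    using measurable_PM[OF running_measurable] by (simp add: case_prod_beta')
  have rfm: "(\<lambda>y. running g y (f y)) \<in> borel_measurable (pos_measure M)"
    using measurable_compose[OF pair rm] by simp
  have ovm: "optimal_value g \<in> borel_measurable (pos_measure M)"
    by (rule measurable_restrict_space1[OF optimal_value_measurable])
  have stepm: "(\<lambda>y. \<integral>\<^sup>+z. optimal_value g z \<partial>q y) \<in> borel_measurable (pos_measure M)"
    by (rule measurable_compose[OF q nn_integral_measurable_subprob_algebra[OF ovm]])
  have partial: "(\<Sum>i<n. \<integral>\<^sup>+y. running g y (f y) \<partial>N i) + (\<integral>\<^sup>+y. optimal_value g y \<partial>N n) = optimal_value g x0" for n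
  proof (induction n)
    case 0
    then show ?case using x0 ovm by (simp add: N0 nn_integral_return)
  next
    case (Suc n)
    have "(\<integral>\<^sup>+y. running g y (f y) \<partial>N n) + (\<integral>\<^sup>+y. optimal_value g y \<partial>N (Suc n))
        = (\<integral>\<^sup>+y. running g y (f y) + (\<integral>\<^sup>+z. optimal_value g z \<partial>q y) \<partial>N n)"
      unfolding NS nn_integral_bind[OF ovm qN]
      using rfm stepm by (intro nn_integral_add[symmetric]) (simp_all add: measurable_cong_sets[OF Ns refl])
    also have "\<dots> = (\<integral>\<^sup>+y. optimal_value g y \<partial>N n)"
      using f(2,3) VS Nsp by (intro nn_integral_cong) (simp add: q_def nn_integral_killed_optimal_value)
    finally show ?case using Suc by (simp add: add.assoc)
  qed
  have "(\<Sum>i<n. \<integral>\<^sup>+y. running g y (f y) \<partial>N i) \<le> optimal_value g x0" for n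
    unfolding partial[of n, symmetric] by (rule add_increasing2) simp_all
  then have "(\<Sum>n. \<integral>\<^sup>+y. running g y (f y) \<partial>N n) \<le> optimal_value g x0"
    by (intro suminf_le_const summableI)
  then have run: "(\<integral>\<^sup>+z. running g (fst z) (snd z) \<partial>\<mu>) \<le> optimal_value g x0"
    unfolding \<mu>int[OF rm] by simp

  have q_em: "emeasure (N (Suc n)) \<Gamma> = (\<integral>\<^sup>+y. emeasure (transition M y (f y)) \<Gamma> \<partial>N n)" if G: "\<Gamma> \<in> sets (pos_measure M)" for n \<Gamma>
    unfolding NS using x0 Nsp f(2) VS
    by (subst emeasure_bind[OF _ qN G]) (auto intro!: nn_integral_cong simp: q_def emeasure_killed[OF _ _ G])
  have \<nu>em: "emeasure \<nu> \<Gamma> = (\<Sum>n. emeasure (N n) \<Gamma>)" if G: "\<Gamma> \<in> sets (pos_measure M)" for \<Gamma>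
    using \<nu>int[of "indicator \<Gamma>"] G by (simp add: \<nu>s Ns)
  have \<nu>split: "emeasure \<nu> \<Gamma> = indicator \<Gamma> x0 + (\<Sum>n. \<integral>\<^sup>+y. emeasure (transition M y (f y)) \<Gamma> \<partial>N n)" if G: "\<Gamma> \<in> sets (pos_measure M)" for \<Gamma>
  proof -
    have "emeasure \<nu> \<Gamma> = (\<Sum>n. emeasure (N (n + 1)) \<Gamma>) + (\<Sum>n<1. emeasure (N n) \<Gamma>)"
      unfolding \<nu>em[OF G] by (rule suminf_offset) (rule summableI)
    then show ?thesis using G by (simp add: q_em[OF G] N0 add.commute)
  qed
  have \<mu>rect: "emeasure \<mu> (\<Gamma> \<times> B) = emeasure \<nu> \<Gamma>" if G: "\<Gamma> \<in> sets (pos_measure M)" for \<Gamma>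
  proof -
    have GV: "\<Gamma> \<subseteq> V" using sets.sets_into_space[OF G] by simp
    have "\<Gamma> \<times> B \<in> sets PM" using G sets.top[of "action_measure M"] by (intro pair_measureI) simp_all
    then have "emeasure \<mu> (\<Gamma> \<times> B) = emeasure \<nu> ((\<lambda>y. (y, f y)) -` (\<Gamma> \<times> B) \<inter> space \<nu>)"
      unfolding \<mu>_def by (intro emeasure_distr pair\<nu>)
    also have "(\<lambda>y. (y, f y)) -` (\<Gamma> \<times> B) \<inter> space \<nu> = \<Gamma>"
      using GV f(2) VS sets_eq_imp_space_eq[OF \<nu>s] by auto
    finally show ?thesis .
  qed
  have bal: "emeasure \<mu> (\<Gamma> \<times> B) = indicator \<Gamma> x0 + (\<integral>\<^sup>+(y, b). emeasure (transition M y b) \<Gamma> \<partial>\<mu>)"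
    if G: "\<Gamma> \<in> sets (pos_measure M)" for \<Gamma>
    unfolding \<mu>rect[OF G] \<nu>split[OF G] using \<mu>int[OF transition_emeasure_measurable[OF G]] by (simp add: case_prod_beta')

  obtain K where K: "0 \<le> K" "\<And>y. y \<in> S \<Longrightarrow> optimal_value g y \<le> ennreal K"
    by (rule optimal_value_bounded) blast
  have ofin: "optimal_value g x0 < top" using le_less_trans[OF K(2)[OF VS[OF x0]] ennreal_less_top] .
  obtain \<delta> where \<delta>: "0 < \<delta>" "\<And>y b. y \<in> S \<Longrightarrow> b \<in> B \<Longrightarrow> ennreal \<delta> * emeasure (transition M y b) V \<le> cost M 0 y b"
    using survival_le_cost V_sets None_notin_V by metis
  have \<mu>sp: "space \<mu> = V \<times> B" using sets_eq_imp_space_eq[OF \<mu>s] by (simp add: space_PM)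
  have fin: "\<mu> \<in> finite_measures M"
  proof -
    let ?I = "\<integral>\<^sup>+z. emeasure (transition M (fst z) (snd z)) V \<partial>\<mu>"
    have "ennreal \<delta> * ?I = (\<integral>\<^sup>+z. ennreal \<delta> * emeasure (transition M (fst z) (snd z)) V \<partial>\<mu>)"
      using transition_emeasure_measurable[OF V_in_pos]
      by (intro nn_integral_cmult[symmetric]) (simp add: measurable_cong_sets[OF \<mu>s refl])
    also have "\<dots> \<le> (\<integral>\<^sup>+z. running g (fst z) (snd z) \<partial>\<mu>)"
    proof (rule nn_integral_mono)
      fix z assume "z \<in> space \<mu>"
      then have z: "fst z \<in> S" "snd z \<in> B" using V_subset \<mu>sp by auto
      have "cost M 0 (fst z) (snd z) \<le> running g (fst z) (snd z)"
        unfolding running_def by (rule add_increasing2) simp_all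
      with \<delta>(2)[OF z] show "ennreal \<delta> * emeasure (transition M (fst z) (snd z)) V \<le> running g (fst z) (snd z)"
        by (rule order_trans)
    qed
    also note run
    also note ofin
    finally have "?I < top" using \<delta>(1) by (auto simp: ennreal_mult_less_top)
    then have "emeasure \<mu> (space \<mu>) < top"
      unfolding \<mu>sp bal[OF V_in_pos] by (simp add: case_prod_beta' indicator_def)
    then show ?thesis using \<mu>s by (auto simp: finite_measures_def less_top[symmetric] intro: finite_measureI)
  qed
  have occ: "\<mu> \<in> occupation_measures M x0"
    using fin bal by (simp add: occupation_iff)

  have ic: "integrable \<mu> (real_cost j)" if "j \<le> num_constraints M" for j by (rule integrable_real_cost[OF fin that])
  have ir: "integrable \<mu> (real_running g)"
    unfolding real_running_def[abs_def] using ic by (intro Bochner_Integration.integrable_add Bochner_Integration.integrable_sum integrable_mult_right) auto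
  have "ennreal (\<integral>z. real_running g z \<partial>\<mu>) = (\<integral>\<^sup>+z. ennreal (real_running g z) \<partial>\<mu>)"
    using ir real_running_nonneg[OF g] by (intro nn_integral_eq_integral[symmetric]) auto
  also have "\<dots> = (\<integral>\<^sup>+z. running g (fst z) (snd z) \<partial>\<mu>)"
    using running_eq_real[OF g] \<mu>sp VS by (intro nn_integral_cong) auto
  also note run
  also have "optimal_value g x0 = ennreal (enn2real (optimal_value g x0))"
    by (rule ennreal_enn2real[OF ofin, symmetric])
  finally have "(\<integral>z. real_running g z \<partial>\<mu>) \<le> enn2real (optimal_value g x0)"
    by (subst (asm) ennreal_le_iff) auto
  moreover have "(\<integral>z. real_running g z \<partial>\<mu>) = (\<integral>z. real_cost 0 z \<partial>\<mu>) + (\<Sum>j=1..num_constraints M. g j * (\<integral>z. real_cost j z \<partial>\<mu>))"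
    unfolding real_running_def using ic
    by (subst Bochner_Integration.integral_add) (auto intro!: Bochner_Integration.integrable_sum simp: Bochner_Integration.integral_sum)
  ultimately have "lagrangian1 M \<mu> g \<le> ereal (enn2real (optimal_value g x0) - (\<Sum>j=1..num_constraints M. g j * constraint_bound M j))"
    unfolding lagrangian1_eq[OF fin] by (simp add: sum_subtractf algebra_simps)
  with occ show thesis by (rule that)
qed

end

text \<open>Balance and costs are affine in the measure. The statement records only the cost vectors, which is
  all that \<open>lagrange_multipliers\<close> sees.\<close>

lemma occupation_convex:
  assumes \<mu>: "\<mu> \<in> occupation_measures M x0" and \<nu>: "\<nu> \<in> occupation_measures M x0" and t: "0 \<le> t" "t \<le> 1"
  shows "\<exists>\<kappa>\<in>occupation_measures M x0. \<forall>j\<le>num_constraints M.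
    (\<integral>z. real_cost j z \<partial>\<kappa>) = t * (\<integral>z. real_cost j z \<partial>\<mu>) + (1 - t) * (\<integral>z. real_cost j z \<partial>\<nu>)"
proof -
  let ?\<kappa> = "add_measure (scale_measure (ennreal t) \<mu>) (scale_measure (ennreal (1 - t)) \<nu>)"
  note fin = occupation_finite[OF \<mu>] occupation_finite[OF \<nu>]
  note m = finite_measuresD[OF fin(1)] and n = finite_measuresD[OF fin(2)]
  interpret m: finite_measure \<mu> by (rule m)
  interpret n: finite_measure \<nu> by (rule n)
  have s: "sets (scale_measure (ennreal (1 - t)) \<nu>) = sets (scale_measure (ennreal t) \<mu>)"
    using m(1) n(1) by simp
  have s\<kappa>: "sets ?\<kappa> = sets PM" using m(1) by simp
  have int: "(\<integral>\<^sup>+z. h z \<partial>?\<kappa>) = ennreal t * (\<integral>\<^sup>+z. h z \<partial>\<mu>) + ennreal (1 - t) * (\<integral>\<^sup>+z. h z \<partial>\<nu>)"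
    if "h \<in> borel_measurable PM" for h
    using that by (simp add: nn_integral_add_measure[OF s] nn_integral_scale_measure measurable_cong_sets[OF m(1) refl] measurable_cong_sets[OF n(1) refl]
       measurable_cong_sets[OF sets_scale_measure refl])
  have em: "emeasure ?\<kappa> A = ennreal t * emeasure \<mu> A + ennreal (1 - t) * emeasure \<nu> A" if "A \<in> sets PM" for A
    using that m(1) by (subst emeasure_add_measure[OF s]) simp_all
  have "V \<times> B \<in> sets PM" using sets.top[of PM] by (simp add: space_PM)
  from em[OF this] have "emeasure ?\<kappa> (space ?\<kappa>) \<noteq> \<infinity>"
    using m(2) m.emeasure_finite n.emeasure_finite by (simp add: space_scale_measure ennreal_mult_eq_top_iff)
  then have fin\<kappa>: "?\<kappa> \<in> finite_measures M"
    using s\<kappa> by (auto simp: finite_measures_def intro: finite_measureI)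
  have t1: "ennreal t * c + ennreal (1 - t) * c = c" for c
    using t by (simp flip: distrib_right ennreal_plus)
  have "emeasure ?\<kappa> (\<Gamma> \<times> B) = indicator \<Gamma> x0 + (\<integral>\<^sup>+(y, b). emeasure (transition M y b) \<Gamma> \<partial>?\<kappa>)"
    if G: "\<Gamma> \<in> sets (pos_measure M)" for \<Gamma>
  proof -
    have GB: "\<Gamma> \<times> B \<in> sets PM" using G sets.top[of "action_measure M"] by (intro pair_measureI) simp_all
    have "emeasure ?\<kappa> (\<Gamma> \<times> B) = (ennreal t * indicator \<Gamma> x0 + ennreal (1 - t) * indicator \<Gamma> x0) +
      (ennreal t * (\<integral>\<^sup>+z. emeasure (transition M (fst z) (snd z)) \<Gamma> \<partial>\<mu>) + ennreal (1 - t) * (\<integral>\<^sup>+z. emeasure (transition M (fst z) (snd z)) \<Gamma> \<partial>\<nu>))"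
      unfolding em[OF GB] using \<mu> \<nu> G by (simp add: occupation_iff case_prod_beta' distrib_left ac_simps)
    then show ?thesis
      unfolding t1 int[OF transition_emeasure_measurable[OF G], symmetric] by (simp add: case_prod_beta')
  qed
  with fin\<kappa> have occ: "?\<kappa> \<in> occupation_measures M x0" by (simp add: occupation_iff)
  have "(\<integral>z. real_cost j z \<partial>?\<kappa>) = t * (\<integral>z. real_cost j z \<partial>\<mu>) + (1 - t) * (\<integral>z. real_cost j z \<partial>\<nu>)"
    if j: "j \<le> num_constraints M" for j
  proof -
    have nn: "(\<integral>\<^sup>+z. ennreal (real_cost j z) \<partial>\<rho>) = ennreal (\<integral>z. real_cost j z \<partial>\<rho>)" if "\<rho> \<in> finite_measures M" for \<rho>
      using integrable_real_cost[OF that j] by (intro nn_integral_eq_integral) auto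
    have "(\<lambda>z. ennreal (real_cost j z)) \<in> borel_measurable PM" using j by measurable
    from int[OF this] have "ennreal (\<integral>z. real_cost j z \<partial>?\<kappa>) = ennreal (t * (\<integral>z. real_cost j z \<partial>\<mu>) + (1 - t) * (\<integral>z. real_cost j z \<partial>\<nu>))"
      unfolding nn[OF fin(1)] nn[OF fin(2)] nn[OF fin\<kappa>] using t
      by (simp add: ennreal_mult ennreal_plus integral_nonneg_AE)
    then show ?thesis
      using t by (subst (asm) ennreal_inj) (auto intro!: add_nonneg_nonneg mult_nonneg_nonneg integral_nonneg_AE)
  qed
  with occ show ?thesis by blast
qed

end

end

section \<open>Duality\<close>

lemma multipliers_nonneg: "g \<in> multipliers M \<Longrightarrow> \<forall>j\<in>{1..num_constraints M}. 0 \<le> g j"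
  by (auto simp: multipliers_def PiE_iff)

text \<open>The Bellman function and the limit of value iteration agree on the state space but need not agree
  elsewhere in the type; feasibility depends only on the values on \<open>V\<close>.\<close>

lemma lp_feasible_cong:
  assumes eq: "\<And>x. x \<in> pos_states M \<Longrightarrow> W x = W' x" and W: "W \<in> lp_feasible M g"
  shows "W' \<in> lp_feasible M g"
proof -
  have sp: "space (pos_measure M) \<subseteq> pos_states M" by (simp add: space_restrict_space)
  have "W' \<in> borel_measurable (pos_measure M) \<longleftrightarrow> W \<in> borel_measurable (pos_measure M)"
    using sp eq by (intro measurable_cong) auto
  moreover have "W' ` pos_states M = W ` pos_states M" using eq by auto
  moreover have "(\<lambda>y. indicator (pos_states M) y *\<^sub>R W' y) = (\<lambda>y. indicator (pos_states M) y *\<^sub>R W y)"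
    using eq by (auto simp: indicator_def)
  ultimately show ?thesis
    using W eq by (simp add: lp_feasible_def test_functions_def set_lebesgue_integral_def)
qed

context bounded_semicontinuous_model
begin

lemma bellman_on_V: "x \<in> V \<Longrightarrow> bellman M g x = optimal_value g x"
  using bellman_eq V_subset by auto

lemma lsc_bellman: "lower_semicontinuous_map (subtopology (state_top M) V) (bellman M g)"
  unfolding lower_semicontinuous_map_def
proof
  fix c
  have "openin (state_top M) {x \<in> S. c < optimal_value g x}"
    using lsc_optimal_value by (auto simp: lower_semicontinuous_map_def)
  then have "openin (subtopology (state_top M) V) ({x \<in> S. c < optimal_value g x} \<inter> V)"
    by (auto simp: openin_subtopology)
  also have "{x \<in> S. c < optimal_value g x} \<inter> V = {x \<in> topspace (subtopology (state_top M) V). c < bellman M g x}"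
    using V_subset by (auto simp: bellman_on_V)
  finally show "openin (subtopology (state_top M) V) {x \<in> topspace (subtopology (state_top M) V). c < bellman M g x}" .
qed

lemma bellman_bounded: "\<exists>K::real. \<forall>x\<in>V. bellman M g x \<le> ennreal K"
proof -
  obtain K where "0 \<le> K" "\<And>y. y \<in> S \<Longrightarrow> optimal_value g y \<le> ennreal K"
    by (rule optimal_value_bounded) blast
  then show ?thesis using V_subset by (auto simp: bellman_on_V)
qed

context
  fixes x0
  assumes x0: "x0 \<in> V"
begin

abbreviation "bellman_fun g \<equiv> (\<lambda>x. enn2real (bellman M g x))"
abbreviation "penalty g \<equiv> (\<Sum>j=1..num_constraints M. g j * constraint_bound M j)"

lemma bellman_finite: "bellman M g x0 = ennreal (bellman_fun g x0)"
proof -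
  obtain K where "0 \<le> K" "\<And>y. y \<in> S \<Longrightarrow> optimal_value g y \<le> ennreal K"
    by (rule optimal_value_bounded) blast
  with x0 V_subset have "optimal_value g x0 \<le> ennreal K" by auto
  from le_less_trans[OF this ennreal_less_top] show ?thesis
    unfolding bellman_on_V[OF x0] by (rule ennreal_enn2real[symmetric])
qed

context
  fixes g
  assumes g: "g \<in> multipliers M"
begin

lemma bellman_feasible: "bellman_fun g \<in> lp_feasible M g"
  by (rule lp_feasible_cong[OF _ optimal_value_feasible[OF x0 multipliers_nonneg[OF g]]])
     (simp add: bellman_on_V)

lemma optimal_measure:
  obtains \<mu> where "\<mu> \<in> occupation_measures M x0" "lagrangian1 M \<mu> g \<le> ereal (bellman_fun g x0 - penalty g)"
  unfolding bellman_on_V[OF x0]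
  by (rule optimal_occupation_measure[OF x0 multipliers_nonneg[OF g]]) blast

text \<open>Evaluation at one measure in \<open>\<D>\<close>, the optimal occupation measure, where \<open>W\<close> drops out of the
  Lagrangian.\<close>

lemma dual_objective_le:
  assumes W: "W \<in> test_functions M"
  shows "dual_objective M x0 W g \<le> ereal (bellman_fun g x0 - penalty g)"
proof -
  obtain \<mu> where \<mu>: "\<mu> \<in> occupation_measures M x0" "lagrangian1 M \<mu> g \<le> ereal (bellman_fun g x0 - penalty g)"
    by (rule optimal_measure)
  have "dual_objective M x0 W g \<le> lagrangian2 M x0 \<mu> W g"
    unfolding dual_objective_def by (intro INF_lower occupation_finite[OF x0 \<mu>(1)])
  also have "\<dots> = lagrangian1 M \<mu> g" by (rule lagrangian2_occupation[OF x0 \<mu>(1) W])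
  also note \<mu>(2)
  finally show ?thesis .
qed

lemma dual_objective_feasible_ge:
  assumes "W \<in> lp_feasible M g"
  shows "ereal (W x0 - penalty g) \<le> dual_objective M x0 W g"
  unfolding dual_objective_def by (intro INF_greatest lagrangian2_ge[OF x0 assms])

lemma bellman_test: "bellman_fun g \<in> test_functions M"
  using bellman_feasible by (simp add: lp_feasible_def)

lemma dual_objective_bellman: "dual_objective M x0 (bellman_fun g) g = ereal (bellman_fun g x0 - penalty g)"
  by (intro antisym dual_objective_le bellman_test dual_objective_feasible_ge bellman_feasible)

text \<open>A feasible \<open>W\<close> bounds the dual objective from below by its own value in \<open>x\<^sub>0\<close>, and
  \<open>dual_objective_le\<close> bounds it from above by the value of the Bellman function.\<close>

lemma lp_solution_bellman: "lp_solution M x0 g (bellman_fun g)"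
proof -
  have "W x0 \<le> bellman_fun g x0" if W: "W \<in> lp_feasible M g" for W
    using order_trans[OF dual_objective_feasible_ge[OF W] dual_objective_le] W by (simp add: lp_feasible_def)
  then show ?thesis using bellman_feasible by (simp add: lp_solution_def)
qed

lemma lp_value_bellman: "lp_value M x0 g = enn2ereal (bellman M g x0)"
proof -
  have "lp_value M x0 g = ereal (bellman_fun g x0)"
    unfolding lp_value_def using lp_solution_bellman
    by (intro antisym SUP_least SUP_upper2[of "bellman_fun g"]) (auto simp: lp_solution_def)
  then show ?thesis by (subst bellman_finite) simp
qed

lemma dual_fun_bellman: "dual_fun M x0 g = ereal (bellman_fun g x0 - penalty g)"
proof (rule antisym)
  obtain \<mu> where \<mu>: "\<mu> \<in> occupation_measures M x0" "lagrangian1 M \<mu> g \<le> ereal (bellman_fun g x0 - penalty g)"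
    by (rule optimal_measure)
  then show "dual_fun M x0 g \<le> ereal (bellman_fun g x0 - penalty g)"
    unfolding dual_fun_def by (rule INF_lower2)
  show "ereal (bellman_fun g x0 - penalty g) \<le> dual_fun M x0 g"
    unfolding dual_fun_def
  proof (rule INF_greatest)
    fix \<mu> assume \<mu>: "\<mu> \<in> occupation_measures M x0"
    show "ereal (bellman_fun g x0 - penalty g) \<le> lagrangian1 M \<mu> g"
      using lagrangian2_ge[OF x0 bellman_feasible occupation_finite[OF x0 \<mu>]]
      by (simp add: lagrangian2_occupation[OF x0 \<mu> bellman_test])
  qed
qed

lemma SUP_dual_objective: "(SUP W\<in>test_functions M. dual_objective M x0 W g) = dual_fun M x0 g"
  unfolding dual_fun_bellman
  by (intro antisym SUP_least dual_objective_le SUP_upper2[of "bellman_fun g"] bellman_test)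
     (simp_all add: dual_objective_bellman)

end

text \<open>On feasible measures in \<open>\<D>\<close> the bracket vanishes and the penalties are nonpositive, so the supremum
  of \<open>L\<^sub>2\<close> is at most the primary cost. Hence the infimum of these suprema is a lower bound \<open>p\<close> for the constrained
  problem, and Lagrange multipliers for this \<open>p\<close> give \<open>h(g) \<ge> p\<close>.\<close>

lemma strong_duality:
  assumes slater: "slater_condition M x0"
  obtains g where "g \<in> multipliers M"
    "(INF \<mu>\<in>finite_measures M. SUP (W, g)\<in>test_functions M \<times> multipliers M. lagrangian2 M x0 \<mu> W g) \<le> dual_fun M x0 g"
proof -
  let ?L = "INF \<mu>\<in>finite_measures M. SUP (W, g)\<in>test_functions M \<times> multipliers M. lagrangian2 M x0 \<mu> W g"
  let ?D = "occupation_measures M x0"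
  define c where "c j \<mu> = (\<integral>z. real_cost j z \<partial>\<mu>)" for j and \<mu> :: "('x option \<times> ennreal \<times> 'a) measure"
  let ?h = "\<lambda>j \<mu>. c j \<mu> - constraint_bound M j"
  have L1: "lagrangian1 M \<mu> g = ereal (c 0 \<mu> + (\<Sum>j=1..num_constraints M. g j * ?h j \<mu>))" if "\<mu> \<in> ?D" for \<mu> g
    unfolding c_def by (rule lagrangian1_eq[OF occupation_finite[OF x0 that]])
  have feasible: "?L \<le> ereal (c 0 \<mu>)" if \<mu>: "\<mu> \<in> ?D" and h: "\<forall>j\<in>{1..num_constraints M}. ?h j \<mu> \<le> 0" for \<mu>
  proof (rule INF_lower2[OF occupation_finite[OF x0 \<mu>]], rule SUP_least)
    fix p assume "p \<in> test_functions M \<times> multipliers M"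
    then obtain W g where p: "p = (W, g)" "W \<in> test_functions M" "g \<in> multipliers M" by auto
    have "(\<Sum>j=1..num_constraints M. g j * ?h j \<mu>) \<le> 0"
      using h multipliers_nonneg[OF p(3)] by (intro sum_nonpos mult_nonneg_nonpos) auto
    then show "(case p of (W, g) \<Rightarrow> lagrangian2 M x0 \<mu> W g) \<le> ereal (c 0 \<mu>)"
      by (simp add: p(1) lagrangian2_occupation[OF x0 \<mu> p(2)] L1[OF \<mu>])
  qed
  obtain \<mu>s where \<mu>s: "\<mu>s \<in> ?D" "\<forall>j\<in>{1..num_constraints M}. cost_integral M j \<mu>s < ennreal (constraint_bound M j)"
    using slater by (auto simp: slater_condition_def)
  have sl: "?h j \<mu>s < 0" if j: "j \<in> {1..num_constraints M}" for j
  proof -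
    have "cost_integral M j \<mu>s = ennreal (c j \<mu>s)"
      unfolding c_def using j by (intro cost_integral_eq occupation_finite[OF x0 \<mu>s(1)]) auto
    moreover have "0 \<le> c j \<mu>s" unfolding c_def by (rule integral_nonneg_AE) simp
    moreover have "cost_integral M j \<mu>s < ennreal (constraint_bound M j)" using \<mu>s(2) j by blast
    ultimately show ?thesis by (simp add: ennreal_less_iff)
  qed
  \<comment> \<open>Weak duality with zero multipliers keeps the infimum away from \<open>-\<infinity>\<close>.\<close>
  define g0 :: "nat \<Rightarrow> real" where "g0 = restrict (\<lambda>_. 0) {1..num_constraints M}"
  have g0: "g0 \<in> multipliers M" by (auto simp: g0_def multipliers_def)
  have "ereal (bellman_fun g0 x0 - penalty g0) = dual_objective M x0 (bellman_fun g0) g0"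
    by (rule dual_objective_bellman[OF g0, symmetric])
  also have "\<dots> \<le> ?L"
    unfolding dual_objective_def
    by (intro INF_mono) (auto intro!: bexI SUP_upper2[of "(bellman_fun g0, g0)"] bellman_test[OF g0] g0)
  finally have low: "?L \<noteq> - \<infinity>" by auto
  have "?L \<le> ereal (c 0 \<mu>s)" using sl by (intro feasible \<mu>s(1)) (auto intro: less_imp_le)
  then have "?L \<noteq> \<infinity>" by auto
  with low obtain p where p: "?L = ereal p" by (cases ?L) auto
  have "\<exists>g. (\<forall>j. 0 \<le> g j) \<and> (\<forall>\<mu>\<in>?D. p \<le> c 0 \<mu> + (\<Sum>j=1..num_constraints M. g j * ?h j \<mu>))"
  proof (rule lagrange_multipliers)
    fix \<mu> \<nu> and t :: real assume *: "\<mu> \<in> ?D" "\<nu> \<in> ?D" "0 \<le> t" "t \<le> 1"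
    from occupation_convex[OF x0 this] obtain \<kappa> where \<kappa>: "\<kappa> \<in> ?D"
      "\<And>j. j \<le> num_constraints M \<Longrightarrow> c j \<kappa> = t * c j \<mu> + (1 - t) * c j \<nu>" unfolding c_def by blast
    then show "\<exists>\<kappa>\<in>?D. c 0 \<kappa> = t * c 0 \<mu> + (1 - t) * c 0 \<nu> \<and>
        (\<forall>j\<in>{1..num_constraints M}. ?h j \<kappa> = t * ?h j \<mu> + (1 - t) * ?h j \<nu>)"
      by (intro bexI[of _ \<kappa>]) (auto simp: algebra_simps)
  next
    show "\<exists>\<mu>\<in>?D. \<forall>j\<in>{1..num_constraints M}. ?h j \<mu> < 0" using \<mu>s(1) sl by blast
  next
    show "p \<le> c 0 \<mu>" if "\<mu> \<in> ?D" "\<forall>j\<in>{1..num_constraints M}. ?h j \<mu> \<le> 0" for \<mu>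
      using feasible[OF that] p by simp
  qed
  then obtain g where g: "\<And>j. 0 \<le> g j" "\<And>\<mu>. \<mu> \<in> ?D \<Longrightarrow> p \<le> c 0 \<mu> + (\<Sum>j=1..num_constraints M. g j * ?h j \<mu>)"
    by blast
  show thesis
  proof (rule that[of "restrict g {1..num_constraints M}"])
    show "restrict g {1..num_constraints M} \<in> multipliers M" using g(1) by (auto simp: multipliers_def)
    show "?L \<le> dual_fun M x0 (restrict g {1..num_constraints M})"
      unfolding dual_fun_def p using g(2) by (intro INF_greatest) (simp add: L1)
  qed
qed

end

end

theorem theorem3:
  fixes M :: "('x::polish_space, 'a::polish_space) impulse_model"
    and x0 :: "'x option"
  assumes "valid_model M"
    and "x0 \<in> pos_states M"
    and "semicontinuous_mdp M"
    and "slater_condition M x0"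
    and "cost_conditions M"
  shows "(\<forall>g\<in>multipliers M.
            (\<exists>K::real. \<forall>x\<in>pos_states M. bellman M g x \<le> ennreal K) \<and>
            (\<forall>x\<in>pos_states M. 0 \<le> bellman M g x) \<and>
            lower_semicontinuous_map (subtopology (state_top M) (pos_states M)) (bellman M g) \<and>
            lp_solution M x0 g (\<lambda>x. enn2real (bellman M g x)) \<and>
            lp_value M x0 g = enn2ereal (bellman M g x0))
       \<and> (\<forall>g\<in>multipliers M.
            enn2ereal (bellman M g x0)
              - ereal (\<Sum>j=1..num_constraints M. g j * constraint_bound M j) = dual_fun M x0 g)
       \<and> (\<forall>g\<in>multipliers M. \<exists>W. is_maximizer (test_functions M) (\<lambda>W. dual_objective M x0 W g) W)
       \<and> (SUP g\<in>multipliers M. SUP W\<in>test_functions M. dual_objective M x0 W g)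
           = (SUP g\<in>multipliers M. dual_fun M x0 g)
       \<and> (\<exists>g. is_maximizer (multipliers M)
                (\<lambda>g. SUP W\<in>test_functions M. dual_objective M x0 W g) g \<and>
              is_maximizer (multipliers M) (dual_fun M x0) g)
       \<and> (\<forall>g. is_maximizer (multipliers M)
                (\<lambda>g. SUP W\<in>test_functions M. dual_objective M x0 W g) g \<or>
              is_maximizer (multipliers M) (dual_fun M x0) g \<longrightarrow>
            is_maximizer (test_functions M \<times> multipliers M)
              (\<lambda>(W, g). dual_objective M x0 W g) (\<lambda>x. enn2real (bellman M g x), g))
       \<and> (INF \<mu>\<in>finite_measures M. SUP (W, g)\<in>test_functions M \<times> multipliers M.
             lagrangian2 M x0 \<mu> W g)
           = (SUP (W, g)\<in>test_functions M \<times> multipliers M. INF \<mu>\<in>finite_measures M.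
             lagrangian2 M x0 \<mu> W g)"
proof -
  interpret bounded_semicontinuous_model M
    using assms by unfold_locales
  note x0 = assms(2)
  let ?T = "test_functions M" and ?G = "multipliers M"
  let ?sup = "\<lambda>g. SUP W\<in>?T. dual_objective M x0 W g"
  let ?L = "INF \<mu>\<in>finite_measures M. SUP (W, g)\<in>?T \<times> ?G. lagrangian2 M x0 \<mu> W g"
  let ?R = "SUP (W, g)\<in>?T \<times> ?G. INF \<mu>\<in>finite_measures M. lagrangian2 M x0 \<mu> W g"
  have R: "?R = (SUP (W, g)\<in>?T \<times> ?G. dual_objective M x0 W g)"
    by (simp add: dual_objective_def)
  have sup_eq: "?sup g = dual_fun M x0 g" if "g \<in> ?G" for g
    by (rule SUP_dual_objective[OF x0 that])
  have max_iff: "is_maximizer ?G ?sup g \<longleftrightarrow> is_maximizer ?G (dual_fun M x0) g" for g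
    using sup_eq by (auto simp: is_maximizer_def)
  have bellman_attains: "dual_objective M x0 (\<lambda>x. enn2real (bellman M g x)) g = dual_fun M x0 g" if "g \<in> ?G" for g
    unfolding dual_fun_bellman[OF x0 that] by (rule dual_objective_bellman[OF x0 that])
  have obj_le: "dual_objective M x0 W g \<le> dual_fun M x0 g" if "W \<in> ?T" "g \<in> ?G" for W g
    unfolding dual_fun_bellman[OF x0 that(2)] by (rule dual_objective_le[OF x0 that(2,1)])
  have weak: "?R \<le> ?L"
    by (intro INF_greatest SUP_least) (auto intro!: INF_lower2 SUP_upper2)
  have dual_le_R: "dual_fun M x0 g \<le> ?R" if "g \<in> ?G" for g
    unfolding R bellman_attains[OF that, symmetric]
    by (rule SUP_upper2[of "(\<lambda>x. enn2real (bellman M g x), g)"]) (auto intro: bellman_test[OF x0 that] that)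
  obtain gs where gs: "gs \<in> ?G" "?L \<le> dual_fun M x0 gs"
    by (rule strong_duality[OF x0 assms(4)])
  have gs_max: "is_maximizer ?G (dual_fun M x0) gs"
    using gs order_trans[OF dual_le_R order_trans[OF weak gs(2)]] by (auto simp: is_maximizer_def)
  show ?thesis
  proof (intro conjI ballI allI impI)
    fix g assume g: "g \<in> ?G"
    show "\<exists>K::real. \<forall>x\<in>pos_states M. bellman M g x \<le> ennreal K" by (rule bellman_bounded)
    show "lower_semicontinuous_map (subtopology (state_top M) (pos_states M)) (bellman M g)"
      by (rule lsc_bellman)
    show "lp_solution M x0 g (\<lambda>x. enn2real (bellman M g x))" by (rule lp_solution_bellman[OF x0 g])
    show "lp_value M x0 g = enn2ereal (bellman M g x0)" by (rule lp_value_bellman[OF x0 g])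
    show "enn2ereal (bellman M g x0)
        - ereal (\<Sum>j=1..num_constraints M. g j * constraint_bound M j) = dual_fun M x0 g"
      unfolding dual_fun_bellman[OF x0 g] by (subst bellman_finite[OF x0]) simp
    show "\<exists>W. is_maximizer ?T (\<lambda>W. dual_objective M x0 W g) W"
      using obj_le[OF _ g] bellman_attains[OF g] bellman_test[OF x0 g]
      by (intro exI[of _ "\<lambda>x. enn2real (bellman M g x)"]) (simp add: is_maximizer_def)
  next
    show "(SUP g\<in>?G. ?sup g) = (SUP g\<in>?G. dual_fun M x0 g)"
      by (intro SUP_cong refl sup_eq)
    show "\<exists>g. is_maximizer ?G ?sup g \<and> is_maximizer ?G (dual_fun M x0) g"
      using gs_max max_iff by blast
    show "?L = ?R"
      using weak order_trans[OF gs(2) dual_le_R[OF gs(1)]] by (rule antisym[rotated])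
  next
    fix g assume "is_maximizer ?G ?sup g \<or> is_maximizer ?G (dual_fun M x0) g"
    then have g: "g \<in> ?G" "\<And>g'. g' \<in> ?G \<Longrightarrow> dual_fun M x0 g' \<le> dual_fun M x0 g"
      unfolding max_iff by (auto simp: is_maximizer_def)
    have "dual_objective M x0 W' g' \<le> dual_fun M x0 g" if "W' \<in> ?T" "g' \<in> ?G" for W' g'
      using order_trans[OF obj_le[OF that] g(2)[OF that(2)]] .
    then show "is_maximizer (?T \<times> ?G) (\<lambda>(W, g). dual_objective M x0 W g) (\<lambda>x. enn2real (bellman M g x), g)"
      using g(1) bellman_test[OF x0 g(1)] bellman_attains[OF g(1)] by (auto simp: is_maximizer_def)
  qed simp
qed

end
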